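(* Let $\delta\in[0,1]$, let $P_d$ be a probability distribution on $\mathbb{Z}_+=\{0,1,2,\dots\}$, and let $\mu_s$ be a symmetric probability distribution on $(-\infty,+\infty]$. Let $\mathcal{Q}_s$ be the associated BP operator on symmetric distributions. Exclude the exceptional case in which $\mu_s=\delta_0$ (no survey), $d=1$ almost surely under $P_d$, and $\delta\in\{0,1\}$ (in which case $\mathcal{Q}_s$ is the identity operator). Then there exists at most one non-trivial symmetric BP fixed point $\mu^*$. Moreover, for all non-trivial symmetric $\mu$, the sequence $\mathcal{Q}_s^h\mu$ converges weakly as $h\to\infty$ to the same fixed point: to $\mu^*$ if it exists, and to the trivial distribution $\delta_0$ otherwise.
   Context: A probability distribution $\mu$ on $(-\infty,+\infty]$ is called symmetric if $\mu[E]=\int e^{-r}\mathbf{1}\{-r\in E\}\,d\mu(r)$ for every measurable $E\subseteq(-\infty,+\infty)$ (i.e. $d\mu(r)=e^{r}d\mu(-r)$; an atom at $+\infty$ is allowed). The trivial distribution is $\delta_0$, the unit mass at $0$ (not to be confused with the parameter $\delta$). Weak convergence is that of probability measures on $(-\infty,+\infty]$ (test functions: bounded functions continuous on $(-\infty,+\infty]$). BP operator: for symmetric $\mu$, $\mathcal{Q}_s\mu$ is the law of $$R=\sum_{u=1}^d Z_uF_\delta(\tilde R_u)+S,\qquad F_\delta(x)=\ln\frac{(1-\delta)e^x+\delta}{\delta e^x+1-\delta}=2\tanh^{-1}\!\Big((1-2\delta)\tanh\frac{x}{2}\Big),$$ where $d\sim P_d$, $\tilde R_u\sim\mu$ i.i.d.,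 $Z_u$ i.i.d. with $\mathbb{P}[Z_u=-1]=\delta$, $\mathbb{P}[Z_u=1]=1-\delta$, $S\sim\mu_s$, all jointly independent, with $F_\delta(+\infty)$ defined by continuity. A symmetric $\mu$ is a BP fixed point if $\mathcal{Q}_s\mu=\mu$. *)

theory Defs
  imports "HOL-Probability.Probability" "HOL-Real_Asymp.Real_Asymp"
begin

(* A distribution on (-oo, +oo] is a Borel measure on ereal that gives mass 0 to -oo. *)
definition half_extended_distribution :: "ereal measure \<Rightarrow> bool" where
  "half_extended_distribution \<mu> \<longleftrightarrow>
     prob_space \<mu> \<and> sets \<mu> = sets borel \<and> emeasure \<mu> {-\<infinity>} = 0"

(* E ranges over sets of finite values, so -r \<in> E forces r to be finite and the value
   of real_of_ereal at the infinities plays no role. *)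
definition symmetric_distribution :: "ereal measure \<Rightarrow> bool" where
  "symmetric_distribution \<mu> \<longleftrightarrow>
     half_extended_distribution \<mu> \<and>
     (\<forall>E \<in> sets borel. E \<subseteq> {-\<infinity><..<\<infinity>} \<longrightarrow>
        emeasure \<mu> E =
          (\<integral>\<^sup>+ r. ennreal (exp (- real_of_ereal r)) * indicator E (- r) \<partial>\<mu>))"

definition trivial_distribution :: "ereal measure" where
  "trivial_distribution = return borel 0"

(* The test functions are only constrained on (-oo, +oo]; the integrals are over that set. *)
definition weakly_converges :: "(nat \<Rightarrow> ereal measure) \<Rightarrow> ereal measure \<Rightarrow> bool" where
  "weakly_converges M \<mu> \<longleftrightarrow>
     (\<forall>f :: ereal \<Rightarrow> real. continuous_on {-\<infinity><..} f \<and> bounded (f ` {-\<infinity><..}) \<longrightarrow>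
        (\<lambda>h. LINT r:{-\<infinity><..}|M h. f r) \<longlonglongrightarrow> (LINT r:{-\<infinity><..}|\<mu>. f r))"

definition bp_F_real :: "real \<Rightarrow> real \<Rightarrow> real" where
  "bp_F_real \<delta> x = ln (((1 - \<delta>) * exp x + \<delta>) / (\<delta> * exp x + 1 - \<delta>))"

(* At the infinities: the limits of bp_F_real, see bp_F_tendsto_PInfty and bp_F_tendsto_MInfty. *)
definition bp_F :: "real \<Rightarrow> ereal \<Rightarrow> ereal" where
  "bp_F \<delta> r = (case r of
       ereal x \<Rightarrow> ereal (bp_F_real \<delta> x)
     | PInfty \<Rightarrow>
         (if \<delta> = 0 then \<infinity> else if \<delta> = 1 then -\<infinity> else ereal (ln ((1 - \<delta>) / \<delta>)))
     | MInfty \<Rightarrow>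
         (if \<delta> = 0 then -\<infinity> else if \<delta> = 1 then \<infinity> else ereal (ln (\<delta> / (1 - \<delta>)))))"

lemma bp_F_simps [simp]:
  "bp_F \<delta> (ereal x) = ereal (bp_F_real \<delta> x)"
  "bp_F \<delta> \<infinity> =
     (if \<delta> = 0 then \<infinity> else if \<delta> = 1 then -\<infinity> else ereal (ln ((1 - \<delta>) / \<delta>)))"
  "bp_F \<delta> (-\<infinity>) =
     (if \<delta> = 0 then -\<infinity> else if \<delta> = 1 then \<infinity> else ereal (ln (\<delta> / (1 - \<delta>))))"
  by (simp_all add: bp_F_def flip: PInfty_eq_infinity MInfty_eq_minfinity)

definition flip_sign_pmf :: "real \<Rightarrow> real pmf" where
  "flip_sign_pmf \<delta> = map_pmf (\<lambda>b. if b then -1 else 1) (bernoulli_pmf \<delta>)"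

(* For symmetric \<mu> and \<mu>\<^sub>s all summands are almost surely different from -oo, so the
   convention of ereal for \<infinity> + (-\<infinity>) is irrelevant. Only the first d coordinates of the two
   infinite i.i.d. sequences are used. *)
definition bp_operator ::
    "real \<Rightarrow> nat pmf \<Rightarrow> ereal measure \<Rightarrow> ereal measure \<Rightarrow> ereal measure" where
  "bp_operator \<delta> P\<^sub>d \<mu>\<^sub>s \<mu> =
     distr
       (measure_pmf P\<^sub>d \<Otimes>\<^sub>M
        ((\<Pi>\<^sub>M u\<in>(UNIV :: nat set). measure_pmf (flip_sign_pmf \<delta>)) \<Otimes>\<^sub>M
         ((\<Pi>\<^sub>M u\<in>(UNIV :: nat set). \<mu>) \<Otimes>\<^sub>M \<mu>\<^sub>s)))
       borel
       (\<lambda>(d, Z, R, S). (\<Sum>u = 1..d. ereal (Z u) * bp_F \<delta> (R u)) + S)"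

definition bp_fixed_point ::
    "real \<Rightarrow> nat pmf \<Rightarrow> ereal measure \<Rightarrow> ereal measure \<Rightarrow> bool" where
  "bp_fixed_point \<delta> P\<^sub>d \<mu>\<^sub>s \<mu> \<longleftrightarrow>
     symmetric_distribution \<mu> \<and> bp_operator \<delta> P\<^sub>d \<mu>\<^sub>s \<mu> = \<mu>"

definition nontrivial_bp_fixed_point ::
    "real \<Rightarrow> nat pmf \<Rightarrow> ereal measure \<Rightarrow> ereal measure \<Rightarrow> bool" where
  "nontrivial_bp_fixed_point \<delta> P\<^sub>d \<mu>\<^sub>s \<mu> \<longleftrightarrow>
     bp_fixed_point \<delta> P\<^sub>d \<mu>\<^sub>s \<mu> \<and> \<mu> \<noteq> trivial_distribution"

lemma bp_F_real_fraction_pos: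
  assumes "0 \<le> \<delta>" "\<delta> \<le> 1"
  shows "0 < (1 - \<delta>) * exp x + \<delta>" "0 < \<delta> * exp x + 1 - (\<delta> :: real)"
proof -
  show "0 < (1 - \<delta>) * exp x + \<delta>"
  proof (cases "\<delta> = 0")
    case False
    then show ?thesis using assms by (intro add_nonneg_pos) auto
  qed simp
  show "0 < \<delta> * exp x + 1 - \<delta>"
  proof (cases "\<delta> = 1")
    case False
    then have "0 < \<delta> * exp x + (1 - \<delta>)" using assms by (intro add_nonneg_pos) auto
    then show ?thesis by simp
  qed simp
qed

lemma bp_F_real_eq_artanh:
  assumes "0 \<le> \<delta>" "\<delta> \<le> 1"
  shows "bp_F_real \<delta> x = 2 * artanh ((1 - 2 * \<delta>) * tanh (x / 2))"
proof -
  let ?a = "(1 - \<delta>) * exp x + \<delta>" and ?b = "\<delta> * exp x + 1 - \<delta>"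
  have e: "exp x + 1 > 0" by (simp add: add_pos_pos)
  have "tanh (x / 2) = (1 - exp (- x)) / (1 + exp (- x))"
    by (simp add: tanh_real_altdef)
  also have "\<dots> = (exp x - 1) / (exp x + 1)"
  proof -
    have "exp x * exp (- x) = 1" by (simp add: exp_minus)
    then have "exp x * (1 - exp (- x)) = exp x - 1" "exp x * (1 + exp (- x)) = exp x + 1"
      by (simp_all add: algebra_simps)
    then show ?thesis by (metis exp_not_eq_zero mult_divide_mult_cancel_left)
  qed
  finally have t: "tanh (x / 2) = (exp x - 1) / (exp x + 1)" .
  have n: "1 + (1 - 2 * \<delta>) * tanh (x / 2) = 2 * ?a / (exp x + 1)"
    using e unfolding t by (simp add: field_simps)
  have d: "1 - (1 - 2 * \<delta>) * tanh (x / 2) = 2 * ?b / (exp x + 1)"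
    using e unfolding t by (simp add: field_simps)
  have "(2 * p / c) / (2 * q / c) = p / q" if "c \<noteq> 0" for p q c :: real
    using that by simp
  then have "(2 * ?a / (exp x + 1)) / (2 * ?b / (exp x + 1)) = ?a / ?b"
    using e by (metis less_irrefl)
  then show ?thesis
    unfolding artanh_def n d bp_F_real_def by simp
qed

lemma bp_F_tendsto_PInfty:
  assumes "0 \<le> \<delta>" "\<delta> \<le> 1"
  shows "((\<lambda>x. bp_F \<delta> (ereal x)) \<longlongrightarrow> bp_F \<delta> \<infinity>) at_top"
proof -
  consider "\<delta> = 0" | "\<delta> = 1" | "0 < \<delta>" "\<delta> < 1" using assms by linarith
  then show ?thesis
  proof cases
    case 1
    then show ?thesis
      by (simp add: bp_F_real_def tendsto_PInfty_eq_at_top filterlim_ident)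
  next
    case 2
    have "((\<lambda>x. - ereal x) \<longlongrightarrow> - \<infinity>) at_top"
      by (intro tendsto_uminus_ereal) (simp add: tendsto_PInfty_eq_at_top filterlim_ident)
    then show ?thesis using 2 by (simp add: bp_F_real_def ln_div)
  next
    case 3
    then have "((\<lambda>x. bp_F_real \<delta> x) \<longlongrightarrow> ln ((1 - \<delta>) / \<delta>)) at_top"
      unfolding bp_F_real_def by (real_asymp simp: divide_inverse)
    then show ?thesis using 3 by simp
  qed
qed

lemma bp_F_tendsto_MInfty:
  assumes "0 \<le> \<delta>" "\<delta> \<le> 1"
  shows "((\<lambda>x. bp_F \<delta> (ereal x)) \<longlongrightarrow> bp_F \<delta> (-\<infinity>)) at_bot"
proof -
  have odd_F: "bp_F \<delta> (- y) = - bp_F \<delta> y" for y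
  proof (cases y)
    case (real x)
    have x: "exp x * exp (- x) = 1" by (simp add: exp_minus)
    have "exp x * ((1 - \<delta>) * exp (- x) + \<delta>) = \<delta> * exp x + 1 - \<delta>"
      "exp x * (\<delta> * exp (- x) + 1 - \<delta>) = (1 - \<delta>) * exp x + \<delta>"
      using x by algebra+
    then have "((1 - \<delta>) * exp (- x) + \<delta>) / (\<delta> * exp (- x) + 1 - \<delta>)
        = (\<delta> * exp x + 1 - \<delta>) / ((1 - \<delta>) * exp x + \<delta>)"
      by (metis exp_not_eq_zero mult_divide_mult_cancel_left)
    then have "bp_F_real \<delta> (- x) = - bp_F_real \<delta> x"
      using bp_F_real_fraction_pos[OF assms, of x] by (simp add: bp_F_real_def ln_div)
    then show ?thesis using real by simp
  next
    case PInf
    then show ?thesis using assms by (simp add: ln_div)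
  next
    case MInf
    then show ?thesis using assms by (simp add: ln_div)
  qed
  have "((\<lambda>x. - bp_F \<delta> (ereal x)) \<longlongrightarrow> - bp_F \<delta> \<infinity>) at_top"
    by (intro tendsto_uminus_ereal bp_F_tendsto_PInfty assms)
  then show ?thesis
    by (simp add: filterlim_at_bot_mirror odd_F flip: uminus_ereal.simps(1) del: bp_F_simps)
qed

lemma measurable_bp_F [measurable]: "bp_F \<delta> \<in> borel_measurable borel"
proof -
  have [measurable]: "(\<lambda>x. bp_F_real \<delta> x) \<in> borel_measurable borel"
    unfolding bp_F_real_def by measurable
  have "bp_F \<delta> = (\<lambda>y. if y = \<infinity> then bp_F \<delta> \<infinity> else if y = -\<infinity> then bp_F \<delta> (-\<infinity>)
      else ereal (bp_F_real \<delta> (real_of_ereal y)))"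
    by (rule ext, rename_tac y, case_tac y) auto
  also have "\<dots> \<in> borel_measurable borel" by measurable
  finally show ?thesis .
qed

(* distr is degenerate for non-measurable functions; this shows that bp_operator is a true law. *)
lemma measurable_bp_sum:
  assumes [measurable_cong]: "sets \<mu> = sets borel" "sets \<mu>\<^sub>s = sets borel"
  shows "(\<lambda>(d, Z, R, S). (\<Sum>u = 1..d. ereal (Z u) * bp_F \<delta> (R u)) + S) \<in> borel_measurable
       (measure_pmf P\<^sub>d \<Otimes>\<^sub>M
        ((\<Pi>\<^sub>M u\<in>(UNIV :: nat set). measure_pmf (flip_sign_pmf \<delta>)) \<Otimes>\<^sub>M
         ((\<Pi>\<^sub>M u\<in>(UNIV :: nat set). \<mu>) \<Otimes>\<^sub>M \<mu>\<^sub>s)))" (is "?f \<in> borel_measurable ?N")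
proof -
  have [measurable]: "(\<lambda>z. ereal z) \<in> borel_measurable (measure_pmf (flip_sign_pmf \<delta>))"
    by simp
  have "(\<lambda>w. (\<lambda>d w. (\<Sum>u = 1..d. ereal (fst (snd w) u) * bp_F \<delta> (fst (snd (snd w)) u))
       + snd (snd (snd w))) (fst w) w) \<in> borel_measurable ?N"
  proof (rule measurable_compose_countable)
    show "fst \<in> ?N \<rightarrow>\<^sub>M count_space UNIV"
      by measurable
  next
    fix d
    have [measurable]: "(\<lambda>w. ereal (fst (snd w) u)) \<in> borel_measurable ?N" for u
      by measurable
    show "(\<lambda>w. (\<Sum>u = 1..d. ereal (fst (snd w) u) * bp_F \<delta> (fst (snd (snd w)) u))
       + snd (snd (snd w))) \<in> borel_measurable ?N"
      by measurable
  qed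
  then show ?thesis by (simp add: case_prod_beta')
qed

end

(*
  Write tau r = tanh (r/2). A symmetric law is a mixture of binary symmetric channels, so it is
  determined by the law of |tau|, and even by the function a \<mapsto> E max(|tau|, a) on [0,1]. Pointwise order
  of these functions is channel degradation; it is preserved by the BP operator Q, and a one-parameter
  family of degradations is given by the binary symmetric channels B_t, which replace |tau| by t |tau|.
  The stringy tree inequality B_t (mu * nu) <= B_t mu * B_t nu gives B_t (Q mu) <= Q (B_t mu).
  For two nontrivial fixed points let t be maximal with B_t mu <= nu. If t < 1, the stringy tree
  inequality is strict enough to make the order between B_t mu and nu strict at every a up to the top of
  the support, so t could be increased; hence mu <= nu, and by symmetry mu = nu. Convergence follows by
  sandwiching Q^h mu between the increasing iterates of B_t mu* and the decreasing iterates of the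
  point mass at infinity: monotone iterates converge to fixed points by Helly's theorem.
*)
theory Submission
  imports Defs
begin

section \<open>The hyperbolic tangent coordinate and symmetric laws\<close>

text \<open>An equality \<open>mag (noise e \<mu>) a = mag \<nu> a\<close> at a single point cannot
  be refuted locally: for a sum of two observations the stringy tree inequality is strict only if
  \<open>a\<close> lies in a window between their difference and their sum. So the proof takes the
  largest point of equality and pushes it further up. Both fixed points are averages over the
  degree, hence equality holds for each degree that occurs, and then between any two laws of a chain
  that joins the two sides. A convolution averages \<open>mag\<close> of one factor over the others,
  so each equality can be read off at any support point of those others; the tops of the supports
  are the informative ones. Above the top of a support nothing has to be shown, because there
  \<open>mag\<close> is the identity. With unbounded degrees the top of a fixed point need not be
  attained by any degree, which is why a quantitative gap is carried along. The family of
  comparisons starts at an explicit scale: scaling |tau| by its mean under \<nu>, positive for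
  nontrivial \<nu>, already puts \<mu> below \<nu>.\<close>

text \<open>For a log-likelihood ratio r this is the posterior mean of a uniform sign: noise becomes
  multiplication, and both infinities become ordinary end points.\<close>

definition tau :: "ereal \<Rightarrow> real" where
  "tau r = (case r of ereal x \<Rightarrow> tanh (x / 2) | PInfty \<Rightarrow> 1 | MInfty \<Rightarrow> -1)"

lemma tau_simps [simp]: "tau (ereal x) = tanh (x / 2)" "tau \<infinity> = 1" "tau (-\<infinity>) = -1"
  by (simp_all add: tau_def flip: PInfty_eq_infinity MInfty_eq_minfinity)

lemma tau_zero [simp]: "tau 0 = 0"
  by (simp add: zero_ereal_def)

lemma tau_uminus [simp]: "tau (- r) = - tau r"
  by (cases r) (simp_all add: tanh_minus)

lemma tau_bounds: "- 1 \<le> tau r" "tau r \<le> 1"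
proof (atomize(full), cases r)
  case (real x)
  then show "- 1 \<le> tau r \<and> tau r \<le> 1"
    using tanh_real_bounds[of "x / 2"] by auto
qed auto

lemma abs_tau_le_1: "\<bar>tau r\<bar> \<le> 1"
  using tau_bounds[of r] by auto

lemma tau_eq_iff: "tau r = tau s \<longleftrightarrow> r = s"
proof
  assume *: "tau r = tau s"
  have lt: "tanh (x / 2) < 1" "- 1 < tanh (x / 2)" for x :: real
    using tanh_real_bounds[of "x / 2"] by auto
  show "r = s"
    using * lt[of "real_of_ereal r"] lt[of "real_of_ereal s"]
    by (cases r; cases s) auto
qed simp

lemma tau_eq_minus_1_iff: "tau r = -1 \<longleftrightarrow> r = -\<infinity>"
  using tau_eq_iff[of r "-\<infinity>"] by simp

lemma tau_eq_1_iff: "tau r = 1 \<longleftrightarrow> r = \<infinity>"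
  using tau_eq_iff[of r "\<infinity>"] by simp

lemma tau_mult_eq_minus_1:
  assumes "tau x * tau y = -1"
  shows "tau x = 1 \<and> tau y = -1 \<or> tau x = -1 \<and> tau y = 1"
proof -
  have "\<bar>tau x\<bar> * \<bar>tau y\<bar> = 1" using assms by (simp flip: abs_mult)
  then have "\<bar>tau x\<bar> = 1" "\<bar>tau y\<bar> = 1"
    using abs_tau_le_1[of x] abs_tau_le_1[of y]
    by (smt (verit) mult_left_le mult_left_le_one_le abs_ge_zero)+
  then show ?thesis using assms by (auto simp: abs_if split: if_splits)
qed

lemma one_minus_tau_le_2: "\<bar>1 - tau r\<bar> \<le> 2"
  using tau_bounds[of r] by auto

lemma one_minus_tau_indicator_le_2: "\<bar>(1 - tau r) * indicator A x\<bar> \<le> 2"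
  using one_minus_tau_le_2[of r] by (simp add: indicator_def)

lemma measurable_tau [measurable]: "tau \<in> borel_measurable borel"
proof -
  have [measurable]: "(\<lambda>x::real. tanh (x / 2)) \<in> borel_measurable borel"
    by (intro borel_measurable_continuous_onI continuous_intros) auto
  have "tau = (\<lambda>y. if y = \<infinity> then 1 else if y = -\<infinity> then -1 else tanh (real_of_ereal y / 2))"
    by (rule ext, rename_tac y, case_tac y) auto
  also have "\<dots> \<in> borel_measurable borel" by measurable
  finally show ?thesis .
qed

text \<open>The excluded product belongs to opposite infinities, where \<open>ereal\<close> yields
  \<infinity> while the quotient is 0 / 0. Later uses exclude this case or give it weight
  zero.\<close>

lemma tau_add:
  assumes "tau r * tau s \<noteq> -1"
  shows "tau (r + s) = (tau r + tau s) / (1 + tau r * tau s)"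
proof (cases r; cases s)
  fix x y assume rs: "r = ereal x" "s = ereal y"
  have "tanh (x / 2 + y / 2) = (tanh (x / 2) + tanh (y / 2)) / (1 + tanh (x / 2) * tanh (y / 2))"
    by (rule tanh_add) auto
  then show ?thesis using rs by (simp add: add_divide_distrib)
next
  fix x assume rs: "r = ereal x" "s = \<infinity>"
  have "1 + tanh (x / 2) > 0" using tanh_real_bounds[of "x / 2"] by auto
  then show ?thesis using rs by simp
next
  fix x assume rs: "r = ereal x" "s = -\<infinity>"
  have "1 - tanh (x / 2) > 0" using tanh_real_bounds[of "x / 2"] by auto
  then show ?thesis using rs by (simp add: field_simps)
next
  fix x assume rs: "s = ereal x" "r = \<infinity>"
  have "1 + tanh (x / 2) > 0" using tanh_real_bounds[of "x / 2"] by auto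
  then show ?thesis using rs by simp
next
  fix x assume rs: "s = ereal x" "r = -\<infinity>"
  have "1 - tanh (x / 2) > 0" using tanh_real_bounds[of "x / 2"] by auto
  then show ?thesis using rs by (simp add: field_simps)
qed (use assms in auto)

lemma tanh_half: "tanh (x / 2 :: real) = (exp x - 1) / (exp x + 1)"
proof -
  have "tanh (x / 2) = (1 - exp (- x)) / (1 + exp (- x))"
    by (simp add: tanh_real_altdef)
  also have "\<dots> = (exp x * (1 - exp (- x))) / (exp x * (1 + exp (- x)))"
    by simp
  also have "\<dots> = (exp x - 1) / (exp x + 1)"
    by (simp add: algebra_simps exp_minus)
  finally show ?thesis .
qed

lemma tanh_artanh:
  assumes "\<bar>y\<bar> < (1 :: real)"
  shows "tanh (artanh y) = y"
proof -
  have "artanh y = ln ((1 + y) / (1 - y)) / 2" by (simp add: artanh_def)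
  moreover have "exp (ln ((1 + y) / (1 - y))) = (1 + y) / (1 - y)"
    using assms by (intro exp_ln) (auto simp: field_simps)
  ultimately have "tanh (artanh y) = ((1 + y) / (1 - y) - 1) / ((1 + y) / (1 - y) + 1)"
    by (simp only: tanh_half)
  also have "(1 + y) / (1 - y) - 1 = 2 * y / (1 - y)"
    using assms by (simp add: divide_simps)
  also have "(1 + y) / (1 - y) + 1 = 2 / (1 - y)"
    using assms by (simp add: divide_simps)
  finally show ?thesis
    using assms by simp
qed

lemma tau_bp_F:
  assumes "0 \<le> \<delta>" "\<delta> \<le> 1"
  shows "tau (bp_F \<delta> r) = (1 - 2 * \<delta>) * tau r"
proof -
  \<comment> \<open>The values of \<open>bp_F\<close> at the two infinities are both of this form,
    for e = \<delta> and for e = 1 - \<delta>.\<close>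
  have *: "tanh (ln ((1 - e) / e) / 2) = 1 - 2 * e" if "0 < e" "e < 1" for e :: real
    unfolding tanh_half using that by (simp add: field_simps)
  show ?thesis
  proof (cases r)
    case (real x)
    have "\<bar>1 - 2 * \<delta>\<bar> \<le> 1" using assms by auto
    moreover have "\<bar>tanh (x / 2)\<bar> < 1" using tanh_real_bounds[of "x / 2"] by auto
    ultimately have "\<bar>(1 - 2 * \<delta>) * tanh (x / 2)\<bar> < 1"
      by (metis abs_mult abs_ge_zero mult_le_cancel_right1 mult_right_le_one_le mult.commute order.strict_trans1)
    then show ?thesis
      using real assms by (simp add: bp_F_real_eq_artanh tanh_artanh)
  next
    case PInf
    then show ?thesis using *[of \<delta>] assms by auto
  next
    case MInf
    then show ?thesis using *[of "1 - \<delta>"] assms by auto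
  qed
qed

section \<open>Symmetry as invariance of a weighted measure\<close>

lemma symmetric_distributionD:
  assumes "symmetric_distribution \<mu>"
  shows "prob_space \<mu>" "sets \<mu> = sets borel" "AE r in \<mu>. r \<noteq> -\<infinity>" "space \<mu> = UNIV"
proof -
  have *: "prob_space \<mu>" "sets \<mu> = sets borel" "emeasure \<mu> {-\<infinity>} = 0"
    using assms by (auto simp: symmetric_distribution_def half_extended_distribution_def)
  show "prob_space \<mu>" "sets \<mu> = sets borel" by fact+
  show "space \<mu> = UNIV" using sets_eq_imp_space_eq[OF *(2)] by simp
  show "AE r in \<mu>. r \<noteq> -\<infinity>"
    by (rule AE_I[where N="{-\<infinity>}"]) (use * in auto)
qed

lemma uminus_vimage_borel [measurable]:
  "A \<in> sets borel \<Longrightarrow> uminus -` (A :: ereal set) \<in> sets borel"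
  using measurable_sets[of uminus borel borel A] by simp

text \<open>The defining identity as an equality of measures, so that integrals of arbitrary
  functions can be transported. Restricting to finite values removes the atom at
  \<infinity>.\<close>

lemma symmetric_measure_eq:
  assumes "symmetric_distribution \<mu>"
  defines "F \<equiv> {-\<infinity><..<\<infinity>} :: ereal set"
  shows "density \<mu> (indicator F) =
    distr (density \<mu> (\<lambda>r. ennreal (exp (- real_of_ereal r) * indicator F r))) borel uminus"
proof (rule measure_eqI)
  note [simp] = symmetric_distributionD[OF assms(1)]
  note [measurable_cong] = symmetric_distributionD(2)[OF assms(1)]
  have [measurable]: "F \<in> sets borel" by (simp add: F_def)
  show "sets (density \<mu> (indicator F)) = sets (distr (density \<mu> (\<lambda>r. ennreal (exp (- real_of_ereal r) * indicator F r))) borel uminus)"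
    by simp
  fix A assume "A \<in> sets (density \<mu> (indicator F))"
  then have [measurable]: "A \<in> sets borel" by simp
  have F: "- r \<in> F \<longleftrightarrow> r \<in> F" for r by (cases r) (auto simp: F_def)
  have "emeasure (density \<mu> (indicator F)) A = emeasure \<mu> (A \<inter> F)"
  proof -
    have "emeasure (density \<mu> (indicator F)) A = (\<integral>\<^sup>+r. indicator F r * indicator A r \<partial>\<mu>)"
      by (rule emeasure_density) auto
    also have "\<dots> = (\<integral>\<^sup>+r. indicator (A \<inter> F) r \<partial>\<mu>)"
      by (intro nn_integral_cong) (auto simp: indicator_def)
    finally show ?thesis by simp
  qed
  also have "\<dots> = (\<integral>\<^sup>+ r. ennreal (exp (- real_of_ereal r)) * indicator (A \<inter> F) (- r) \<partial>\<mu>)"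
    using assms(1) unfolding symmetric_distribution_def by (auto simp: F_def)
  also have "\<dots> = (\<integral>\<^sup>+ r. ennreal (exp (- real_of_ereal r) * indicator F r) * indicator (uminus -` A) r \<partial>\<mu>)"
    by (intro nn_integral_cong) (auto simp: indicator_def F)
  also have "\<dots> = emeasure (distr (density \<mu> (\<lambda>r. ennreal (exp (- real_of_ereal r) * indicator F r))) borel uminus) A"
  proof -
    let ?D = "density \<mu> (\<lambda>r. ennreal (exp (- real_of_ereal r) * indicator F r))"
    have "emeasure (distr ?D borel uminus) A = emeasure ?D (uminus -` A \<inter> space ?D)"
      by (rule emeasure_distr) auto
    also have "\<dots> = (\<integral>\<^sup>+ r. ennreal (exp (- real_of_ereal r) * indicator F r) * indicator (uminus -` A \<inter> space ?D) r \<partial>\<mu>)"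
      by (rule emeasure_density) (auto simp: measurable_sets_borel)
    finally show ?thesis by simp
  qed
  finally show "emeasure (density \<mu> (indicator F)) A = \<dots>" .
qed

text \<open>Trades the factor exp (-r) of the symmetry condition for the bounded weights 1 + tau and
  1 - tau.\<close>

lemma tau_exp: 
  assumes "r \<noteq> \<infinity>" "r \<noteq> -\<infinity>"
  shows "exp (- real_of_ereal r) * (1 + tau r) = 1 - tau r"
proof -
  obtain x where r: "r = ereal x" using assms by (cases r) auto
  have "exp x + 1 > 0" by (simp add: add_pos_pos)
  then have "1 + (exp x - 1) / (exp x + 1) = 2 * exp x / (exp x + 1)"
    "1 - (exp x - 1) / (exp x + 1) = 2 / (exp x + 1)"
    by (simp_all add: field_simps)
  moreover have "exp (- x) * (2 * exp x / (exp x + 1)) = 2 / (exp x + 1)"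
    by (simp add: exp_minus)
  ultimately show ?thesis by (simp add: r tanh_half)
qed

text \<open>The weight \<open>1 - tau\<close> vanishes at \<open>\<infinity>\<close>, so that symmetry becomes invariance of the
  weighted measure under negation, without a case distinction for the atom at \<open>\<infinity>\<close>.\<close>

lemma symmetric_flip:
  fixes h :: "ereal \<Rightarrow> real"
  assumes "symmetric_distribution \<mu>" and [measurable]: "h \<in> borel_measurable borel"
  shows "(\<integral>r. (1 - tau r) * h r \<partial>\<mu>) = (\<integral>r. (1 - tau r) * h (- r) \<partial>\<mu>)"
proof -
  define F where "F = ({-\<infinity><..<\<infinity>} :: ereal set)"
  note s = symmetric_distributionD[OF assms(1)]
  note [measurable_cong] = s(2)
  have [measurable]: "F \<in> sets borel" by (simp add: F_def)
  have 1: "(\<lambda>r. indicator F r :: ennreal) = (\<lambda>r. ennreal (indicator F r))"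
    by (auto simp: indicator_def)
  have nF: "r \<in> F \<longleftrightarrow> r \<noteq> \<infinity> \<and> r \<noteq> -\<infinity>" for r by (cases r) (auto simp: F_def)
  have "(\<integral>r. (1 - tau r) * h r \<partial>\<mu>) = (\<integral>r. indicator F r *\<^sub>R ((1 - tau r) * h r) \<partial>\<mu>)"
    by (rule integral_cong_AE) (use s(3) in \<open>auto simp: nF indicator_def\<close>)
  also have "\<dots> = (\<integral>r. (1 - tau r) * h r \<partial>density \<mu> (indicator F))"
    unfolding 1 by (subst integral_density) auto
  also have "\<dots> = (\<integral>r. (1 - tau (- r)) * h (- r) \<partial>density \<mu> (\<lambda>r. ennreal (exp (- real_of_ereal r) * indicator F r)))"
    unfolding symmetric_measure_eq[OF assms(1), folded F_def]
    by (subst integral_distr) auto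
  also have "\<dots> = (\<integral>r. (exp (- real_of_ereal r) * indicator F r) *\<^sub>R ((1 - tau (- r)) * h (- r)) \<partial>\<mu>)"
    by (subst integral_density) auto
  also have "\<dots> = (\<integral>r. (1 - tau r) * h (- r) \<partial>\<mu>)"
  proof (rule integral_cong_AE)
    show "AE r in \<mu>. (exp (- real_of_ereal r) * indicator F r) *\<^sub>R ((1 - tau (- r)) * h (- r)) = (1 - tau r) * h (- r)"
      using s(3)
    proof eventually_elim
      case (elim r)
      then show ?case
        using tau_exp[of r] by (cases "r = \<infinity>") (auto simp: nF indicator_def mult.assoc[symmetric])
    qed
  qed auto
  finally show ?thesis .
qed

text \<open>Converse of \<open>symmetric_flip\<close>: at finite r the weight 1 - tau is positive,
  so dividing by it recovers the original condition from the invariance of the weighted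
  measure.\<close>

lemma symmetric_distributionI:
  assumes "prob_space \<mu>" and sets: "sets \<mu> = sets borel" and "AE r in \<mu>. r \<noteq> -\<infinity>"
    and flip: "\<And>A. A \<in> sets borel \<Longrightarrow>
       (\<integral>r. (1 - tau r) * indicator A r \<partial>\<mu>) = (\<integral>r. (1 - tau r) * indicator A (- r) \<partial>\<mu>)"
  shows "symmetric_distribution \<mu>"
proof -
  interpret prob_space \<mu> by fact
  note [measurable_cong] = sets
  have sp [simp]: "space \<mu> = UNIV" using sets_eq_imp_space_eq[OF sets] by simp
  have null: "emeasure \<mu> {-\<infinity>} = 0"
    using assms(3) sets by (subst (asm) AE_iff_measurable[where N="{-\<infinity>}"]) auto
  define D where "D = density \<mu> (\<lambda>r. ennreal (1 - tau r))"
  have nn: "0 \<le> 1 - tau r" "0 \<le> 1 + tau r" for r using tau_bounds[of r] by auto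
  have int: "integrable \<mu> (\<lambda>r. (1 - tau r) * indicator A (f r))"
    if [measurable]: "A \<in> sets borel" "f \<in> borel_measurable borel" for A and f :: "ereal \<Rightarrow> ereal"
  proof (rule integrable_const_bound[where B=2])
    show "AE r in \<mu>. norm ((1 - tau r) * indicator A (f r)) \<le> 2"
      by (intro AE_I2) (simp add: one_minus_tau_indicator_le_2)
  qed measurable
  have D: "D = distr D borel uminus"
  proof (rule measure_eqI)
    show "sets D = sets (distr D borel uminus)" using sets by (simp add: D_def)
    fix A assume "A \<in> sets D"
    then have [measurable]: "A \<in> sets borel" using sets by (simp add: D_def)
    have "emeasure D A = (\<integral>\<^sup>+r. ennreal ((1 - tau r) * indicator A r) \<partial>\<mu>)"
      unfolding D_def by (subst emeasure_density) (auto simp: indicator_def intro!: nn_integral_cong)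
    also have "\<dots> = ennreal (\<integral>r. (1 - tau r) * indicator A r \<partial>\<mu>)"
      using int[of A "\<lambda>x. x"] nn by (subst nn_integral_eq_integral) auto
    also have "\<dots> = ennreal (\<integral>r. (1 - tau r) * indicator A (- r) \<partial>\<mu>)"
      by (subst flip) auto
    also have "\<dots> = (\<integral>\<^sup>+r. ennreal ((1 - tau r) * indicator A (- r)) \<partial>\<mu>)"
      using int[of A uminus] nn by (subst nn_integral_eq_integral) auto
    also have "\<dots> = emeasure (distr D borel uminus) A"
    proof -
      have [measurable_cong]: "sets D = sets borel" using sets by (simp add: D_def)
      have "emeasure (distr D borel uminus) A = emeasure D (uminus -` A \<inter> space D)"
        by (rule emeasure_distr) measurable
      also have "space D = UNIV" by (simp add: D_def)
      also have "emeasure D (uminus -` A \<inter> UNIV) = (\<integral>\<^sup>+r. ennreal (1 - tau r) * indicator (uminus -` A) r \<partial>\<mu>)"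
        unfolding D_def by (subst emeasure_density) (auto simp: sets)
      finally show ?thesis by (auto simp: indicator_def intro!: nn_integral_cong)
    qed
    finally show "emeasure D A = emeasure (distr D borel uminus) A" .
  qed
  have Dsets [measurable_cong]: "sets D = sets borel" using sets by (simp add: D_def)
  have "emeasure \<mu> E = (\<integral>\<^sup>+ r. ennreal (exp (- real_of_ereal r)) * indicator E (- r) \<partial>\<mu>)"
    if [measurable]: "E \<in> sets borel" and E: "E \<subseteq> {-\<infinity><..<\<infinity>}" for E
  proof -
    \<comment> \<open>Density of E with respect to the weighted measure D; the reflection of D then
      acts on g alone.\<close>
    define g where "g r = ennreal (1 / (1 - tau r) * indicator E r)" for r
    have [measurable]: "g \<in> borel_measurable borel" unfolding g_def by measurable
    have fin: "1 - tau r > 0" "1 + tau r > 0" if "r \<in> E" for r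
      using that E tau_eq_1_iff[of r] tau_eq_minus_1_iff[of r] nn[of r] by (force simp: less_le)+
    have "ennreal (1 - tau r) * g r = indicator E r" for r
      using fin[of r] nn[of r]
      by (cases "r \<in> E") (auto simp: g_def ennreal_mult[symmetric])
    then have "emeasure \<mu> E = (\<integral>\<^sup>+ r. ennreal (1 - tau r) * g r \<partial>\<mu>)"
      by (simp add: sets)
    also have "\<dots> = (\<integral>\<^sup>+ r. g r \<partial>D)"
      unfolding D_def by (subst nn_integral_density) auto
    also have "\<dots> = (\<integral>\<^sup>+ r. g (- r) \<partial>D)"
      by (subst D, subst nn_integral_distr) auto
    also have "\<dots> = (\<integral>\<^sup>+ r. ennreal (1 - tau r) * g (- r) \<partial>\<mu>)"
      unfolding D_def by (subst nn_integral_density) auto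
    also have "\<dots> = (\<integral>\<^sup>+ r. ennreal (exp (- real_of_ereal r)) * indicator E (- r) \<partial>\<mu>)"
    proof (rule nn_integral_cong, cases)
      fix r assume r: "- r \<in> E"
      have "r \<noteq> \<infinity>" "r \<noteq> -\<infinity>" using r E by auto
      then have "exp (- real_of_ereal r) = (1 - tau r) / (1 + tau r)"
        using tau_exp[of r] fin[OF r] by (simp add: field_simps)
      then show "ennreal (1 - tau r) * g (- r) = ennreal (exp (- real_of_ereal r)) * indicator E (- r)"
        using r fin[OF r] by (simp add: g_def ennreal_mult[symmetric] nn)
    qed (simp add: g_def)
    finally show ?thesis .
  qed
  then show ?thesis
    using assms null by (auto simp: symmetric_distribution_def half_extended_distribution_def)
qed

lemma (in prob_space) integrable_bounded:
  fixes f :: "'a \<Rightarrow> real"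
  assumes "f \<in> borel_measurable M" "\<And>x. x \<in> space M \<Longrightarrow> \<bar>f x\<bar> \<le> B"
  shows "integrable M f"
  by (rule integrable_const_bound[where B=B]) (use assms in auto)

lemma symmetric_integrable:
  fixes h :: "ereal \<Rightarrow> real"
  assumes "symmetric_distribution \<mu>" "h \<in> borel_measurable borel" "\<And>r. \<bar>h r\<bar> \<le> B"
  shows "integrable \<mu> h"
proof -
  interpret prob_space \<mu> using symmetric_distributionD[OF assms(1)] by simp
  show ?thesis
    by (rule integrable_bounded[of _ B])
      (use assms(2,3) symmetric_distributionD(2)[OF assms(1)] in \<open>simp_all cong: measurable_cong_sets\<close>)
qed

text \<open>The mixture of binary symmetric channels without conditioning on |tau|: by
  \<open>symmetric_flip\<close> the second summand integrates to the same value as (1 - tau) / 2 * h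
  r, and the two weights add up to 1.\<close>

lemma symmetric_mix:
  fixes h :: "ereal \<Rightarrow> real"
  assumes s: "symmetric_distribution \<mu>" and [measurable]: "h \<in> borel_measurable borel"
    and B: "\<And>r. \<bar>h r\<bar> \<le> B"
  shows "(\<integral>r. h r \<partial>\<mu>) = (\<integral>r. (1 + tau r) / 2 * h r + (1 - tau r) / 2 * h (- r) \<partial>\<mu>)"
proof -
  have i: "integrable \<mu> (\<lambda>r. (1 - tau r) * h r)" "integrable \<mu> (\<lambda>r. (1 + tau r) * h r)"
     "integrable \<mu> (\<lambda>r. (1 - tau r) * h (- r))"
  proof -
    have B': "\<bar>c * h r\<bar> \<le> 2 * B" if "\<bar>c\<bar> \<le> 2" for c r
      unfolding abs_mult using that B[of r] by (intro mult_mono) auto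
    have c: "\<bar>1 - tau r\<bar> \<le> 2" "\<bar>1 + tau r\<bar> \<le> 2" for r using tau_bounds[of r] by auto
    show "integrable \<mu> (\<lambda>r. (1 - tau r) * h r)"
      by (rule symmetric_integrable[OF s _ B'[OF c(1)]]) measurable
    show "integrable \<mu> (\<lambda>r. (1 + tau r) * h r)"
      by (rule symmetric_integrable[OF s _ B'[OF c(2)]]) measurable
    show "integrable \<mu> (\<lambda>r. (1 - tau r) * h (- r))"
      by (rule symmetric_integrable[OF s _ B'[OF c(1)]]) measurable
  qed
  have "(\<integral>r. (1 + tau r) / 2 * h r + (1 - tau r) / 2 * h (- r) \<partial>\<mu>)
     = (\<integral>r. (1 + tau r) * h r / 2 + (1 - tau r) * h (- r) / 2 \<partial>\<mu>)"
    by simp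
  also have "\<dots> = (\<integral>r. (1 + tau r) * h r \<partial>\<mu>) / 2 + (\<integral>r. (1 - tau r) * h (- r) \<partial>\<mu>) / 2"
    using i by (subst Bochner_Integration.integral_add) auto
  also have "\<dots> = (\<integral>r. (1 + tau r) * h r \<partial>\<mu>) / 2 + (\<integral>r. (1 - tau r) * h r \<partial>\<mu>) / 2"
    using symmetric_flip[OF s, of h] by simp
  also have "\<dots> = (\<integral>r. (1 + tau r) * h r / 2 + (1 - tau r) * h r / 2 \<partial>\<mu>)"
    using i by (subst Bochner_Integration.integral_add) auto
  also have "\<dots> = (\<integral>r. h r \<partial>\<mu>)"
    by (intro Bochner_Integration.integral_cong) (auto simp: field_simps)
  finally show ?thesis ..
qed

section \<open>Convolution and binary symmetric noise\<close>

lemma symmetric_integral_bound: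
  fixes h :: "ereal \<Rightarrow> real"
  assumes "symmetric_distribution \<mu>" "h \<in> borel_measurable borel" "\<And>r. \<bar>h r\<bar> \<le> B"
  shows "\<bar>\<integral>r. h r \<partial>\<mu>\<bar> \<le> B"
proof -
  interpret prob_space \<mu> using symmetric_distributionD[OF assms(1)] by simp
  note i = symmetric_integrable[OF assms]
  have "\<bar>\<integral>r. h r \<partial>\<mu>\<bar> \<le> (\<integral>r. \<bar>h r\<bar> \<partial>\<mu>)"
    by (rule integral_abs_bound)
  also have "\<dots> \<le> (\<integral>r. B \<partial>\<mu>)"
    using i assms(3) by (intro integral_mono) auto
  finally show ?thesis by (simp add: prob_space)
qed

lemma symmetric_measurable_integral:
  fixes f :: "ereal \<Rightarrow> ereal \<Rightarrow> real"
  assumes "symmetric_distribution \<nu>"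
    and [measurable]: "(\<lambda>(x, y). f x y) \<in> borel_measurable (borel \<Otimes>\<^sub>M borel)"
  shows "(\<lambda>x. \<integral>y. f x y \<partial>\<nu>) \<in> borel_measurable borel"
proof -
  interpret prob_space \<nu> using symmetric_distributionD[OF assms(1)] by simp
  note [measurable_cong] = symmetric_distributionD(2)[OF assms(1)]
  show ?thesis by measurable
qed

text \<open>\<open>symmetric_mix\<close> in y and then in x. The four sign patterns are grouped by
  whether the signs agree, because later cancellations happen inside each group.\<close>

lemma symmetric_mix2:
  fixes f :: "ereal \<Rightarrow> ereal \<Rightarrow> real"
  assumes \<mu>: "symmetric_distribution \<mu>" and \<nu>: "symmetric_distribution \<nu>"
    and [measurable]: "(\<lambda>(x, y). f x y) \<in> borel_measurable (borel \<Otimes>\<^sub>M borel)"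
    and B: "\<And>x y. \<bar>f x y\<bar> \<le> B"
  shows "(\<integral>x. \<integral>y. f x y \<partial>\<nu> \<partial>\<mu>) = (\<integral>x. \<integral>y.
      ((1 + tau x) * (1 + tau y) * f x y + (1 - tau x) * (1 - tau y) * f (- x) (- y)) / 4 +
      ((1 + tau x) * (1 - tau y) * f x (- y) + (1 - tau x) * (1 + tau y) * f (- x) y) / 4 \<partial>\<nu> \<partial>\<mu>)"
proof -
  define g where "g x y = (1 + tau y) / 2 * f x y + (1 - tau y) / 2 * f x (- y)" for x y
  have [measurable]: "(\<lambda>(x, y). g x y) \<in> borel_measurable (borel \<Otimes>\<^sub>M borel)"
    unfolding g_def by measurable
  have w: "(1 + tau x) / 2 * g x y + (1 - tau x) / 2 * g (- x) y =
      ((1 + tau x) * (1 + tau y) * f x y + (1 - tau x) * (1 - tau y) * f (- x) (- y)) / 4 +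
      ((1 + tau x) * (1 - tau y) * f x (- y) + (1 - tau x) * (1 + tau y) * f (- x) y) / 4" for x y
    by (simp add: g_def field_simps)
  have gB: "\<bar>g x y\<bar> \<le> B" for x y
  proof -
    have "\<bar>g x y\<bar> \<le> \<bar>(1 + tau y) / 2 * f x y\<bar> + \<bar>(1 - tau y) / 2 * f x (- y)\<bar>"
      unfolding g_def by (rule abs_triangle_ineq)
    also have "\<dots> \<le> (1 + tau y) / 2 * B + (1 - tau y) / 2 * B"
      unfolding abs_mult using tau_bounds[of y] B by (intro add_mono mult_mono) auto
    also have "\<dots> = B" by (simp add: field_simps)
    finally show ?thesis .
  qed
  have ig: "integrable \<nu> (\<lambda>y. c * g x y)" for x c
    by (intro integrable_mult_right symmetric_integrable[OF \<nu> _ gB]) measurable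
  have "(\<integral>x. \<integral>y. f x y \<partial>\<nu> \<partial>\<mu>) = (\<integral>x. \<integral>y. g x y \<partial>\<nu> \<partial>\<mu>)"
    unfolding g_def by (subst symmetric_mix[OF \<nu> _ B]) auto
  also have "\<dots> = (\<integral>x. (1 + tau x) / 2 * (\<integral>y. g x y \<partial>\<nu>) + (1 - tau x) / 2 * (\<integral>y. g (- x) y \<partial>\<nu>) \<partial>\<mu>)"
    by (rule symmetric_mix[OF \<mu> symmetric_measurable_integral[OF \<nu>]
          symmetric_integral_bound[OF \<nu> _ gB]]) measurable
  also have "\<dots> = (\<integral>x. \<integral>y. (1 + tau x) / 2 * g x y + (1 - tau x) / 2 * g (- x) y \<partial>\<nu> \<partial>\<mu>)"
    by (subst Bochner_Integration.integral_add[OF ig ig]) simp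
  finally show ?thesis unfolding w .
qed

text \<open>Combines independent observations of the same bit. Addition on \<open>ereal\<close> is
  associative and commutative at the infinities too, so the algebraic laws below are not restricted
  to symmetric measures.\<close>

definition iconv :: "ereal measure \<Rightarrow> ereal measure \<Rightarrow> ereal measure"  (infixr "\<star>\<star>" 70) where
  "\<mu> \<star>\<star> \<nu> = distr (\<mu> \<Otimes>\<^sub>M \<nu>) borel (\<lambda>(x, y). x + y)"

text \<open>The observation of a bit through a binary symmetric channel with crossover probability
  e.\<close>

definition noise :: "real \<Rightarrow> ereal measure \<Rightarrow> ereal measure" where
  "noise e \<mu> = distr (measure_pmf (flip_sign_pmf e) \<Otimes>\<^sub>M \<mu>) borel (\<lambda>(z, r). ereal z * bp_F e r)"

lemma sets_iconv [simp, measurable_cong]: "sets (\<mu> \<star>\<star> \<nu>) = sets borel"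
  by (simp add: iconv_def)

lemma sets_noise [simp, measurable_cong]: "sets (noise e \<mu>) = sets borel"
  by (simp add: noise_def)

lemma nn_integral_iconv:
  assumes \<mu>: "prob_space \<mu>" "sets \<mu> = sets borel" and \<nu>: "prob_space \<nu>" "sets \<nu> = sets borel"
    and [measurable]: "h \<in> borel_measurable borel"
  shows "(\<integral>\<^sup>+r. h r \<partial>(\<mu> \<star>\<star> \<nu>)) = (\<integral>\<^sup>+x. \<integral>\<^sup>+y. h (x + y) \<partial>\<nu> \<partial>\<mu>)"
proof -
  interpret \<mu>: prob_space \<mu> by fact
  interpret \<nu>: prob_space \<nu> by fact
  note [measurable_cong] = \<mu>(2) \<nu>(2)
  have "(\<integral>\<^sup>+r. h r \<partial>(\<mu> \<star>\<star> \<nu>)) = (\<integral>\<^sup>+p. h (case p of (x, y) \<Rightarrow> x + y) \<partial>(\<mu> \<Otimes>\<^sub>M \<nu>))"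
    unfolding iconv_def by (subst nn_integral_distr) auto
  also have "\<dots> = (\<integral>\<^sup>+x. \<integral>\<^sup>+y. h (x + y) \<partial>\<nu> \<partial>\<mu>)"
    by (subst \<nu>.nn_integral_fst[symmetric]) auto
  finally show ?thesis .
qed

lemma prob_space_iconv:
  assumes \<mu>: "prob_space \<mu>" "sets \<mu> = sets borel" and \<nu>: "prob_space \<nu>" "sets \<nu> = sets borel"
  shows "prob_space (\<mu> \<star>\<star> \<nu>)"
proof
  interpret \<mu>: prob_space \<mu> by fact
  interpret \<nu>: prob_space \<nu> by fact
  have "emeasure (\<mu> \<star>\<star> \<nu>) (space (\<mu> \<star>\<star> \<nu>)) = (\<integral>\<^sup>+r. 1 \<partial>(\<mu> \<star>\<star> \<nu>))" by simp
  also have "\<dots> = 1"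
    using nn_integral_iconv[OF assms, of "\<lambda>_. 1"] by (simp add: \<mu>.emeasure_space_1 \<nu>.emeasure_space_1)
  finally show "emeasure (\<mu> \<star>\<star> \<nu>) (space (\<mu> \<star>\<star> \<nu>)) = 1" .
qed

lemma measure_eq_nn_integral:
  assumes "sets M = sets N" "\<And>A. A \<in> sets M \<Longrightarrow> (\<integral>\<^sup>+x. indicator A x \<partial>M) = (\<integral>\<^sup>+x. indicator A x \<partial>N)"
  shows "M = N"
  by (rule measure_eqI) (use assms in auto)

lemma iconv_commute:
  assumes \<mu>: "prob_space \<mu>" "sets \<mu> = sets borel" and \<nu>: "prob_space \<nu>" "sets \<nu> = sets borel"
  shows "\<mu> \<star>\<star> \<nu> = \<nu> \<star>\<star> \<mu>"
proof (rule measure_eq_nn_integral)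
  fix A assume "A \<in> sets (\<mu> \<star>\<star> \<nu>)"
  then have [measurable]: "A \<in> sets borel" by simp
  interpret \<mu>: prob_space \<mu> by fact
  interpret \<nu>: prob_space \<nu> by fact
  interpret pair_sigma_finite \<nu> \<mu> ..
  note [measurable_cong] = \<mu>(2) \<nu>(2)
  show "(\<integral>\<^sup>+x. indicator A x \<partial>(\<mu> \<star>\<star> \<nu>)) = (\<integral>\<^sup>+x. indicator A x \<partial>(\<nu> \<star>\<star> \<mu>))"
    using Fubini'[of "\<lambda>x y. indicator A (x + y)"]
    by (simp add: nn_integral_iconv \<mu> \<nu> assms add.commute del: nn_integral_indicator)
qed simp

lemma iconv_assoc:
  assumes \<mu>: "prob_space \<mu>" "sets \<mu> = sets borel" and \<nu>: "prob_space \<nu>" "sets \<nu> = sets borel"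
    and \<kappa>: "prob_space \<kappa>" "sets \<kappa> = sets borel"
  shows "(\<mu> \<star>\<star> \<nu>) \<star>\<star> \<kappa> = \<mu> \<star>\<star> (\<nu> \<star>\<star> \<kappa>)"
proof (rule measure_eq_nn_integral)
  fix A assume "A \<in> sets ((\<mu> \<star>\<star> \<nu>) \<star>\<star> \<kappa>)"
  then have [measurable]: "A \<in> sets borel" by simp
  interpret \<mu>: prob_space \<mu> by fact
  interpret \<nu>: prob_space \<nu> by fact
  interpret \<kappa>: prob_space \<kappa> by fact
  note [measurable_cong] = \<mu>(2) \<nu>(2) \<kappa>(2)
  show "(\<integral>\<^sup>+x. indicator A x \<partial>((\<mu> \<star>\<star> \<nu>) \<star>\<star> \<kappa>)) = (\<integral>\<^sup>+x. indicator A x \<partial>(\<mu> \<star>\<star> (\<nu> \<star>\<star> \<kappa>)))"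
    by (simp add: nn_integral_iconv prob_space_iconv assms add.assoc del: nn_integral_indicator)
qed simp

lemma integral_iconv:
  fixes h :: "ereal \<Rightarrow> real"
  assumes \<mu>: "prob_space \<mu>" "sets \<mu> = sets borel" and \<nu>: "prob_space \<nu>" "sets \<nu> = sets borel"
    and [measurable]: "h \<in> borel_measurable borel" and B: "\<And>r. \<bar>h r\<bar> \<le> B"
  shows "(\<integral>r. h r \<partial>(\<mu> \<star>\<star> \<nu>)) = (\<integral>x. \<integral>y. h (x + y) \<partial>\<nu> \<partial>\<mu>)"
proof -
  interpret \<mu>: prob_space \<mu> by fact
  interpret \<nu>: prob_space \<nu> by fact
  interpret pair_prob_space \<mu> \<nu> ..
  note [measurable_cong] = \<mu>(2) \<nu>(2)
  have "(\<integral>r. h r \<partial>(\<mu> \<star>\<star> \<nu>)) = (\<integral>p. h (case p of (x, y) \<Rightarrow> x + y) \<partial>(\<mu> \<Otimes>\<^sub>M \<nu>))"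
    unfolding iconv_def by (subst integral_distr) auto
  also have "\<dots> = (\<integral>x. \<integral>y. h (x + y) \<partial>\<nu> \<partial>\<mu>)"
    by (subst integral_fst'[symmetric]) (auto intro!: P.integrable_bounded[where B=B] B)
  finally show ?thesis .
qed

lemma nn_integral_noise:
  assumes \<mu>: "prob_space \<mu>" "sets \<mu> = sets borel"
    and [measurable]: "h \<in> borel_measurable borel"
  shows "(\<integral>\<^sup>+r. h r \<partial>noise e \<mu>) = (\<integral>\<^sup>+z. \<integral>\<^sup>+r. h (ereal z * bp_F e r) \<partial>\<mu> \<partial>flip_sign_pmf e)"
proof -
  interpret \<mu>: prob_space \<mu> by fact
  note [measurable_cong] = \<mu>(2)
  have [measurable]: "(\<lambda>z. ereal z) \<in> borel_measurable (measure_pmf (flip_sign_pmf e))"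
    by simp
  have "(\<integral>\<^sup>+r. h r \<partial>noise e \<mu>) = (\<integral>\<^sup>+p. h (case p of (z, r) \<Rightarrow> ereal z * bp_F e r) \<partial>(measure_pmf (flip_sign_pmf e) \<Otimes>\<^sub>M \<mu>))"
    unfolding noise_def by (subst nn_integral_distr) auto
  also have "\<dots> = (\<integral>\<^sup>+z. \<integral>\<^sup>+r. h (ereal z * bp_F e r) \<partial>\<mu> \<partial>flip_sign_pmf e)"
    by (subst \<mu>.nn_integral_fst[symmetric]) auto
  finally show ?thesis .
qed

lemma prob_space_noise:
  assumes \<mu>: "prob_space \<mu>" "sets \<mu> = sets borel"
  shows "prob_space (noise e \<mu>)"
proof
  interpret \<mu>: prob_space \<mu> by fact
  have "emeasure (noise e \<mu>) (space (noise e \<mu>)) = (\<integral>\<^sup>+r. 1 \<partial>(noise e \<mu>))" by simp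
  also have "\<dots> = 1"
    using nn_integral_noise[OF assms, of "\<lambda>_. 1"] by (simp add: \<mu>.emeasure_space_1)
  finally show "emeasure (noise e \<mu>) (space (noise e \<mu>)) = 1" .
qed

lemma integral_noise:
  fixes h :: "ereal \<Rightarrow> real"
  assumes \<mu>: "prob_space \<mu>" "sets \<mu> = sets borel" and e: "0 \<le> e" "e \<le> 1"
    and [measurable]: "h \<in> borel_measurable borel" and B: "\<And>r. \<bar>h r\<bar> \<le> B"
  shows "(\<integral>r. h r \<partial>noise e \<mu>) = (\<integral>r. (1 - e) * h (bp_F e r) + e * h (- bp_F e r) \<partial>\<mu>)"
proof -
  interpret \<mu>: prob_space \<mu> by fact
  interpret pair_prob_space "measure_pmf (flip_sign_pmf e)" \<mu> ..
  note [measurable_cong] = \<mu>(2)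
  have [measurable]: "(\<lambda>z. ereal z) \<in> borel_measurable (measure_pmf (flip_sign_pmf e))"
    by simp
  have i: "integrable \<mu> (\<lambda>r. h (bp_F e r))" "integrable \<mu> (\<lambda>r. h (- bp_F e r))"
    by (auto intro!: \<mu>.integrable_bounded[where B=B] B)
  have "(\<integral>r. h r \<partial>noise e \<mu>) = (\<integral>p. h (case p of (z, r) \<Rightarrow> ereal z * bp_F e r) \<partial>(measure_pmf (flip_sign_pmf e) \<Otimes>\<^sub>M \<mu>))"
    unfolding noise_def by (subst integral_distr) auto
  also have "\<dots> = (\<integral>z. \<integral>r. h (ereal z * bp_F e r) \<partial>\<mu> \<partial>flip_sign_pmf e)"
    by (subst integral_fst'[symmetric]) (auto intro!: P.integrable_bounded[where B=B] B)
  also have "\<dots> = (1 - e) * (\<integral>r. h (bp_F e r) \<partial>\<mu>) + e * (\<integral>r. h (- bp_F e r) \<partial>\<mu>)"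
    unfolding flip_sign_pmf_def using e
    by (simp flip: uminus_ereal.simps(1) one_ereal_def)
  also have "\<dots> = (\<integral>r. (1 - e) * h (bp_F e r) + e * h (- bp_F e r) \<partial>\<mu>)"
    using i by simp
  finally show ?thesis .
qed

text \<open>For opposite infinities both x + y and -x + -y are \<infinity>, hence the
  hypothesis.\<close>

lemma ereal_uminus_add: 
  assumes "tau x * tau y \<noteq> -1"
  shows "- x + - y = - (x + y)"
  using assms by (cases x; cases y) auto

lemma symmetric_iconv:
  assumes \<mu>: "symmetric_distribution \<mu>" and \<nu>: "symmetric_distribution \<nu>"
  shows "symmetric_distribution (\<mu> \<star>\<star> \<nu>)"
proof (rule symmetric_distributionI)
  note m = symmetric_distributionD(1,2)[OF \<mu>] and n = symmetric_distributionD(1,2)[OF \<nu>]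
  interpret \<mu>: prob_space \<mu> by (rule m)
  interpret \<nu>: prob_space \<nu> by (rule n)
  interpret prob_space "\<mu> \<star>\<star> \<nu>" by (rule prob_space_iconv[OF m n])
  show "prob_space (\<mu> \<star>\<star> \<nu>)" by (rule prob_space_iconv[OF m n])
  note [measurable_cong] = m n
  have "emeasure (\<mu> \<star>\<star> \<nu>) {-\<infinity>} = (\<integral>\<^sup>+x. indicator {-\<infinity>} x \<partial>(\<mu> \<star>\<star> \<nu>))"
    by simp
  also have "\<dots> = (\<integral>\<^sup>+x. \<integral>\<^sup>+y. indicator {-\<infinity>} (x + y) \<partial>\<nu> \<partial>\<mu>)"
    by (rule nn_integral_iconv[OF m n]) auto
  also have "\<dots> = (\<integral>\<^sup>+x. 0 \<partial>\<mu>)"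
  proof (rule nn_integral_cong_AE)
    show "AE x in \<mu>. (\<integral>\<^sup>+y. indicator {-\<infinity>} (x + y) \<partial>\<nu>) = 0"
      using symmetric_distributionD(3)[OF \<mu>]
    proof eventually_elim
      case (elim x)
      have "AE y in \<nu>. indicator {-\<infinity>} (x + y) = (0 :: ennreal)"
        using symmetric_distributionD(3)[OF \<nu>]
        by eventually_elim (use elim in \<open>auto simp: indicator_def ereal_plus_eq_MInfty\<close>)
      then show ?case
        by (subst nn_integral_0_iff_AE) auto
    qed
  qed
  finally have "emeasure (\<mu> \<star>\<star> \<nu>) {-\<infinity>} = 0" by simp
  then show "AE r in \<mu> \<star>\<star> \<nu>. r \<noteq> -\<infinity>"
    by (intro AE_I[where N="{-\<infinity>}"]) auto
  fix A :: "ereal set" assume [measurable]: "A \<in> sets borel"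
  define h where "h r = (1 - tau r) * (indicator A r - indicator A (- r))" for r
  have [measurable]: "h \<in> borel_measurable borel" unfolding h_def by measurable
  have B: "\<bar>h r\<bar> \<le> 2" for r
    using tau_bounds[of r] by (auto simp: h_def indicator_def)
  have int: "integrable (\<mu> \<star>\<star> \<nu>) (\<lambda>r. (1 - tau r) * indicator A (f r))"
    if [measurable]: "f \<in> borel_measurable borel" for f :: "ereal \<Rightarrow> ereal"
  proof (rule integrable_bounded[where B=2])
    show "\<bar>(1 - tau r) * indicator A (f r)\<bar> \<le> 2" for r by (rule one_minus_tau_indicator_le_2)
  qed measurable
  \<comment> \<open>With s = tau x and t = tau y both terms carry the weight (1 - s^2)(1 - t^2) / (1
    + s t), with opposite signs; at opposite infinities both weights vanish.\<close>
  have 0: "(1 + tau x) * (1 + tau y) * h (x + y) + (1 - tau x) * (1 - tau y) * h (- x + - y) = 0" for x y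
  proof (cases "tau x * tau y = -1")
    case True
    then show ?thesis using tau_mult_eq_minus_1[OF True] by auto
  next
    case False
    then have ne: "1 + tau x * tau y \<noteq> 0" by linarith
    define o' where "o' = (indicator A (x + y) - indicator A (- (x + y)) :: real)"
    have 1: "h (x + y) = (1 - (tau x + tau y) / (1 + tau x * tau y)) * o'"
      by (simp add: h_def tau_add False o'_def)
    have 2: "h (- x + - y) = (1 + (tau x + tau y) / (1 + tau x * tau y)) * (- o')"
      unfolding ereal_uminus_add[OF False] by (simp add: h_def tau_add False o'_def)
    show ?thesis unfolding 1 2 using ne by (simp add: field_simps)
  qed
  have "(\<integral>r. (1 - tau r) * indicator A r \<partial>(\<mu> \<star>\<star> \<nu>)) - (\<integral>r. (1 - tau r) * indicator A (- r) \<partial>(\<mu> \<star>\<star> \<nu>))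
      = (\<integral>r. h r \<partial>(\<mu> \<star>\<star> \<nu>))"
    using int[of "\<lambda>r. r"] int[of uminus] by (simp add: h_def right_diff_distrib)
  also have "\<dots> = (\<integral>x. \<integral>y. h (x + y) \<partial>\<nu> \<partial>\<mu>)"
    by (rule integral_iconv[OF m n _ B]) measurable
  also have "\<dots> = (\<integral>x. \<integral>y. 0 \<partial>\<nu> \<partial>\<mu>)"
  proof (subst symmetric_mix2[OF \<mu> \<nu> _ B], measurable, intro Bochner_Integration.integral_cong refl)
    fix x y
    show "((1 + tau x) * (1 + tau y) * h (x + y) + (1 - tau x) * (1 - tau y) * h (- x + - y)) / 4 +
      ((1 + tau x) * (1 - tau y) * h (x + - y) + (1 - tau x) * (1 + tau y) * h (- x + y)) / 4 = 0"
      \<comment> \<open>The group with opposite signs is the other group with y negated.\<close>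
      using 0[of x "- y"] by (simp add: 0)
  qed
  finally show "(\<integral>r. (1 - tau r) * indicator A r \<partial>(\<mu> \<star>\<star> \<nu>)) = (\<integral>r. (1 - tau r) * indicator A (- r) \<partial>(\<mu> \<star>\<star> \<nu>))"
    by simp
qed simp

text \<open>An even function does not see the common sign, so each group of
  \<open>symmetric_mix2\<close> collapses to one term and only the relative sign remains.\<close>

lemma integral_iconv_even:
  fixes h :: "ereal \<Rightarrow> real"
  assumes \<mu>: "symmetric_distribution \<mu>" and \<nu>: "symmetric_distribution \<nu>"
    and [measurable]: "h \<in> borel_measurable borel" and B: "\<And>r. \<bar>h r\<bar> \<le> B"
    and even: "\<And>r. h (- r) = h r"
  shows "(\<integral>r. h r \<partial>(\<mu> \<star>\<star> \<nu>)) =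
    (\<integral>x. \<integral>y. (1 + tau x * tau y) / 2 * h (x + y) + (1 - tau x * tau y) / 2 * h (x + - y) \<partial>\<nu> \<partial>\<mu>)"
proof -
  note m = symmetric_distributionD(1,2)[OF \<mu>] and n = symmetric_distributionD(1,2)[OF \<nu>]
  have *: "(1 - tau x) * (1 - tau y) * h (- x + - y) = (1 - tau x) * (1 - tau y) * h (x + y)"
    if "tau x * tau y \<noteq> - 1 \<or> (1 - tau x) * (1 - tau y) = 0" for x y
    using that ereal_uminus_add[of x y] even by auto
  \<comment> \<open>Where -x + -y is not the negative of x + y, a factor of the weight is
    zero.\<close>
  have c: "tau x * tau y \<noteq> - 1 \<or> (1 - tau x) * (1 - tau y) = 0" for x y
  proof (cases "tau x * tau y = -1")
    case True
    then show ?thesis using tau_mult_eq_minus_1[OF True] by auto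
  qed simp
  have "(\<integral>r. h r \<partial>(\<mu> \<star>\<star> \<nu>)) = (\<integral>x. \<integral>y. h (x + y) \<partial>\<nu> \<partial>\<mu>)"
    by (rule integral_iconv[OF m n _ B]) measurable
  also have "\<dots> = (\<integral>x. \<integral>y. (1 + tau x * tau y) / 2 * h (x + y) + (1 - tau x * tau y) / 2 * h (x + - y) \<partial>\<nu> \<partial>\<mu>)"
  proof (subst symmetric_mix2[OF \<mu> \<nu> _ B], measurable, intro Bochner_Integration.integral_cong refl)
    fix x y
    have "((1 + tau x) * (1 + tau y) * h (x + y) + (1 - tau x) * (1 - tau y) * h (- x + - y)) / 4 +
      ((1 + tau x) * (1 - tau y) * h (x + - y) + (1 - tau x) * (1 + tau y) * h (- x + y)) / 4
      = ((1 + tau x) * (1 + tau y) * h (x + y) + (1 - tau x) * (1 - tau y) * h (x + y)) / 4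
      + ((1 + tau x) * (1 - tau y) * h (x + - y) + (1 - tau x) * (1 + tau y) * h (x + - y)) / 4"
      by (simp only: *[OF c, of x y] *[OF c, of x "- y", unfolded tau_uminus diff_minus_eq_add ereal_uminus_uminus])
    also have "\<dots> = (1 + tau x * tau y) / 2 * h (x + y) + (1 - tau x * tau y) / 2 * h (x + - y)"
      by (simp add: field_simps)
    finally show "((1 + tau x) * (1 + tau y) * h (x + y) + (1 - tau x) * (1 - tau y) * h (- x + - y)) / 4 +
      ((1 + tau x) * (1 - tau y) * h (x + - y) + (1 - tau x) * (1 + tau y) * h (- x + y)) / 4 = \<dots>" .
  qed
  finally show ?thesis .
qed

lemma symmetric_noise:
  assumes \<mu>: "symmetric_distribution \<mu>" and e: "0 \<le> e" "e \<le> 1"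
  shows "symmetric_distribution (noise e \<mu>)"
proof (rule symmetric_distributionI)
  note m = symmetric_distributionD(1,2)[OF \<mu>]
  interpret \<mu>: prob_space \<mu> by (rule m)
  interpret prob_space "noise e \<mu>" by (rule prob_space_noise[OF m])
  show "prob_space (noise e \<mu>)" by (rule prob_space_noise[OF m])
  note [measurable_cong] = m
  have tF: "tau (bp_F e r) = (1 - 2 * e) * tau r" for r by (rule tau_bp_F[OF e])
  have "measure (noise e \<mu>) {-\<infinity>} = (\<integral>r. indicator {-\<infinity>} r \<partial>noise e \<mu>)"
    by simp
  also have "\<dots> = (\<integral>r. (1 - e) * indicator {-\<infinity>} (bp_F e r) + e * indicator {-\<infinity>} (- bp_F e r) \<partial>\<mu>)"
    by (rule integral_noise[OF m e, where B=1]) auto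
  also have "\<dots> = (\<integral>r. 0 \<partial>\<mu>)"
  proof (rule integral_cong_AE)
    show "AE r in \<mu>. (1 - e) * indicator {-\<infinity>} (bp_F e r) + e * indicator {-\<infinity>} (- bp_F e r) = 0"
      using symmetric_distributionD(3)[OF \<mu>]
    proof eventually_elim
      case (elim r)
      \<comment> \<open>\<open>bp_F\<close> makes \<infinity> infinite only for e = 0 or e = 1, and
        then the sign that would lead to -\<infinity> has probability 0.\<close>
      have "(1 - e) * indicator {-\<infinity>} (bp_F e r) = 0"
        using e elim by (cases r) (auto simp: indicator_def)
      moreover have "e * indicator {-\<infinity>} (- bp_F e r) = 0"
        using e elim by (cases r) (auto simp: indicator_def split: if_splits)
      ultimately show ?case by linarith
    qed
  qed auto
  finally have "emeasure (noise e \<mu>) {-\<infinity>} = 0" by (simp add: emeasure_eq_measure)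
  then show "AE r in noise e \<mu>. r \<noteq> -\<infinity>"
    by (intro AE_I[where N="{-\<infinity>}"]) auto
  fix A :: "ereal set" assume [measurable]: "A \<in> sets borel"
  define k where "k r = (indicator A r - indicator A (- r) :: real)" for r
  have [measurable]: "k \<in> borel_measurable borel" unfolding k_def by measurable
  have km: "k (- r) = - k r" for r by (simp add: k_def)
  have kB: "\<bar>k r\<bar> \<le> 1" for r by (simp add: k_def indicator_def)
  define h where "h r = (1 - tau r) * k r" for r
  have [measurable]: "h \<in> borel_measurable borel" unfolding h_def by measurable
  have B: "\<bar>h r\<bar> \<le> 2" for r
    unfolding h_def abs_mult using mult_mono[OF one_minus_tau_le_2 kB] by auto
  have int: "integrable (noise e \<mu>) (\<lambda>r. (1 - tau r) * indicator A (f r))"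
    if [measurable]: "f \<in> borel_measurable borel" for f :: "ereal \<Rightarrow> ereal"
  proof (rule integrable_bounded[where B=2])
    show "\<bar>(1 - tau r) * indicator A (f r)\<bar> \<le> 2" for r by (rule one_minus_tau_indicator_le_2)
  qed measurable
  have Fodd: "bp_F e (- r) = - bp_F e r" for r
    by (subst tau_eq_iff[symmetric]) (simp add: tF)
  define q where "q r = k (bp_F e r)" for r
  have [measurable]: "q \<in> borel_measurable borel" unfolding q_def by measurable
  have "(\<integral>r. (1 - tau r) * indicator A r \<partial>noise e \<mu>) - (\<integral>r. (1 - tau r) * indicator A (- r) \<partial>noise e \<mu>)
      = (\<integral>r. h r \<partial>noise e \<mu>)"
    using int[of "\<lambda>r. r"] int[of uminus] by (simp add: h_def k_def right_diff_distrib)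
  also have "\<dots> = (\<integral>r. (1 - e) * h (bp_F e r) + e * h (- bp_F e r) \<partial>\<mu>)"
    by (rule integral_noise[OF m e _ B]) measurable
  \<comment> \<open>As k is odd, with \<theta> = 1 - 2 * e the coefficient of k is (1 - e) (1 -
    \<theta> tau) - e (1 + \<theta> tau) = \<theta> (1 - tau).\<close>
  also have "\<dots> = (\<integral>r. (1 - 2 * e) * ((1 - tau r) * q r) \<partial>\<mu>)"
    by (intro Bochner_Integration.integral_cong refl)
       (simp add: h_def tF km q_def algebra_simps)
  also have "\<dots> = (1 - 2 * e) * (\<integral>r. (1 - tau r) * q r \<partial>\<mu>)"
    by simp
  also have "(\<integral>r. (1 - tau r) * q r \<partial>\<mu>) = (\<integral>r. (1 - tau r) * q (- r) \<partial>\<mu>)"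
    by (rule symmetric_flip[OF \<mu>]) measurable
  also have "\<dots> = - (\<integral>r. (1 - tau r) * q r \<partial>\<mu>)"
    by (simp add: q_def Fodd km)
  finally have D: "(\<integral>r. (1 - tau r) * indicator A r \<partial>noise e \<mu>) - (\<integral>r. (1 - tau r) * indicator A (- r) \<partial>noise e \<mu>)
    = (1 - 2 * e) * - (\<integral>r. (1 - tau r) * q r \<partial>\<mu>)" .
  \<comment> \<open>The function q is odd, so the reflection makes its weighted integral its own
    negative.\<close>
  have "(\<integral>r. (1 - tau r) * q r \<partial>\<mu>) = (\<integral>r. (1 - tau r) * q (- r) \<partial>\<mu>)"
    by (rule symmetric_flip[OF \<mu>]) measurable
  also have "\<dots> = - (\<integral>r. (1 - tau r) * q r \<partial>\<mu>)"
    by (simp add: q_def Fodd km)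
  finally have "(\<integral>r. (1 - tau r) * q r \<partial>\<mu>) = 0" by simp
  with D show "(\<integral>r. (1 - tau r) * indicator A r \<partial>noise e \<mu>) = (\<integral>r. (1 - tau r) * indicator A (- r) \<partial>noise e \<mu>)"
    by simp
qed simp

section \<open>The BP operator as a mixture of convolutions\<close>

fun iconv_pow :: "ereal measure \<Rightarrow> nat \<Rightarrow> ereal measure \<Rightarrow> ereal measure" where
  "iconv_pow \<mu> 0 \<nu> = \<nu>"
| "iconv_pow \<mu> (Suc n) \<nu> = \<mu> \<star>\<star> iconv_pow \<mu> n \<nu>"

lemma iconv_pow_prob_sets:
  assumes "prob_space \<mu>" "sets \<mu> = sets borel" "prob_space \<nu>" "sets \<nu> = sets borel"
  shows "prob_space (iconv_pow \<mu> n \<nu>)" "sets (iconv_pow \<mu> n \<nu>) = sets borel"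
  using assms by (induction n) (auto intro!: prob_space_iconv)

lemma borel_measurable_bp_sum:
  assumes "f \<in> N \<rightarrow>\<^sub>M Pi\<^sub>M I (\<lambda>_. measure_pmf p)" "g \<in> N \<rightarrow>\<^sub>M Pi\<^sub>M I' (\<lambda>_. \<mu>)"
    and "J \<subseteq> I" "J \<subseteq> I'" and \<mu>: "sets \<mu> = sets borel"
  shows "(\<lambda>w. \<Sum>u\<in>J. ereal (f w u) * bp_F \<delta> (g w u)) \<in> borel_measurable N"
proof (intro borel_measurable_ereal_sum borel_measurable_ereal_times)
  fix u assume "u \<in> J"
  then have u: "u \<in> I" "u \<in> I'" using assms by auto
  show "(\<lambda>w. ereal (f w u)) \<in> borel_measurable N"
    by (rule measurable_compose[OF measurable_compose[OF assms(1) measurable_component_singleton[OF u(1)]]]) simp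
  have "(\<lambda>w. g w u) \<in> borel_measurable N"
    using measurable_compose[OF assms(2) measurable_component_singleton[OF u(2)]]
      measurable_cong_sets[OF refl \<mu>] by auto
  then show "(\<lambda>w. bp_F \<delta> (g w u)) \<in> borel_measurable N"
    by measurable
qed

lemma borel_measurable_bp_term:
  assumes [measurable]: "h \<in> borel_measurable borel" "a \<in> borel_measurable N" "b \<in> borel_measurable N"
    "c \<in> borel_measurable N" "e \<in> borel_measurable N"
  shows "(\<lambda>w. h (a w * bp_F \<delta> (b w) + c w + e w)) \<in> borel_measurable N"
  by measurable

text \<open>Induction on d: coordinate Suc d is split off both products and moved outside, where it
  contributes an independent draw from \<open>noise \<delta> \<mu>\<close> to the sum over the other
  coordinates.\<close>

lemma nn_integral_bp_sum_finite:
  assumes \<mu>: "prob_space \<mu>" "sets \<mu> = sets borel" and \<nu>: "prob_space \<nu>" "sets \<nu> = sets borel"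
    and h: "h \<in> borel_measurable borel"
  shows "(\<integral>\<^sup>+Z. \<integral>\<^sup>+R. \<integral>\<^sup>+S. h ((\<Sum>u = 1..d. ereal (Z u) * bp_F \<delta> (R u)) + S) \<partial>\<nu>
            \<partial>(\<Pi>\<^sub>M u\<in>{1..d}. \<mu>) \<partial>(\<Pi>\<^sub>M u\<in>{1..d}. measure_pmf (flip_sign_pmf \<delta>)))
     = (\<integral>\<^sup>+r. h r \<partial>iconv_pow (noise \<delta> \<mu>) d \<nu>)"
  using h
proof (induction d arbitrary: h)
  case 0
  interpret Z: product_prob_space "\<lambda>_::nat. measure_pmf (flip_sign_pmf \<delta>)" UNIV ..
  interpret \<mu>: prob_space \<mu> by fact
  interpret R: product_prob_space "\<lambda>_::nat. \<mu>" UNIV ..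
  show ?case by (simp add: Z.emeasure_space_1 PiM_empty)
next
  case (Suc d h)
  let ?J = "{1..d}" and ?Z = "measure_pmf (flip_sign_pmf \<delta>)"
  note [measurable] = Suc.prems
  interpret \<mu>: prob_space \<mu> by fact
  interpret \<nu>: prob_space \<nu> by fact
  interpret Z: product_prob_space "\<lambda>_::nat. ?Z" UNIV ..
  interpret R: product_prob_space "\<lambda>_::nat. \<mu>" UNIV ..
  interpret ZJ: prob_space "Pi\<^sub>M ?J (\<lambda>_. ?Z)"
    by (rule prob_space_PiM) (simp add: measure_pmf.prob_space_axioms)
  interpret RJ: prob_space "Pi\<^sub>M ?J (\<lambda>_. \<mu>)"
    by (rule prob_space_PiM) (rule \<mu>.prob_space_axioms)
  interpret RJ': prob_space "Pi\<^sub>M (insert (Suc d) ?J) (\<lambda>_. \<mu>)"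
    by (rule prob_space_PiM) (rule \<mu>.prob_space_axioms)
  interpret sw: pair_sigma_finite "Pi\<^sub>M ?J (\<lambda>_. ?Z)" \<mu> ..
  note [measurable_cong] = \<mu>(2) \<nu>(2)
  have [measurable]: "(\<lambda>z. ereal z) \<in> borel_measurable ?Z"
    by simp
  have J: "{1..Suc d} = insert (Suc d) ?J" by auto
  have nin: "Suc d \<notin> ?J" by simp
  define s where "s Z R = (\<Sum>u\<in>?J. ereal (Z u) * bp_F \<delta> (R u))" for Z R
  have s_upd: "s (Z(Suc d := z)) R = s Z R" "s Z (R(Suc d := r)) = s Z R" for Z R z r
    unfolding s_def by (auto intro!: sum.cong)
  have sum: "(\<Sum>u\<in>insert (Suc d) ?J. ereal (Z u) * bp_F \<delta> (R u)) = ereal (Z (Suc d)) * bp_F \<delta> (R (Suc d)) + s Z R" for Z R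
    by (simp add: s_def)
  let ?J' = "insert (Suc d) ?J"
  note ms = borel_measurable_bp_sum[where \<mu>=\<mu> and p="flip_sign_pmf \<delta>", OF _ _ _ _ \<mu>(2)]
  have Zm: "(\<lambda>Z. ereal (Z (Suc d))) \<in> borel_measurable (Pi\<^sub>M ?J' (\<lambda>_. ?Z))"
    by (rule measurable_compose[where N="?Z"]) auto
  have Rm: "(\<lambda>R. R (Suc d)) \<in> borel_measurable (Pi\<^sub>M ?J' (\<lambda>_. \<mu>))"
    using measurable_component_singleton[of "Suc d" ?J' "\<lambda>_. \<mu>"] measurable_cong_sets[OF refl \<mu>(2)] by auto
  have \<nu>m: "(\<lambda>x. x) \<in> borel_measurable \<nu>" and \<mu>m: "(\<lambda>x. x) \<in> borel_measurable \<mu>"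
    by (simp_all add: \<mu> \<nu>)
  note f = measurable_fst measurable_snd measurable_compose[OF measurable_fst]
    measurable_compose[OF measurable_compose[OF measurable_fst measurable_fst]]
    measurable_compose[OF measurable_compose[OF measurable_fst measurable_snd]]
    measurable_compose[OF measurable_snd]
    measurable_compose[OF measurable_compose[OF measurable_compose[OF measurable_fst measurable_fst] measurable_fst]]
    measurable_compose[OF measurable_compose[OF measurable_compose[OF measurable_fst measurable_fst] measurable_snd]]
  \<comment> \<open>m1, m2 and m3 are the measurability obligations for splitting off Z (Suc d), for
    splitting off R (Suc d), and for exchanging the integrals over Z and r.\<close>
  have m1: "(\<lambda>Z. \<integral>\<^sup>+R. \<integral>\<^sup>+S. h (ereal (Z (Suc d)) * bp_F \<delta> (R (Suc d)) + s Z R + S) \<partial>\<nu> \<partial>(Pi\<^sub>M ?J' (\<lambda>_. \<mu>)))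
      \<in> borel_measurable (Pi\<^sub>M ?J' (\<lambda>_. ?Z))"
  proof -
    let ?N = "(Pi\<^sub>M ?J' (\<lambda>_. ?Z) \<Otimes>\<^sub>M Pi\<^sub>M ?J' (\<lambda>_. \<mu>)) \<Otimes>\<^sub>M \<nu>"
    have 1: "(\<lambda>w. s (fst (fst w)) (snd (fst w))) \<in> borel_measurable ?N"
      unfolding s_def by (rule ms[where I="?J'" and I'="?J'"]) (measurable, auto)
    have "(\<lambda>w. h (ereal (fst (fst w) (Suc d)) * bp_F \<delta> (snd (fst w) (Suc d)) + s (fst (fst w)) (snd (fst w)) + snd w))
      \<in> borel_measurable ?N"
      by (rule borel_measurable_bp_term[OF Suc.prems f(4)[OF Zm] f(5)[OF Rm] 1 f(6)[OF \<nu>m]])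
    note I = \<nu>.borel_measurable_nn_integral[of "\<lambda>w S. h (ereal (fst w (Suc d)) * bp_F \<delta> (snd w (Suc d)) + s (fst w) (snd w) + S)", unfolded split_beta', OF this]
    show ?thesis
      by (rule RJ'.borel_measurable_nn_integral, unfold split_beta', rule I)
  qed
  have m2: "(\<lambda>R. \<integral>\<^sup>+S. h (ereal z * bp_F \<delta> (R (Suc d)) + s Z R + S) \<partial>\<nu>) \<in> borel_measurable (Pi\<^sub>M ?J' (\<lambda>_. \<mu>))"
    if Z: "Z \<in> space (Pi\<^sub>M ?J (\<lambda>_. ?Z))" for Z z
  proof -
    let ?N = "Pi\<^sub>M ?J' (\<lambda>_. \<mu>) \<Otimes>\<^sub>M \<nu>"
    have 1: "(\<lambda>w. s Z (fst w)) \<in> borel_measurable ?N"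
      unfolding s_def using Z by (intro ms[where I="?J" and I'="?J'"]) auto
    have "(\<lambda>w. h (ereal z * bp_F \<delta> (fst w (Suc d)) + s Z (fst w) + snd w)) \<in> borel_measurable ?N"
      by (rule borel_measurable_bp_term[OF Suc.prems borel_measurable_const f(3)[OF Rm] 1 f(6)[OF \<nu>m]])
    note I = \<nu>.borel_measurable_nn_integral[of "\<lambda>w S. h (ereal z * bp_F \<delta> (w (Suc d)) + s Z w + S)", unfolded split_beta', OF this]
    from I show ?thesis .
  qed
  have m3: "(\<lambda>(Z, r). \<integral>\<^sup>+R. \<integral>\<^sup>+S. h (ereal z * bp_F \<delta> r + s Z R + S) \<partial>\<nu> \<partial>(Pi\<^sub>M ?J (\<lambda>_. \<mu>)))
     \<in> borel_measurable (Pi\<^sub>M ?J (\<lambda>_. ?Z) \<Otimes>\<^sub>M \<mu>)" for z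
  proof -
    let ?N = "((Pi\<^sub>M ?J (\<lambda>_. ?Z) \<Otimes>\<^sub>M \<mu>) \<Otimes>\<^sub>M Pi\<^sub>M ?J (\<lambda>_. \<mu>)) \<Otimes>\<^sub>M \<nu>"
    have 1: "(\<lambda>w. s (fst (fst (fst w))) (snd (fst w))) \<in> borel_measurable ?N"
      unfolding s_def by (rule ms[OF f(7)[OF measurable_ident_sets[OF refl]] f(5)[OF measurable_ident_sets[OF refl]]]) auto
    have "(\<lambda>w. h (ereal z * bp_F \<delta> (snd (fst (fst w))) + s (fst (fst (fst w))) (snd (fst w)) + snd w))
      \<in> borel_measurable ?N"
      by (rule borel_measurable_bp_term[OF Suc.prems borel_measurable_const f(8)[OF \<mu>m] 1 f(6)[OF \<nu>m]])
    note I = \<nu>.borel_measurable_nn_integral[of "\<lambda>w S. h (ereal z * bp_F \<delta> (snd (fst w)) + s (fst (fst w)) (snd w) + S)", unfolded split_beta', OF this]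
    show ?thesis
      unfolding split_beta'
      by (rule RJ.borel_measurable_nn_integral, unfold split_beta', rule I)
  qed
  have "(\<integral>\<^sup>+Z. \<integral>\<^sup>+R. \<integral>\<^sup>+S. h ((\<Sum>u = 1..Suc d. ereal (Z u) * bp_F \<delta> (R u)) + S) \<partial>\<nu>
            \<partial>(\<Pi>\<^sub>M u\<in>{1..Suc d}. \<mu>) \<partial>(\<Pi>\<^sub>M u\<in>{1..Suc d}. ?Z))
    = (\<integral>\<^sup>+Z. \<integral>\<^sup>+R. \<integral>\<^sup>+S. h (ereal (Z (Suc d)) * bp_F \<delta> (R (Suc d)) + s Z R + S) \<partial>\<nu>
            \<partial>(\<Pi>\<^sub>M u\<in>?J'. \<mu>) \<partial>(\<Pi>\<^sub>M u\<in>?J'. ?Z))"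
    unfolding J sum ..
  also have "\<dots> = (\<integral>\<^sup>+z. \<integral>\<^sup>+Z. \<integral>\<^sup>+R. \<integral>\<^sup>+S. h (ereal z * bp_F \<delta> (R (Suc d)) + s Z R + S) \<partial>\<nu>
            \<partial>(\<Pi>\<^sub>M u\<in>?J'. \<mu>) \<partial>(\<Pi>\<^sub>M u\<in>?J. ?Z) \<partial>?Z)"
    by (subst Z.product_nn_integral_insert_rev[OF _ nin m1]) (simp_all add: s_upd)
  also have "\<dots> = (\<integral>\<^sup>+z. \<integral>\<^sup>+Z. \<integral>\<^sup>+r. \<integral>\<^sup>+R. \<integral>\<^sup>+S. h (ereal z * bp_F \<delta> r + s Z R + S) \<partial>\<nu>
            \<partial>(\<Pi>\<^sub>M u\<in>?J. \<mu>) \<partial>\<mu> \<partial>(\<Pi>\<^sub>M u\<in>?J. ?Z) \<partial>?Z)"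
    by (intro nn_integral_cong, subst R.product_nn_integral_insert_rev[OF _ nin m2]) (simp_all add: s_upd)
  also have "\<dots> = (\<integral>\<^sup>+z. \<integral>\<^sup>+r. \<integral>\<^sup>+Z. \<integral>\<^sup>+R. \<integral>\<^sup>+S. h (ereal z * bp_F \<delta> r + s Z R + S) \<partial>\<nu>
            \<partial>(\<Pi>\<^sub>M u\<in>?J. \<mu>) \<partial>(\<Pi>\<^sub>M u\<in>?J. ?Z) \<partial>\<mu> \<partial>?Z)"
    by (intro nn_integral_cong sw.Fubini'[symmetric] m3)
  also have "\<dots> = (\<integral>\<^sup>+z. \<integral>\<^sup>+r. \<integral>\<^sup>+x. h (ereal z * bp_F \<delta> r + x) \<partial>iconv_pow (noise \<delta> \<mu>) d \<nu> \<partial>\<mu> \<partial>?Z)"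
  proof (intro nn_integral_cong)
    fix z :: real and r :: ereal
    have "(\<lambda>x. h (ereal z * bp_F \<delta> r + x)) \<in> borel_measurable borel" by measurable
    from Suc.IH[OF this]
    show "(\<integral>\<^sup>+Z. \<integral>\<^sup>+R. \<integral>\<^sup>+S. h (ereal z * bp_F \<delta> r + s Z R + S) \<partial>\<nu> \<partial>(\<Pi>\<^sub>M u\<in>?J. \<mu>) \<partial>(\<Pi>\<^sub>M u\<in>?J. ?Z))
      = (\<integral>\<^sup>+x. h (ereal z * bp_F \<delta> r + x) \<partial>iconv_pow (noise \<delta> \<mu>) d \<nu>)"
      by (simp add: s_def add.assoc)
  qed
  also have "\<dots> = (\<integral>\<^sup>+y. \<integral>\<^sup>+x. h (y + x) \<partial>iconv_pow (noise \<delta> \<mu>) d \<nu> \<partial>noise \<delta> \<mu>)"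
  proof (rule nn_integral_noise[OF \<mu>, symmetric])
    interpret p: prob_space "iconv_pow (noise \<delta> \<mu>) d \<nu>"
      by (intro iconv_pow_prob_sets prob_space_noise \<mu> \<nu>) simp
    note [measurable_cong] = iconv_pow_prob_sets(2)[OF prob_space_noise[OF \<mu>] sets_noise \<nu>]
    show "(\<lambda>y. \<integral>\<^sup>+x. h (y + x) \<partial>iconv_pow (noise \<delta> \<mu>) d \<nu>) \<in> borel_measurable borel"
      by measurable
  qed
  also have "\<dots> = (\<integral>\<^sup>+r. h r \<partial>iconv_pow (noise \<delta> \<mu>) (Suc d) \<nu>)"
    by (simp add: nn_integral_iconv prob_space_noise \<mu> \<nu> iconv_pow_prob_sets)
  finally show ?case .
qed

text \<open>Passes from the infinite products in \<open>bp_operator\<close> to the finitely many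
  coordinates that an integrand reads.\<close>

lemma nn_integral_PiM_restrict:
  fixes M :: "'i \<Rightarrow> 'a measure"
  assumes "\<And>i. prob_space (M i)" "finite J" and [measurable]: "f \<in> borel_measurable (Pi\<^sub>M J M)"
    and eq: "\<And>x. g x = f (restrict x J)"
  shows "(\<integral>\<^sup>+x. g x \<partial>Pi\<^sub>M UNIV M) = (\<integral>\<^sup>+x. f x \<partial>Pi\<^sub>M J M)"
proof -
  interpret product_prob_space M UNIV
    using assms(1) by (intro product_prob_spaceI)
  have "(\<integral>\<^sup>+x. f x \<partial>Pi\<^sub>M J M) = (\<integral>\<^sup>+x. f x \<partial>distr (Pi\<^sub>M UNIV M) (Pi\<^sub>M J M) (\<lambda>x. restrict x J))"
    using distr_PiM_restrict_finite[of J] assms(2) by simp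
  also have "\<dots> = (\<integral>\<^sup>+x. f (restrict x J) \<partial>Pi\<^sub>M UNIV M)"
    by (rule nn_integral_distr) auto
  finally show ?thesis by (simp add: eq)
qed

text \<open>Given the degree, only d coordinates matter and the sum has a convolution as its law;
  hence the operator is a mixture over d.\<close>

lemma nn_integral_bp_operator:
  assumes \<mu>: "prob_space \<mu>" "sets \<mu> = sets borel" and \<nu>: "prob_space \<nu>" "sets \<nu> = sets borel"
    and h [measurable]: "h \<in> borel_measurable borel"
  shows "(\<integral>\<^sup>+r. h r \<partial>bp_operator \<delta> P \<nu> \<mu>) = (\<integral>\<^sup>+d. \<integral>\<^sup>+r. h r \<partial>iconv_pow (noise \<delta> \<mu>) d \<nu> \<partial>measure_pmf P)"
proof -
  let ?Z = "measure_pmf (flip_sign_pmf \<delta>)"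
  let ?U = "UNIV :: nat set"
  interpret \<mu>: prob_space \<mu> by fact
  interpret \<nu>: prob_space \<nu> by fact
  interpret ZU: prob_space "Pi\<^sub>M ?U (\<lambda>_. ?Z)"
    by (rule prob_space_PiM) (simp add: measure_pmf.prob_space_axioms)
  interpret RU: prob_space "Pi\<^sub>M ?U (\<lambda>_. \<mu>)"
    by (rule prob_space_PiM) (rule \<mu>.prob_space_axioms)
  interpret R\<nu>: pair_prob_space "Pi\<^sub>M ?U (\<lambda>_. \<mu>)" \<nu> ..
  interpret ZR\<nu>: pair_prob_space "Pi\<^sub>M ?U (\<lambda>_. ?Z)" "Pi\<^sub>M ?U (\<lambda>_. \<mu>) \<Otimes>\<^sub>M \<nu>" ..
  note [measurable_cong] = \<mu>(2) \<nu>(2)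
  define s where "s d Z R = (\<Sum>u = 1..d. ereal (Z u) * bp_F \<delta> (R u))" for d and Z :: "nat \<Rightarrow> real" and R
  note ms = borel_measurable_bp_sum[where \<mu>=\<mu> and p="flip_sign_pmf \<delta>", OF _ _ _ _ \<mu>(2)]
  note id = measurable_ident_sets[OF refl]
  have \<nu>m: "(\<lambda>x. x) \<in> borel_measurable \<nu>" by (simp add: \<nu>)
  note hs = measurable_compose[OF borel_measurable_ereal_add h]
  have m: "(\<lambda>w. h (s d (fst w) (fst (snd w)) + snd (snd w))) \<in>
      borel_measurable (Pi\<^sub>M ?U (\<lambda>_. ?Z) \<Otimes>\<^sub>M (Pi\<^sub>M ?U (\<lambda>_. \<mu>) \<Otimes>\<^sub>M \<nu>))" for d
    unfolding s_def
    by (rule hs[OF ms[OF measurable_fst measurable_compose[OF measurable_snd measurable_fst]]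
          measurable_compose[OF measurable_compose[OF measurable_snd measurable_snd] \<nu>m]]) auto
  have m2: "(\<lambda>w. h (s d Z (fst w) + snd w)) \<in> borel_measurable (Pi\<^sub>M I (\<lambda>_. \<mu>) \<Otimes>\<^sub>M \<nu>)" if "{1..d::nat} \<subseteq> I" for d I Z
    unfolding s_def using that
    by (intro hs[OF ms[OF measurable_const measurable_fst, of _ "?U"]
          measurable_compose[OF measurable_snd \<nu>m]]) (auto simp: space_PiM)
  have md: "(\<lambda>(d, Z, R, S). s d Z R + S) \<in> borel_measurable (measure_pmf P \<Otimes>\<^sub>M (Pi\<^sub>M ?U (\<lambda>_. ?Z) \<Otimes>\<^sub>M (Pi\<^sub>M ?U (\<lambda>_. \<mu>) \<Otimes>\<^sub>M \<nu>)))"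
    using measurable_bp_sum[OF \<mu>(2) \<nu>(2), of \<delta> P] by (simp add: s_def)
  have "(\<integral>\<^sup>+r. h r \<partial>bp_operator \<delta> P \<nu> \<mu>) =
     (\<integral>\<^sup>+w. h (case w of (d, Z, R, S) \<Rightarrow> s d Z R + S) \<partial>(measure_pmf P \<Otimes>\<^sub>M (Pi\<^sub>M ?U (\<lambda>_. ?Z) \<Otimes>\<^sub>M (Pi\<^sub>M ?U (\<lambda>_. \<mu>) \<Otimes>\<^sub>M \<nu>))))"
    unfolding bp_operator_def s_def[symmetric] using md by (subst nn_integral_distr) auto
  also have "\<dots> = (\<integral>\<^sup>+d. \<integral>\<^sup>+w. h (case w of (Z, R, S) \<Rightarrow> s d Z R + S) \<partial>(Pi\<^sub>M ?U (\<lambda>_. ?Z) \<Otimes>\<^sub>M (Pi\<^sub>M ?U (\<lambda>_. \<mu>) \<Otimes>\<^sub>M \<nu>)) \<partial>measure_pmf P)"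
    using measurable_compose[OF md h] by (subst ZR\<nu>.P.nn_integral_fst[symmetric]) auto
  also have "\<dots> = (\<integral>\<^sup>+d. \<integral>\<^sup>+r. h r \<partial>iconv_pow (noise \<delta> \<mu>) d \<nu> \<partial>measure_pmf P)"
  proof (rule nn_integral_cong)
    fix d :: nat
    let ?J = "{1..d}"
    interpret RJ: prob_space "Pi\<^sub>M ?J (\<lambda>_. \<mu>)"
      by (rule prob_space_PiM) (rule \<mu>.prob_space_axioms)
    have "(\<integral>\<^sup>+w. h (case w of (Z, R, S) \<Rightarrow> s d Z R + S) \<partial>(Pi\<^sub>M ?U (\<lambda>_. ?Z) \<Otimes>\<^sub>M (Pi\<^sub>M ?U (\<lambda>_. \<mu>) \<Otimes>\<^sub>M \<nu>)))
       = (\<integral>\<^sup>+Z. \<integral>\<^sup>+p. h (case p of (R, S) \<Rightarrow> s d Z R + S) \<partial>(Pi\<^sub>M ?U (\<lambda>_. \<mu>) \<Otimes>\<^sub>M \<nu>) \<partial>Pi\<^sub>M ?U (\<lambda>_. ?Z))"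
    proof (subst R\<nu>.P.nn_integral_fst[symmetric])
      show "(\<lambda>w. h (case w of (Z, R, S) \<Rightarrow> s d Z R + S)) \<in>
          borel_measurable (Pi\<^sub>M ?U (\<lambda>_. ?Z) \<Otimes>\<^sub>M (Pi\<^sub>M ?U (\<lambda>_. \<mu>) \<Otimes>\<^sub>M \<nu>))"
        unfolding split_beta' by (rule m)
    qed simp
    also have "\<dots> = (\<integral>\<^sup>+Z. \<integral>\<^sup>+R. \<integral>\<^sup>+S. h (s d Z R + S) \<partial>\<nu> \<partial>Pi\<^sub>M ?U (\<lambda>_. \<mu>) \<partial>Pi\<^sub>M ?U (\<lambda>_. ?Z))"
    proof (intro nn_integral_cong)
      fix Z :: "nat \<Rightarrow> real"
      show "(\<integral>\<^sup>+p. h (case p of (R, S) \<Rightarrow> s d Z R + S) \<partial>(Pi\<^sub>M ?U (\<lambda>_. \<mu>) \<Otimes>\<^sub>M \<nu>)) = (\<integral>\<^sup>+R. \<integral>\<^sup>+S. h (s d Z R + S) \<partial>\<nu> \<partial>Pi\<^sub>M ?U (\<lambda>_. \<mu>))"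
      proof (subst \<nu>.nn_integral_fst[symmetric])
        show "(\<lambda>p. h (case p of (R, S) \<Rightarrow> s d Z R + S)) \<in> borel_measurable (Pi\<^sub>M ?U (\<lambda>_. \<mu>) \<Otimes>\<^sub>M \<nu>)"
          unfolding split_beta' by (rule m2) simp
      qed simp
    qed
    also have "\<dots> = (\<integral>\<^sup>+Z. \<integral>\<^sup>+R. \<integral>\<^sup>+S. h (s d Z R + S) \<partial>\<nu> \<partial>Pi\<^sub>M ?J (\<lambda>_. \<mu>) \<partial>Pi\<^sub>M ?U (\<lambda>_. ?Z))"
    proof (intro nn_integral_cong nn_integral_PiM_restrict)
      fix Z :: "nat \<Rightarrow> real"
      show "(\<lambda>R. \<integral>\<^sup>+S. h (s d Z R + S) \<partial>\<nu>) \<in> borel_measurable (Pi\<^sub>M ?J (\<lambda>_. \<mu>))"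
        by (rule \<nu>.borel_measurable_nn_integral, unfold split_beta', rule m2) simp
    qed (auto simp: s_def \<mu>.prob_space_axioms)
    also have "\<dots> = (\<integral>\<^sup>+Z. \<integral>\<^sup>+R. \<integral>\<^sup>+S. h (s d Z R + S) \<partial>\<nu> \<partial>Pi\<^sub>M ?J (\<lambda>_. \<mu>) \<partial>Pi\<^sub>M ?J (\<lambda>_. ?Z))"
    proof (intro nn_integral_PiM_restrict)
      have I: "(\<lambda>w. h (s d (fst (fst w)) (snd (fst w)) + snd w)) \<in> borel_measurable ((Pi\<^sub>M ?J (\<lambda>_. ?Z) \<Otimes>\<^sub>M Pi\<^sub>M ?J (\<lambda>_. \<mu>)) \<Otimes>\<^sub>M \<nu>)"
        unfolding s_def
        by (rule hs[OF ms[OF measurable_compose[OF measurable_fst measurable_fst] measurable_compose[OF measurable_fst measurable_snd]]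
          measurable_compose[OF measurable_snd \<nu>m]]) auto
      show "(\<lambda>Z. \<integral>\<^sup>+R. \<integral>\<^sup>+S. h (s d Z R + S) \<partial>\<nu> \<partial>Pi\<^sub>M ?J (\<lambda>_. \<mu>)) \<in> borel_measurable (Pi\<^sub>M ?J (\<lambda>_. ?Z))"
        by (rule RJ.borel_measurable_nn_integral, unfold split_beta', rule \<nu>.borel_measurable_nn_integral, unfold split_beta', rule I)
    qed (auto simp: s_def measure_pmf.prob_space_axioms)
    also have "\<dots> = (\<integral>\<^sup>+r. h r \<partial>iconv_pow (noise \<delta> \<mu>) d \<nu>)"
      unfolding s_def by (rule nn_integral_bp_sum_finite[OF \<mu> \<nu> h])
    finally show "(\<integral>\<^sup>+w. h (case w of (Z, R, S) \<Rightarrow> s d Z R + S) \<partial>(Pi\<^sub>M ?U (\<lambda>_. ?Z) \<Otimes>\<^sub>M (Pi\<^sub>M ?U (\<lambda>_. \<mu>) \<Otimes>\<^sub>M \<nu>)))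
      = (\<integral>\<^sup>+r. h r \<partial>iconv_pow (noise \<delta> \<mu>) d \<nu>)" .
  qed
  finally show ?thesis .
qed

section \<open>Degradation order and the stringy tree inequality\<close>

lemma symmetric_iconv_pow:
  assumes "symmetric_distribution \<mu>" "symmetric_distribution \<nu>"
  shows "symmetric_distribution (iconv_pow \<mu> n \<nu>)"
  using assms by (induction n) (auto intro: symmetric_iconv)

lemma bp_operator_prob_sets:
  assumes \<mu>: "prob_space \<mu>" "sets \<mu> = sets borel" and \<nu>: "prob_space \<nu>" "sets \<nu> = sets borel"
  shows "prob_space (bp_operator \<delta> P \<nu> \<mu>)" "sets (bp_operator \<delta> P \<nu> \<mu>) = sets borel"
proof -
  interpret prob_space "iconv_pow (noise \<delta> \<mu>) d \<nu>" for d
    by (intro iconv_pow_prob_sets prob_space_noise \<mu> \<nu>) simp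
  show "sets (bp_operator \<delta> P \<nu> \<mu>) = sets borel" by (simp add: bp_operator_def)
  have "emeasure (bp_operator \<delta> P \<nu> \<mu>) (space (bp_operator \<delta> P \<nu> \<mu>)) = (\<integral>\<^sup>+r. 1 \<partial>(bp_operator \<delta> P \<nu> \<mu>))" by simp
  also have "\<dots> = 1"
    using nn_integral_bp_operator[OF assms, of "\<lambda>_. 1"] by (simp add: emeasure_space_1)
  finally show "prob_space (bp_operator \<delta> P \<nu> \<mu>)" by (rule prob_spaceI)
qed

text \<open>Adding the constant B makes the integrand nonnegative, which reduces the claim to
  \<open>nn_integral_bp_operator\<close>.\<close>

lemma integral_bp_operator:
  fixes h :: "ereal \<Rightarrow> real"
  assumes \<mu>: "prob_space \<mu>" "sets \<mu> = sets borel" and \<nu>: "prob_space \<nu>" "sets \<nu> = sets borel"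
    and h [measurable]: "h \<in> borel_measurable borel" and B: "\<And>r. \<bar>h r\<bar> \<le> B"
  shows "(\<integral>r. h r \<partial>bp_operator \<delta> P \<nu> \<mu>) = (\<integral>d. (\<integral>r. h r \<partial>iconv_pow (noise \<delta> \<mu>) d \<nu>) \<partial>measure_pmf P)"
proof -
  let ?N = "\<lambda>d. iconv_pow (noise \<delta> \<mu>) d \<nu>" and ?Q = "bp_operator \<delta> P \<nu> \<mu>"
  interpret N: prob_space "?N d" for d
    by (intro iconv_pow_prob_sets prob_space_noise \<mu> \<nu>) simp
  interpret Q: prob_space ?Q by (rule bp_operator_prob_sets[OF \<mu> \<nu>])
  have sN: "sets (?N d) = sets borel" for d
    by (intro iconv_pow_prob_sets prob_space_noise \<mu> \<nu>) simp
  note [measurable_cong] = sN bp_operator_prob_sets(2)[OF \<mu> \<nu>, of \<delta> P]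
  have B0: "0 \<le> h r + B" for r using B[of r] by auto
  have iN: "integrable (?N d) h" for d by (rule N.integrable_bounded[OF _ B]) measurable
  have iQ: "integrable ?Q h" by (rule Q.integrable_bounded[OF _ B]) measurable
  have bN: "\<bar>\<integral>r. h r \<partial>?N d\<bar> \<le> B" for d
  proof -
    have "\<bar>\<integral>r. h r \<partial>?N d\<bar> \<le> (\<integral>r. \<bar>h r\<bar> \<partial>?N d)" by (rule integral_abs_bound)
    also have "\<dots> \<le> (\<integral>r. B \<partial>?N d)" using iN B by (intro integral_mono) auto
    finally show ?thesis by (simp add: N.prob_space)
  qed
  have iP: "integrable (measure_pmf P) (\<lambda>d. \<integral>r. h r \<partial>?N d)"
    by (rule measure_pmf.integrable_bounded[OF _ bN]) simp
  have "ennreal ((\<integral>r. h r \<partial>?Q) + B) = ennreal (\<integral>r. h r + B \<partial>?Q)"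
    using iQ by (simp add: Q.prob_space)
  also have "\<dots> = (\<integral>\<^sup>+r. ennreal (h r + B) \<partial>?Q)"
    using iQ B0 by (intro nn_integral_eq_integral[symmetric]) auto
  also have "\<dots> = (\<integral>\<^sup>+d. \<integral>\<^sup>+r. ennreal (h r + B) \<partial>?N d \<partial>measure_pmf P)"
    by (rule nn_integral_bp_operator[OF \<mu> \<nu>]) measurable
  also have "\<dots> = (\<integral>\<^sup>+d. ennreal ((\<integral>r. h r \<partial>?N d) + B) \<partial>measure_pmf P)"
  proof (rule nn_integral_cong)
    fix d
    have "(\<integral>\<^sup>+r. ennreal (h r + B) \<partial>?N d) = ennreal (\<integral>r. h r + B \<partial>?N d)"
      using iN B0 by (intro nn_integral_eq_integral) auto
    then show "(\<integral>\<^sup>+r. ennreal (h r + B) \<partial>?N d) = ennreal ((\<integral>r. h r \<partial>?N d) + B)"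
      using iN by (simp add: N.prob_space)
  qed
  also have "\<dots> = ennreal (\<integral>d. (\<integral>r. h r \<partial>?N d) + B \<partial>measure_pmf P)"
  proof (intro nn_integral_eq_integral AE_I2)
    show "0 \<le> (\<integral>r. h r \<partial>?N d) + B" for d using bN[of d] by auto
  qed (use iP in auto)
  also have "\<dots> = ennreal ((\<integral>d. (\<integral>r. h r \<partial>?N d) \<partial>measure_pmf P) + B)"
    using iP by simp
  finally have e: "ennreal ((\<integral>r. h r \<partial>?Q) + B) = ennreal ((\<integral>d. (\<integral>r. h r \<partial>?N d) \<partial>measure_pmf P) + B)" .
  have "0 \<le> (\<integral>r. h r + B \<partial>?Q)" using B0 by (intro Bochner_Integration.integral_nonneg) auto
  then have 1: "0 \<le> (\<integral>r. h r \<partial>?Q) + B" using iQ by (simp add: Q.prob_space)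
  have "0 \<le> (\<integral>d. (\<integral>r. h r \<partial>?N d) + B \<partial>measure_pmf P)"
  proof (intro Bochner_Integration.integral_nonneg)
    show "0 \<le> (\<integral>r. h r \<partial>?N d) + B" for d using bN[of d] by auto
  qed
  then have 2: "0 \<le> (\<integral>d. (\<integral>r. h r \<partial>?N d) \<partial>measure_pmf P) + B" using iP by simp
  show ?thesis using e 1 2 by (simp add: ennreal_inj)
qed

lemma symmetric_bp_operator:
  assumes \<mu>: "symmetric_distribution \<mu>" and \<nu>: "symmetric_distribution \<nu>" and \<delta>: "0 \<le> \<delta>" "\<delta> \<le> 1"
  shows "symmetric_distribution (bp_operator \<delta> P \<nu> \<mu>)"
proof -
  note m = symmetric_distributionD(1,2)[OF \<mu>] and n = symmetric_distributionD(1,2)[OF \<nu>]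
  let ?N = "\<lambda>d. iconv_pow (noise \<delta> \<mu>) d \<nu>" and ?Q = "bp_operator \<delta> P \<nu> \<mu>"
  have N: "symmetric_distribution (?N d)" for d
    by (intro symmetric_iconv_pow symmetric_noise \<mu> \<nu> \<delta>)
  interpret Q: prob_space ?Q by (rule bp_operator_prob_sets[OF m n])
  note [simp] = bp_operator_prob_sets(2)[OF m n]
  note [measurable_cong] = bp_operator_prob_sets(2)[OF m n, of \<delta> P]
  show ?thesis
  proof (rule symmetric_distributionI)
    show "prob_space ?Q" by (rule bp_operator_prob_sets[OF m n])
    have "emeasure ?Q {-\<infinity>} = (\<integral>\<^sup>+r. indicator {-\<infinity>} r \<partial>?Q)" by simp
    also have "\<dots> = (\<integral>\<^sup>+d. \<integral>\<^sup>+r. indicator {-\<infinity>} r \<partial>?N d \<partial>measure_pmf P)"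
      by (rule nn_integral_bp_operator[OF m n]) measurable
    also have "\<dots> = 0"
      using N symmetric_distributionD(2)[OF N]
      by (simp add: symmetric_distribution_def half_extended_distribution_def)
    finally show "AE r in ?Q. r \<noteq> -\<infinity>"
      by (intro AE_I[where N="{-\<infinity>}"]) auto
    fix A :: "ereal set" assume [measurable]: "A \<in> sets borel"
    show "(\<integral>r. (1 - tau r) * indicator A r \<partial>?Q) = (\<integral>r. (1 - tau r) * indicator A (- r) \<partial>?Q)"
      by (subst (1 2) integral_bp_operator[OF m n _ one_minus_tau_indicator_le_2])
         (measurable, subst symmetric_flip[OF N], auto)
  qed simp
qed

lemma symmetric_top: "symmetric_distribution (return borel \<infinity>)"
proof (rule symmetric_distributionI)
  show "prob_space (return borel (\<infinity>::ereal))" by (rule prob_space_return) simp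
  show "AE r in return borel \<infinity>. r \<noteq> - (\<infinity>::ereal)"
    by (subst AE_return) auto
  fix A :: "ereal set" assume [measurable]: "A \<in> sets borel"
  show "(\<integral>r. (1 - tau r) * indicator A r \<partial>return borel \<infinity>) = (\<integral>r. (1 - tau r) * indicator A (- r) \<partial>return borel \<infinity>)"
    by (subst (1 2) integral_return) auto
qed simp

text \<open>The random sign leaves |tau| unchanged; what noise does to |tau| is the scaling of
  \<open>tau_bp_F\<close>.\<close>

lemma integral_noise_abs:
  assumes \<mu>: "symmetric_distribution \<mu>" and e: "0 \<le> e" "e \<le> 1"
    and [measurable]: "f \<in> borel_measurable borel" and B: "\<And>r. \<bar>f \<bar>tau r\<bar> :: real\<bar> \<le> B"
  shows "(\<integral>r. f \<bar>tau r\<bar> \<partial>noise e \<mu>) = (\<integral>r. f (\<bar>1 - 2 * e\<bar> * \<bar>tau r\<bar>) \<partial>\<mu>)"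
proof -
  have "(\<integral>r. f \<bar>tau r\<bar> \<partial>noise e \<mu>) = (\<integral>r. (1 - e) * f \<bar>tau (bp_F e r)\<bar> + e * f \<bar>tau (- bp_F e r)\<bar> \<partial>\<mu>)"
    by (rule integral_noise[OF symmetric_distributionD(1,2)[OF \<mu>] e _ B]) measurable
  also have "\<dots> = (\<integral>r. f (\<bar>1 - 2 * e\<bar> * \<bar>tau r\<bar>) \<partial>\<mu>)"
  proof (intro Bochner_Integration.integral_cong refl)
    fix r
    have *: "\<bar>tau (bp_F e r)\<bar> = \<bar>1 - 2 * e\<bar> * \<bar>tau r\<bar>" by (simp add: tau_bp_F[OF e] abs_mult)
    show "(1 - e) * f \<bar>tau (bp_F e r)\<bar> + e * f \<bar>tau (- bp_F e r)\<bar> = f (\<bar>1 - 2 * e\<bar> * \<bar>tau r\<bar>)"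
      unfolding tau_uminus abs_minus_cancel * by (simp flip: distrib_right)
  qed
  finally show ?thesis .
qed

text \<open>For independent symmetric \<open>r\<close>, \<open>s\<close> with values \<open>x = tau r\<close>, \<open>y = tau s\<close>, the relative sign is positive
  with probability \<open>(1 + x y) / 2\<close>, and then \<open>tau (r + s)\<close> is \<open>(x + y) / (1 + x y)\<close> up to sign. Multiplying
  the denominator into the maximum gives this expression for the mean of \<open>max (t * \<bar>tau\<bar>) a\<close>.\<close>

definition kern :: "real \<Rightarrow> real \<Rightarrow> real \<Rightarrow> real \<Rightarrow> real" where
  "kern t a x y = (max (t * \<bar>x + y\<bar>) (a * (1 + x * y)) + max (t * \<bar>x - y\<bar>) (a * (1 - x * y))) / 2"

lemma kern_minus [simp]: "kern t a (- x) y = kern t a x y" "kern t a x (- y) = kern t a x y"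
proof -
  have "\<bar>- x + y\<bar> = \<bar>x - y\<bar>" "\<bar>- x - y\<bar> = \<bar>x + y\<bar>" by linarith+
  then show "kern t a (- x) y = kern t a x y" "kern t a x (- y) = kern t a x y"
    unfolding kern_def by simp_all
qed

lemma kern_abs: "kern t a \<bar>x\<bar> \<bar>y\<bar> = kern t a x y"
  by (cases "0 \<le> x"; cases "0 \<le> y") simp_all

lemma kern_bound:
  assumes "\<bar>x\<bar> \<le> 1" "\<bar>y\<bar> \<le> 1" "\<bar>t\<bar> \<le> T" "\<bar>a\<bar> \<le> A"
  shows "\<bar>kern t a x y\<bar> \<le> 2 * T + 2 * A"
proof -
  have 1: "\<bar>x * y\<bar> \<le> 1" using assms by (simp add: abs_mult mult_le_one)
  have m: "\<bar>u * v\<bar> \<le> U * 2" if "\<bar>u\<bar> \<le> U" "\<bar>v\<bar> \<le> 2" for u v U :: real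
    unfolding abs_mult using that by (intro mult_mono) auto
  have "\<bar>t * \<bar>x + y\<bar>\<bar> \<le> T * 2" "\<bar>t * \<bar>x - y\<bar>\<bar> \<le> T * 2"
    using assms by (auto intro!: m)
  moreover have "\<bar>a * (1 + x * y)\<bar> \<le> A * 2" "\<bar>a * (1 - x * y)\<bar> \<le> A * 2"
    using assms 1 by (auto intro!: m)
  moreover have "\<bar>(max p q + max r s) / 2\<bar> \<le> 2 * T + 2 * A"
    if "\<bar>p\<bar> \<le> T * 2" "\<bar>r\<bar> \<le> T * 2" "\<bar>q\<bar> \<le> A * 2" "\<bar>s\<bar> \<le> A * 2" for p q r s
  proof -
    have "\<bar>max p q\<bar> \<le> \<bar>p\<bar> + \<bar>q\<bar>" "\<bar>max r s\<bar> \<le> \<bar>r\<bar> + \<bar>s\<bar>" by (simp_all add: max_def)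
    then show ?thesis using that abs_triangle_ineq[of "max p q" "max r s"] by simp
  qed
  ultimately show ?thesis unfolding kern_def by blast
qed

lemma measurable_kern [measurable]:
  assumes [measurable]: "t \<in> borel_measurable M" "a \<in> borel_measurable M" "x \<in> borel_measurable M" "y \<in> borel_measurable M"
  shows "(\<lambda>w. kern (t w) (a w) (x w) (y w)) \<in> borel_measurable M"
  unfolding kern_def by measurable

lemma continuous_on_kern [continuous_intros]:
  fixes t a x y :: "'a::topological_space \<Rightarrow> real"
  assumes "continuous_on S t" "continuous_on S a" "continuous_on S x" "continuous_on S y"
  shows "continuous_on S (\<lambda>w. kern (t w) (a w) (x w) (y w))"
  unfolding kern_def by (intro continuous_intros assms) auto

lemma integral_max_iconv:
  assumes \<mu>: "symmetric_distribution \<mu>" and \<nu>: "symmetric_distribution \<nu>" and t: "0 \<le> t" and a: "0 \<le> a"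
  shows "(\<integral>r. max (t * \<bar>tau r\<bar>) a \<partial>(\<mu> \<star>\<star> \<nu>)) = (\<integral>x. \<integral>y. kern t a (tau x) (tau y) \<partial>\<nu> \<partial>\<mu>)"
proof -
  have B: "\<bar>max (t * \<bar>tau r\<bar>) a\<bar> \<le> t + a" for r
    using abs_tau_le_1[of r] t a mult_left_le[of "\<bar>tau r\<bar>" t] by auto
  \<comment> \<open>The factor 1 + tau x * tau y clears the denominator of \<open>tau_add\<close>;
    where it is 0, so is tau x + tau y.\<close>
  have *: "(1 + tau x * tau y) / 2 * max (t * \<bar>tau (x + y)\<bar>) a = max (t * \<bar>tau x + tau y\<bar>) (a * (1 + tau x * tau y)) / 2" for x y
  proof (cases "tau x * tau y = -1")
    case True
    then have "tau x + tau y = 0" using tau_mult_eq_minus_1[OF True] by auto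
    then show ?thesis using True by simp
  next
    case False
    have "\<bar>tau x * tau y\<bar> \<le> 1" using abs_tau_le_1[of x] abs_tau_le_1[of y] by (simp add: abs_mult mult_le_one)
    with False have p: "0 < 1 + tau x * tau y" by linarith
    have "(1 + tau x * tau y) * max (t * \<bar>tau (x + y)\<bar>) a = max ((1 + tau x * tau y) * (t * \<bar>tau (x + y)\<bar>)) ((1 + tau x * tau y) * a)"
      using p by (simp add: max_mult_distrib_left)
    also have "(1 + tau x * tau y) * (t * \<bar>tau (x + y)\<bar>) = t * \<bar>tau x + tau y\<bar>"
      using p by (simp add: tau_add[OF False] abs_div)
    finally show ?thesis by (simp add: mult.commute)
  qed
  have "(\<integral>r. max (t * \<bar>tau r\<bar>) a \<partial>(\<mu> \<star>\<star> \<nu>)) = (\<integral>x. \<integral>y. (1 + tau x * tau y) / 2 * max (t * \<bar>tau (x + y)\<bar>) a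
      + (1 - tau x * tau y) / 2 * max (t * \<bar>tau (x + - y)\<bar>) a \<partial>\<nu> \<partial>\<mu>)"
    by (rule integral_iconv_even[OF \<mu> \<nu> _ B]) auto
  also have "\<dots> = (\<integral>x. \<integral>y. kern t a (tau x) (tau y) \<partial>\<nu> \<partial>\<mu>)"
  proof (intro Bochner_Integration.integral_cong refl)
    fix x y
    show "(1 + tau x * tau y) / 2 * max (t * \<bar>tau (x + y)\<bar>) a + (1 - tau x * tau y) / 2 * max (t * \<bar>tau (x + - y)\<bar>) a
      = kern t a (tau x) (tau y)"
    proof -
      have neg: "(1 - tau x * tau y) / 2 * max (t * \<bar>tau (x + - y)\<bar>) a = max (t * \<bar>tau x - tau y\<bar>) (a * (1 - tau x * tau y)) / 2"
        using *[of x "- y"] by simp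
      show ?thesis unfolding *[of x y] neg kern_def by (simp add: add_divide_distrib)
    qed
  qed
  finally show ?thesis .
qed

text \<open>\<open>mag \<mu> a\<close> is the mean of \<open>\<bar>tau\<bar>\<close> after adding an independent \<open>bsc a\<close> observation
  (lemma \<open>mag_eq_mag_0\<close>). Hence associativity of the convolution moves observations between the measure
  and the parameter, which yields monotonicity and continuity of the convolution.\<close>

definition mag :: "ereal measure \<Rightarrow> real \<Rightarrow> real" where
  "mag \<mu> a = (\<integral>r. max \<bar>tau r\<bar> a \<partial>\<mu>)"

definition deg :: "ereal measure \<Rightarrow> ereal measure \<Rightarrow> bool"  (infix "\<preceq>" 50) where
  "\<mu> \<preceq> \<nu> \<longleftrightarrow> (\<forall>a\<in>{0..1}. mag \<mu> a \<le> mag \<nu> a)"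

text \<open>Perfect information degraded until |tau| = a almost surely; the crossover probability
  solves 1 - 2 * e = a.\<close>

definition bsc :: "real \<Rightarrow> ereal measure" where
  "bsc a = noise ((1 - a) / 2) (return borel \<infinity>)"

lemma mag_integrable:
  assumes "symmetric_distribution \<mu>"
  shows "integrable \<mu> (\<lambda>r. max \<bar>tau r\<bar> a)"
proof (rule symmetric_integrable[OF assms, where B="1 + \<bar>a\<bar>"])
  show "\<bar>max \<bar>tau r\<bar> a\<bar> \<le> 1 + \<bar>a\<bar>" for r using abs_tau_le_1[of r] by auto
qed measurable

lemma mag_bounds:
  assumes \<mu>: "symmetric_distribution \<mu>"
  shows "a \<le> mag \<mu> a" "a \<le> 1 \<Longrightarrow> mag \<mu> a \<le> 1" "1 \<le> a \<Longrightarrow> mag \<mu> a = a" "0 \<le> mag \<mu> a"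
proof -
  interpret prob_space \<mu> using symmetric_distributionD[OF \<mu>] by simp
  note i = mag_integrable[OF \<mu>]
  have t: "max \<bar>tau r\<bar> a \<le> max 1 a" for r using abs_tau_le_1[of r] by auto
  have "(\<integral>r. a \<partial>\<mu>) \<le> mag \<mu> a" unfolding mag_def using i by (intro integral_mono) auto
  then show 1: "a \<le> mag \<mu> a" by (simp add: prob_space)
  have 2: "mag \<mu> a \<le> max 1 a"
  proof -
    have "mag \<mu> a \<le> (\<integral>r. max 1 a \<partial>\<mu>)" unfolding mag_def using i t by (intro integral_mono) auto
    then show ?thesis by (simp add: prob_space)
  qed
  show "a \<le> 1 \<Longrightarrow> mag \<mu> a \<le> 1" "1 \<le> a \<Longrightarrow> mag \<mu> a = a" using 1 2 by auto
  show "0 \<le> mag \<mu> a" unfolding mag_def by (intro Bochner_Integration.integral_nonneg) auto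
qed

text \<open>The maximum is 1-Lipschitz in each argument. That the constant is common to all laws
  later upgrades pointwise convergence to uniform convergence.\<close>

lemma mag_lipschitz:
  assumes \<mu>: "symmetric_distribution \<mu>"
  shows "\<bar>mag \<mu> a - mag \<mu> b\<bar> \<le> \<bar>a - b\<bar>"
proof -
  interpret prob_space \<mu> using symmetric_distributionD[OF \<mu>] by simp
  note i = mag_integrable[OF \<mu>]
  have "\<bar>mag \<mu> a - mag \<mu> b\<bar> = \<bar>\<integral>r. max \<bar>tau r\<bar> a - max \<bar>tau r\<bar> b \<partial>\<mu>\<bar>"
    unfolding mag_def using i by simp
  also have "\<dots> \<le> (\<integral>r. \<bar>max \<bar>tau r\<bar> a - max \<bar>tau r\<bar> b\<bar> \<partial>\<mu>)" by (rule integral_abs_bound)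
  also have "\<dots> \<le> (\<integral>r. \<bar>a - b\<bar> \<partial>\<mu>)"
    using i by (intro integral_mono) auto
  finally show ?thesis by (simp add: prob_space)
qed

lemma mag_continuous:
  assumes \<mu>: "symmetric_distribution \<mu>"
  shows "continuous_on A (mag \<mu>)"
proof (rule continuous_on_subset[OF _ subset_UNIV])
  have "1-lipschitz_on UNIV (mag \<mu>)"
    using mag_lipschitz[OF \<mu>] by (intro lipschitz_onI) (auto simp: dist_real_def)
  then show "continuous_on UNIV (mag \<mu>)" by (rule lipschitz_on_continuous_on)
qed

lemma measurable_mag:
  assumes "symmetric_distribution \<mu>"
  shows "mag \<mu> \<in> borel_measurable borel"
  by (rule borel_measurable_continuous_onI[OF mag_continuous[OF assms]])

lemma mag_mono:
  assumes \<mu>: "symmetric_distribution \<mu>" and "a \<le> b"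
  shows "mag \<mu> a \<le> mag \<mu> b"
  unfolding mag_def using assms mag_integrable[OF \<mu>] by (intro integral_mono) auto

lemma mag_noise_eq:
  assumes \<mu>: "symmetric_distribution \<mu>" and e: "0 \<le> e" "e \<le> 1"
  shows "mag (noise e \<mu>) a = (\<integral>r. max (\<bar>1 - 2 * e\<bar> * \<bar>tau r\<bar>) a \<partial>\<mu>)"
  unfolding mag_def
proof (rule integral_noise_abs[OF \<mu> e, where B="1 + \<bar>a\<bar>"])
  show "\<bar>max \<bar>tau r\<bar> a\<bar> \<le> 1 + \<bar>a\<bar>" for r using abs_tau_le_1[of r] by auto
qed measurable

text \<open>The factor |1 - 2 * e| is pulled out of the maximum, unless it is 0 and |tau| is wiped
  out.\<close>

lemma mag_noise:
  assumes \<mu>: "symmetric_distribution \<mu>" and e: "0 \<le> e" "e \<le> 1" and a: "0 \<le> a"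
  shows "mag (noise e \<mu>) a = (if e = 1 / 2 then a else \<bar>1 - 2 * e\<bar> * mag \<mu> (a / \<bar>1 - 2 * e\<bar>))"
proof (cases "e = 1/2")
  case True
  interpret prob_space \<mu> using symmetric_distributionD[OF \<mu>] by simp
  have "\<bar>1 - 2 * e\<bar> = 0" using True by simp
  then have "mag (noise e \<mu>) a = a" unfolding mag_noise_eq[OF \<mu> e] using a by (simp add: prob_space max_def)
  with True show ?thesis by simp
next
  case False
  then have p: "0 < \<bar>1 - 2 * e\<bar>" by simp
  have "max (\<bar>1 - 2 * e\<bar> * \<bar>tau r\<bar>) a = \<bar>1 - 2 * e\<bar> * max \<bar>tau r\<bar> (a / \<bar>1 - 2 * e\<bar>)" for r
    using p by (simp add: max_mult_distrib_left)
  then have "mag (noise e \<mu>) a = (\<integral>r. \<bar>1 - 2 * e\<bar> * max \<bar>tau r\<bar> (a / \<bar>1 - 2 * e\<bar>) \<partial>\<mu>)"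
    unfolding mag_noise_eq[OF \<mu> e] by presburger
  then show ?thesis using False by (simp add: mag_def)
qed

lemma symmetric_bsc: "0 \<le> a \<Longrightarrow> a \<le> 1 \<Longrightarrow> symmetric_distribution (bsc a)"
  unfolding bsc_def by (intro symmetric_noise symmetric_top) auto

lemma integral_bsc_abs:
  assumes a: "0 \<le> a" "a \<le> 1" and [measurable]: "f \<in> borel_measurable borel" and B: "\<And>r. \<bar>f \<bar>tau r\<bar> :: real\<bar> \<le> B"
  shows "(\<integral>r. f \<bar>tau r\<bar> \<partial>bsc a) = f a"
proof -
  have *: "\<bar>1 - 2 * ((1 - a) / 2)\<bar> = a" using a by (simp add: field_simps)
  have "(\<integral>r. f \<bar>tau r\<bar> \<partial>bsc a) = (\<integral>r. f (\<bar>1 - 2 * ((1 - a) / 2)\<bar> * \<bar>tau r\<bar>) \<partial>return borel \<infinity>)"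
    unfolding bsc_def using a by (intro integral_noise_abs[where f=f and B=B] symmetric_top B) auto
  then show ?thesis unfolding * by (subst (asm) integral_return) auto
qed

text \<open>At a = 0 the kernel is (|x + y| + |x - y|) / 2 = max |x| |y|, so a second observation
  acts exactly like a random parameter.\<close>

lemma mag_0_iconv:
  assumes \<mu>: "symmetric_distribution \<mu>" and \<kappa>: "symmetric_distribution \<kappa>"
  shows "mag (\<mu> \<star>\<star> \<kappa>) 0 = (\<integral>c. mag \<mu> \<bar>tau c\<bar> \<partial>\<kappa>)"
proof -
  note m = symmetric_distributionD(1,2)[OF \<mu>] and k = symmetric_distributionD(1,2)[OF \<kappa>]
  have "mag (\<mu> \<star>\<star> \<kappa>) 0 = (\<integral>r. max (1 * \<bar>tau r\<bar>) 0 \<partial>(\<kappa> \<star>\<star> \<mu>))"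
    unfolding mag_def by (simp add: iconv_commute[OF m k])
  also have "\<dots> = (\<integral>x. \<integral>y. kern 1 0 (tau x) (tau y) \<partial>\<mu> \<partial>\<kappa>)"
    by (rule integral_max_iconv[OF \<kappa> \<mu>]) auto
  also have "\<dots> = (\<integral>c. mag \<mu> \<bar>tau c\<bar> \<partial>\<kappa>)"
    unfolding mag_def
    by (intro Bochner_Integration.integral_cong refl) (auto simp: kern_def max_def)
  finally show ?thesis .
qed

lemma mag_eq_mag_0:
  assumes \<mu>: "symmetric_distribution \<mu>" and a: "0 \<le> a" "a \<le> 1"
  shows "mag \<mu> a = mag (\<mu> \<star>\<star> bsc a) 0"
proof -
  have B: "\<bar>mag \<mu> \<bar>tau r\<bar>\<bar> \<le> 1" for r
    using mag_bounds(2,4)[OF \<mu>, of "\<bar>tau r\<bar>"] abs_tau_le_1[of r] by simp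
  show ?thesis
    by (subst mag_0_iconv[OF \<mu> symmetric_bsc[OF a]], subst integral_bsc_abs[where f="mag \<mu>", OF a measurable_mag[OF \<mu>] B]) simp
qed

text \<open>Here \<mu> enters only through \<open>mag \<mu>\<close>, averaged over a law independent
  of \<mu>. Monotonicity, continuity and the equality cases of convolution all rest on this.\<close>

lemma mag_iconv:
  assumes \<mu>: "symmetric_distribution \<mu>" and \<nu>: "symmetric_distribution \<nu>" and a: "0 \<le> a" "a \<le> 1"
  shows "mag (\<mu> \<star>\<star> \<nu>) a = (\<integral>c. mag \<mu> \<bar>tau c\<bar> \<partial>(\<nu> \<star>\<star> bsc a))"
proof -
  note m = symmetric_distributionD(1,2)
  have "mag (\<mu> \<star>\<star> \<nu>) a = mag ((\<mu> \<star>\<star> \<nu>) \<star>\<star> bsc a) 0"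
    by (rule mag_eq_mag_0[OF symmetric_iconv[OF \<mu> \<nu>] a])
  also have "(\<mu> \<star>\<star> \<nu>) \<star>\<star> bsc a = \<mu> \<star>\<star> (\<nu> \<star>\<star> bsc a)"
    by (rule iconv_assoc[OF m[OF \<mu>] m[OF \<nu>] m[OF symmetric_bsc[OF a]]])
  also have "mag \<dots> 0 = (\<integral>c. mag \<mu> \<bar>tau c\<bar> \<partial>(\<nu> \<star>\<star> bsc a))"
    by (rule mag_0_iconv[OF \<mu> symmetric_iconv[OF \<nu> symmetric_bsc[OF a]]])
  finally show ?thesis .
qed

lemma mag_tau_integrable:
  assumes \<mu>: "symmetric_distribution \<mu>" and \<kappa>: "symmetric_distribution \<kappa>"
  shows "integrable \<kappa> (\<lambda>c. mag \<mu> \<bar>tau c\<bar>)"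
proof (rule symmetric_integrable[OF \<kappa>, where B=1])
  note [measurable] = measurable_mag[OF \<mu>]
  show "(\<lambda>c. mag \<mu> \<bar>tau c\<bar>) \<in> borel_measurable borel" by measurable
  show "\<bar>mag \<mu> \<bar>tau r\<bar>\<bar> \<le> 1" for r
    using mag_bounds(2,4)[OF \<mu>, of "\<bar>tau r\<bar>"] abs_tau_le_1[of r] by simp
qed

lemma deg_refl [simp]: "\<mu> \<preceq> \<mu>" by (simp add: deg_def)

lemma deg_trans [trans]: "\<mu> \<preceq> \<nu> \<Longrightarrow> \<nu> \<preceq> \<kappa> \<Longrightarrow> \<mu> \<preceq> \<kappa>"
  unfolding deg_def by (meson order.trans)

lemma degD: "\<mu> \<preceq> \<nu> \<Longrightarrow> 0 \<le> a \<Longrightarrow> a \<le> 1 \<Longrightarrow> mag \<mu> a \<le> mag \<nu> a"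
  unfolding deg_def by auto

lemma deg_iconv_left:
  assumes \<mu>: "symmetric_distribution \<mu>" "symmetric_distribution \<mu>'" and \<nu>: "symmetric_distribution \<nu>"
    and "\<mu> \<preceq> \<mu>'"
  shows "\<mu> \<star>\<star> \<nu> \<preceq> \<mu>' \<star>\<star> \<nu>"
  unfolding deg_def
proof
  fix a :: real assume "a \<in> {0..1}"
  then have a: "0 \<le> a" "a \<le> 1" by auto
  note k = symmetric_iconv[OF \<nu> symmetric_bsc[OF a]]
  show "mag (\<mu> \<star>\<star> \<nu>) a \<le> mag (\<mu>' \<star>\<star> \<nu>) a"
    unfolding mag_iconv[OF \<mu>(1) \<nu> a] mag_iconv[OF \<mu>(2) \<nu> a]
    by (intro integral_mono mag_tau_integrable \<mu> k degD[OF assms(4)] abs_tau_le_1) auto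
qed

lemma deg_iconv:
  assumes \<mu>: "symmetric_distribution \<mu>" "symmetric_distribution \<mu>'"
    and \<nu>: "symmetric_distribution \<nu>" "symmetric_distribution \<nu>'"
    and d: "\<mu> \<preceq> \<mu>'" "\<nu> \<preceq> \<nu>'"
  shows "\<mu> \<star>\<star> \<nu> \<preceq> \<mu>' \<star>\<star> \<nu>'"
proof -
  note m = symmetric_distributionD(1,2)
  have "\<mu> \<star>\<star> \<nu> \<preceq> \<mu>' \<star>\<star> \<nu>" by (rule deg_iconv_left[OF \<mu> \<nu>(1) d(1)])
  also have "\<mu>' \<star>\<star> \<nu> = \<nu> \<star>\<star> \<mu>'" by (rule iconv_commute[OF m[OF \<mu>(2)] m[OF \<nu>(1)]])
  also have "\<nu> \<star>\<star> \<mu>' \<preceq> \<nu>' \<star>\<star> \<mu>'" by (rule deg_iconv_left[OF \<nu> \<mu>(2) d(2)])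
  also have "\<nu>' \<star>\<star> \<mu>' = \<mu>' \<star>\<star> \<nu>'" by (rule iconv_commute[OF m[OF \<nu>(2)] m[OF \<mu>(2)]])
  finally show ?thesis .
qed

lemma deg_iconv_pow:
  assumes "symmetric_distribution \<mu>" "symmetric_distribution \<mu>'"
    "symmetric_distribution \<nu>" "symmetric_distribution \<nu>'" "\<mu> \<preceq> \<mu>'" "\<nu> \<preceq> \<nu>'"
  shows "iconv_pow \<mu> n \<nu> \<preceq> iconv_pow \<mu>' n \<nu>'"
proof (induction n)
  case (Suc n)
  show ?case
    unfolding iconv_pow.simps
    by (rule deg_iconv[OF assms(1,2) symmetric_iconv_pow symmetric_iconv_pow assms(5) Suc.IH]) (rule assms)+
qed (use assms in simp)

lemma deg_noise:
  assumes \<mu>: "symmetric_distribution \<mu>" "symmetric_distribution \<mu>'" and e: "0 \<le> e" "e \<le> 1" and d: "\<mu> \<preceq> \<mu>'"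
  shows "noise e \<mu> \<preceq> noise e \<mu>'"
  unfolding deg_def
proof
  fix a :: real assume "a \<in> {0..1}"
  then have a: "0 \<le> a" "a \<le> 1" by auto
  \<comment> \<open>The rescaled parameter may exceed 1, where \<open>mag\<close> is the identity
    for both laws.\<close>
  have "mag \<mu> b \<le> mag \<mu>' b" if "0 \<le> b" for b
    using degD[OF d that] mag_bounds(3)[OF \<mu>(1), of b] mag_bounds(3)[OF \<mu>(2), of b] by (cases "b \<le> 1") auto
  then show "mag (noise e \<mu>) a \<le> mag (noise e \<mu>') a"
    unfolding mag_noise[OF \<mu>(1) e a(1)] mag_noise[OF \<mu>(2) e a(1)] using a by (auto intro!: mult_left_mono)
qed

lemma mag_bp_operator:
  assumes \<mu>: "symmetric_distribution \<mu>" and \<nu>: "symmetric_distribution \<nu>"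
  shows "mag (bp_operator \<delta> P \<nu> \<mu>) a = (\<integral>d. mag (iconv_pow (noise \<delta> \<mu>) d \<nu>) a \<partial>measure_pmf P)"
  unfolding mag_def
proof (rule integral_bp_operator[OF symmetric_distributionD(1,2)[OF \<mu>] symmetric_distributionD(1,2)[OF \<nu>], where B="1 + \<bar>a\<bar>"])
  show "\<bar>max \<bar>tau r\<bar> a\<bar> \<le> 1 + \<bar>a\<bar>" for r using abs_tau_le_1[of r] by auto
qed measurable

lemma mag_pmf_integrable:
  assumes "\<And>d. symmetric_distribution (N d)"
  shows "integrable (measure_pmf P) (\<lambda>d. mag (N d) a)"
proof (rule measure_pmf.integrable_bounded[where B="1 + \<bar>a\<bar>"])
  show "\<bar>mag (N d) a\<bar> \<le> 1 + \<bar>a\<bar>" for d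
    using mag_bounds[OF assms[of d], of a] by (cases "a \<le> 1") auto
qed simp

lemma deg_bp_operator:
  assumes \<mu>: "symmetric_distribution \<mu>" "symmetric_distribution \<mu>'" and \<nu>: "symmetric_distribution \<nu>"
    and \<delta>: "0 \<le> \<delta>" "\<delta> \<le> 1" and d: "\<mu> \<preceq> \<mu>'"
  shows "bp_operator \<delta> P \<nu> \<mu> \<preceq> bp_operator \<delta> P \<nu> \<mu>'"
proof -
  note N = symmetric_noise[OF \<mu>(1) \<delta>] symmetric_noise[OF \<mu>(2) \<delta>]
  have "iconv_pow (noise \<delta> \<mu>) n \<nu> \<preceq> iconv_pow (noise \<delta> \<mu>') n \<nu>" for n
    by (rule deg_iconv_pow[OF N \<nu> \<nu> deg_noise[OF \<mu> \<delta> d] deg_refl])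
  then have "mag (iconv_pow (noise \<delta> \<mu>) n \<nu>) a \<le> mag (iconv_pow (noise \<delta> \<mu>') n \<nu>) a" if "a \<in> {0..1}" for n a
    using that unfolding deg_def by blast
  then show ?thesis
    unfolding deg_def mag_bp_operator[OF \<mu>(1) \<nu>] mag_bp_operator[OF \<mu>(2) \<nu>]
    by (intro ballI integral_mono mag_pmf_integrable[OF symmetric_iconv_pow[OF N(1) \<nu>], where P=P]
         mag_pmf_integrable[OF symmetric_iconv_pow[OF N(2) \<nu>], where P=P]) auto
qed

text \<open>Of the four ways to resolve the two maxima, the one with \<open>a (1 + x y)\<close> and \<open>\<bar>x - y\<bar>\<close> never wins alone,
  and the other three are nonincreasing in the product \<open>x y\<close>.\<close>

lemma kern_noise_le_aux:
  fixes x y a t :: real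
  assumes xy: "\<bar>x\<bar> \<le> 1" "\<bar>y\<bar> \<le> 1" "0 \<le> x * y" and t: "0 \<le> t" "t \<le> 1" and a: "0 \<le> a"
  shows "2 * kern t a x y = t * \<bar>x + y\<bar> + t * \<bar>x - y\<bar> \<or>
    2 * kern t a x y = t * \<bar>x + y\<bar> + a * (1 - x * y) \<or> 2 * kern t a x y = 2 * a"
proof -
  define A C p where "A = t * \<bar>x + y\<bar>" and "C = t * \<bar>x - y\<bar>" and "p = x * y"
  have p1: "p \<le> 1" using xy unfolding p_def by (metis abs_le_D1 abs_mult abs_ge_zero mult_le_one)
  have p0: "0 \<le> p" using xy by (simp add: p_def)
  \<comment> \<open>In terms of observations: when the signs agree, the sum has the larger |tau|
    than the difference.\<close>
  have "\<bar>x - y\<bar> * (1 + p) \<le> \<bar>x + y\<bar> * (1 - p)"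
  proof (rule power2_le_imp_le)
    have "((x + y) * (1 - p))\<^sup>2 - ((x - y) * (1 + p))\<^sup>2 = 4 * (x * y) * (1 - x\<^sup>2) * (1 - y\<^sup>2)"
      by (simp add: p_def power2_eq_square algebra_simps)
    also have "\<dots> \<ge> 0"
    proof -
      have "0 \<le> 4 * (x * y)" "0 \<le> 1 - x\<^sup>2" "0 \<le> 1 - y\<^sup>2" using xy by (simp_all add: abs_square_le_1)
      then show ?thesis by (metis mult_nonneg_nonneg)
    qed
    finally show "(\<bar>x - y\<bar> * (1 + p))\<^sup>2 \<le> (\<bar>x + y\<bar> * (1 - p))\<^sup>2"
      by (simp add: power_mult_distrib)
    show "0 \<le> \<bar>x + y\<bar> * (1 - p)" using p1 by simp
  qed
  from mult_left_mono[OF this t(1)] have key: "C * (1 + p) \<le> A * (1 - p)"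
    by (simp add: A_def C_def mult.assoc)
  have K: "2 * kern t a x y = max A (a * (1 + p)) + max C (a * (1 - p))"
    by (simp add: kern_def A_def C_def p_def)
  have "2 * kern t a x y = A + C \<or> 2 * kern t a x y = A + a * (1 - p) \<or> 2 * kern t a x y = 2 * a"
  proof (cases "a * (1 + p) \<le> A")
    case True
    then show ?thesis unfolding K by (auto simp: max_def)
  next
    case False
    show ?thesis
    proof (cases "C \<le> a * (1 - p)")
      case True
      with False show ?thesis unfolding K by (auto simp: max_def algebra_simps)
    next
      \<comment> \<open>Here the term with |x - y| would win although the one with |x + y| loses,
        against \<open>key\<close>.\<close>
      case c: False
      have "A * (1 - p) \<le> a * (1 + p) * (1 - p)" using False p1 by (intro mult_right_mono) auto
      also have "\<dots> = a * (1 - p) * (1 + p)" by simp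
      also have "\<dots> < C * (1 + p)" using c p0 by (intro mult_strict_right_mono) auto
      finally show ?thesis using key by simp
    qed
  qed
  then show ?thesis by (simp add: A_def C_def p_def)
qed

text \<open>The right side has the smaller product t * t * (x * y) and the same terms in |x + y| and
  |x - y|; its sum of maxima dominates each of the three alternatives.\<close>

lemma kern_noise_le_nonneg:
  assumes xy: "\<bar>x\<bar> \<le> 1" "\<bar>y\<bar> \<le> 1" "0 \<le> x * y" and t: "0 \<le> t" "t \<le> 1" and a: "0 \<le> a"
  shows "kern t a x y \<le> kern 1 a (t * x) (t * y)"
proof -
  have "t * t \<le> 1" using t by (simp add: mult_le_one)
  from mult_right_mono[OF this xy(3)] have q: "t * x * (t * y) \<le> x * y"
    by (simp add: mult_ac)
  have "\<bar>t * x + t * y\<bar> = t * \<bar>x + y\<bar>" "\<bar>t * x - t * y\<bar> = t * \<bar>x - y\<bar>"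
    using t by (simp_all add: abs_mult flip: distrib_left right_diff_distrib)
  then have R: "2 * kern 1 a (t * x) (t * y) =
      max (t * \<bar>x + y\<bar>) (a * (1 + t * x * (t * y))) + max (t * \<bar>x - y\<bar>) (a * (1 - t * x * (t * y)))"
    by (simp add: kern_def)
  have "a * (1 - x * y) \<le> a * (1 - t * x * (t * y))" using q a by (intro mult_left_mono) auto
  moreover have "a * (1 + t * x * (t * y)) + a * (1 - t * x * (t * y)) = 2 * a" by (simp add: algebra_simps)
  ultimately have "2 * kern t a x y \<le> 2 * kern 1 a (t * x) (t * y)"
    using kern_noise_le_aux[OF assms] unfolding R by linarith
  then show ?thesis by simp
qed

lemma kern_noise_le:
  assumes xy: "\<bar>x\<bar> \<le> 1" "\<bar>y\<bar> \<le> 1" and t: "0 \<le> t" "t \<le> 1" and a: "0 \<le> a"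
  shows "kern t a x y \<le> kern 1 a (t * x) (t * y)"
proof -
  have "kern t a x y = kern t a \<bar>x\<bar> \<bar>y\<bar>" by (simp add: kern_abs)
  also have "\<dots> \<le> kern 1 a (t * \<bar>x\<bar>) (t * \<bar>y\<bar>)" using assms by (intro kern_noise_le_nonneg) auto
  also have "\<dots> = kern 1 a \<bar>t * x\<bar> \<bar>t * y\<bar>" using t by (simp add: abs_mult)
  also have "\<dots> = kern 1 a (t * x) (t * y)" by (rule kern_abs)
  finally show ?thesis .
qed

text \<open>With q = t * x * (t * y), the conditions on a resolve the maxima on the right to t * (x
  + y) and a * (1 - q). The three alternatives for the left side are strictly smaller by the first
  condition, by q < x * y, and by the second condition, respectively.\<close>

lemma kern_noise_less:
  assumes x: "0 < x" "x \<le> 1" and y: "0 < y" "y \<le> 1" and t: "0 < t" "t < 1"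
    and a: "t * \<bar>x - y\<bar> < a * (1 - t * x * (t * y))" "a * (1 + t * x * (t * y)) < t * (x + y)" "0 < a"
  shows "kern t a x y < kern 1 a (t * x) (t * y)"
proof -
  have "0 < x * y" using x y by simp
  moreover have "t * t < 1" using t mult_strict_mono[of t 1 t 1] by simp
  ultimately have "t * t * (x * y) < 1 * (x * y)" by (intro mult_strict_right_mono)
  then have q: "t * x * (t * y) < x * y"
    by (simp add: mult_ac)
  have "\<bar>t * x + t * y\<bar> = t * \<bar>x + y\<bar>" "\<bar>t * x - t * y\<bar> = t * \<bar>x - y\<bar>"
    using t by (simp_all add: abs_mult flip: distrib_left right_diff_distrib)
  then have R: "2 * kern 1 a (t * x) (t * y) = t * \<bar>x + y\<bar> + a * (1 - t * x * (t * y))"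
    using a x y by (simp add: kern_def)
  have "a * (1 - x * y) < a * (1 - t * x * (t * y))" using q a by (intro mult_strict_left_mono) auto
  moreover have "a * (1 + t * x * (t * y)) + a * (1 - t * x * (t * y)) = 2 * a" by (simp add: algebra_simps)
  moreover have "\<bar>x\<bar> \<le> 1" "\<bar>y\<bar> \<le> 1" "0 \<le> x * y" "\<bar>x + y\<bar> = x + y" using x y by auto
  ultimately have "2 * kern t a x y < 2 * kern 1 a (t * x) (t * y)"
    using kern_noise_le_aux[of x y t a] t a(1,2) less_imp_le[OF a(3)] unfolding R by linarith
  then show ?thesis by simp
qed

section \<open>Compactness and weak convergence\<close>

text \<open>Inverse of tau, continued by constants outside [-1, 1] to be total, monotone and
  continuous.\<close>

definition rho :: "real \<Rightarrow> ereal" where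
  "rho x = (if 1 \<le> x then \<infinity> else if x \<le> -1 then -\<infinity> else ereal (2 * artanh x))"

lemma tau_rho: "\<bar>x\<bar> \<le> 1 \<Longrightarrow> tau (rho x) = x"
  by (auto simp: rho_def tanh_artanh)

lemma rho_tau: "rho (tau r) = r"
  by (subst tau_eq_iff[symmetric], rule tau_rho[OF abs_tau_le_1])

lemma rho_uminus: "rho (- x) = - rho x"
  by (auto simp: rho_def artanh_minus_real)

lemma mono_rho: "x \<le> y \<Longrightarrow> rho x \<le> rho y"
proof -
  assume xy: "x \<le> y"
  have "artanh x \<le> artanh y" if "-1 < x" "y < 1"
  proof (rule ccontr)
    assume "\<not> artanh x \<le> artanh y"
    then have "tanh (artanh y) < tanh (artanh x)" by simp
    then show False using that xy by (simp add: tanh_artanh)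
  qed
  then show ?thesis using xy by (auto simp: rho_def)
qed

text \<open>A monotone map onto all of \<open>ereal\<close> cannot jump.\<close>

lemma continuous_on_rho: "continuous_on A rho"
proof (rule continuous_on_subset[OF _ subset_UNIV], rule continuous_onI_mono)
  have "rho ` UNIV = UNIV" using rho_tau by (metis surj_def)
  then show "open (rho ` UNIV)" by simp
qed (rule mono_rho)

lemma measurable_rho [measurable]: "rho \<in> borel_measurable borel"
  by (rule borel_measurable_continuous_onI[OF continuous_on_rho])

text \<open>The conditional mean of h given |tau| = x under a symmetric law.\<close>

definition mixed :: "(ereal \<Rightarrow> real) \<Rightarrow> real \<Rightarrow> real" where
  "mixed h x = (1 + x) / 2 * h (rho x) + (1 - x) / 2 * h (- rho x)"

definition clamp01 :: "real \<Rightarrow> real" where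
  "clamp01 x = max 0 (min 1 x)"

lemma clamp01: "0 \<le> clamp01 x" "clamp01 x \<le> 1" "0 \<le> x \<Longrightarrow> x \<le> 1 \<Longrightarrow> clamp01 x = x"
  by (auto simp: clamp01_def)

lemma measurable_clamp01 [measurable]: "clamp01 \<in> borel_measurable borel"
  unfolding clamp01_def by measurable

lemma continuous_clamp01: "continuous_on A clamp01"
  unfolding clamp01_def by (intro continuous_intros)

lemma measurable_mixed [measurable]:
  assumes [measurable]: "h \<in> borel_measurable borel"
  shows "mixed h \<in> borel_measurable borel"
  unfolding mixed_def by measurable

lemma mixed_bound:
  assumes "\<And>r. \<bar>h r\<bar> \<le> B" "0 \<le> x" "x \<le> 1"
  shows "\<bar>mixed h x\<bar> \<le> B"
proof -
  have "\<bar>mixed h x\<bar> \<le> \<bar>(1 + x) / 2 * h (rho x)\<bar> + \<bar>(1 - x) / 2 * h (- rho x)\<bar>"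
    unfolding mixed_def by (rule abs_triangle_ineq)
  also have "\<dots> \<le> (1 + x) / 2 * B + (1 - x) / 2 * B"
    unfolding abs_mult using assms by (intro add_mono mult_mono) auto
  also have "\<dots> = B" by (simp add: field_simps)
  finally show ?thesis .
qed

lemma mixed_tau: "mixed h \<bar>tau r\<bar> = (1 + tau r) / 2 * h r + (1 - tau r) / 2 * h (- r)"
proof (cases "0 \<le> tau r")
  case False
  then have "\<bar>tau r\<bar> = tau (- r)" by simp
  then show ?thesis by (simp only: mixed_def rho_tau) simp
qed (simp add: mixed_def rho_tau)

definition abs_law :: "ereal measure \<Rightarrow> real measure" where
  "abs_law \<mu> = distr \<mu> borel (\<lambda>r. \<bar>tau r\<bar>)"

lemma measurable_abs_tau:
  assumes "symmetric_distribution \<mu>"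
  shows "(\<lambda>r. \<bar>tau r\<bar>) \<in> borel_measurable \<mu>"
  using symmetric_distributionD(2)[OF assms] by (simp cong: measurable_cong_sets)

lemma real_distribution_abs_law:
  assumes "symmetric_distribution \<mu>"
  shows "real_distribution (abs_law \<mu>)"
proof -
  interpret prob_space \<mu> using symmetric_distributionD[OF assms] by simp
  show ?thesis unfolding abs_law_def by (rule real_distribution_distr[OF measurable_abs_tau[OF assms]])
qed

lemma integral_abs_law:
  fixes f :: "real \<Rightarrow> real"
  assumes "symmetric_distribution \<mu>" and [measurable]: "f \<in> borel_measurable borel"
  shows "(\<integral>x. f x \<partial>abs_law \<mu>) = (\<integral>r. f \<bar>tau r\<bar> \<partial>\<mu>)"
  unfolding abs_law_def by (rule integral_distr[OF measurable_abs_tau[OF assms(1)]]) simp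

lemma integral_eq_mixed:
  assumes \<mu>: "symmetric_distribution \<mu>" and [measurable]: "h \<in> borel_measurable borel" and B: "\<And>r. \<bar>h r\<bar> \<le> B"
  shows "(\<integral>r. h r \<partial>\<mu>) = (\<integral>x. mixed h x \<partial>abs_law \<mu>)"
proof -
  have "(\<integral>x. mixed h x \<partial>abs_law \<mu>) = (\<integral>r. mixed h \<bar>tau r\<bar> \<partial>\<mu>)"
    by (rule integral_abs_law[OF \<mu>]) measurable
  also have "\<dots> = (\<integral>r. h r \<partial>\<mu>)"
    unfolding mixed_tau by (rule symmetric_mix[OF \<mu> _ B, symmetric]) measurable
  finally show ?thesis ..
qed

lemma symmetric_eqI:
  assumes \<mu>: "symmetric_distribution \<mu>" and \<nu>: "symmetric_distribution \<nu>" and eq: "abs_law \<mu> = abs_law \<nu>"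
  shows "\<mu> = \<nu>"
proof (rule measure_eqI)
  note m = symmetric_distributionD[OF \<mu>] and n = symmetric_distributionD[OF \<nu>]
  interpret \<mu>: prob_space \<mu> by (rule m)
  interpret \<nu>: prob_space \<nu> by (rule n)
  show "sets \<mu> = sets \<nu>" using m n by simp
  fix A assume "A \<in> sets \<mu>"
  then have A [measurable]: "A \<in> sets borel" using m by simp
  have "measure \<mu> A = (\<integral>r. indicator A r \<partial>\<mu>)" using m by simp
  also have "\<dots> = (\<integral>r. indicator A r \<partial>\<nu>)"
    using integral_eq_mixed[OF \<mu>, of "indicator A" 1] integral_eq_mixed[OF \<nu>, of "indicator A" 1]
    by (simp add: eq indicator_def)
  also have "\<dots> = measure \<nu> A" using n by simp
  finally show "emeasure \<mu> A = emeasure \<nu> A"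
    by (simp add: \<mu>.emeasure_eq_measure \<nu>.emeasure_eq_measure)
qed

text \<open>The right derivative of a \<mapsto> max u a is the indicator of u \<le> a, so the right
  derivative of \<open>mag \<mu>\<close> is the distribution function of |tau|.\<close>

lemma cdf_abs_law_limit:
  assumes \<mu>: "symmetric_distribution \<mu>"
  shows "(\<lambda>n. real (Suc n) * (mag \<mu> (x + 1 / real (Suc n)) - mag \<mu> x)) \<longlonglongrightarrow> cdf (abs_law \<mu>) x"
proof -
  interpret prob_space \<mu> using symmetric_distributionD[OF \<mu>] by simp
  note [measurable_cong] = symmetric_distributionD(2)[OF \<mu>]
  define f where "f n r = real (Suc n) * (max \<bar>tau r\<bar> (x + 1 / real (Suc n)) - max \<bar>tau r\<bar> x)" for n r
  have "(\<lambda>n. \<integral>r. f n r \<partial>\<mu>) \<longlonglongrightarrow> (\<integral>r. indicator {..x} \<bar>tau r\<bar> \<partial>\<mu>)"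
  proof (rule integral_dominated_convergence[where w="\<lambda>_. 1"])
    show "AE r in \<mu>. (\<lambda>n. f n r) \<longlonglongrightarrow> indicator {..x} \<bar>tau r\<bar>"
    proof (rule AE_I2)
      fix r
      show "(\<lambda>n. f n r) \<longlonglongrightarrow> indicator {..x} \<bar>tau r\<bar>"
      proof (cases "\<bar>tau r\<bar> \<le> x")
        case True
        have "f n r = 1" for n
        proof -
          have "0 < 1 / real (Suc n)" by simp
          with True have "max \<bar>tau r\<bar> (x + 1 / real (Suc n)) = x + 1 / real (Suc n)" by linarith
          moreover have "max \<bar>tau r\<bar> x = x" using True by simp
          ultimately have "f n r = real (Suc n) * (1 / real (Suc n))" unfolding f_def by (simp only: add_diff_cancel_left')
          then show ?thesis by simp
        qed
        then show ?thesis using True by simp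
      next
        case False
        have "(\<lambda>n. x + 1 / real (Suc n)) \<longlonglongrightarrow> x + 0"
          by (intro tendsto_add tendsto_const LIMSEQ_Suc[OF lim_1_over_n])
        then have "\<forall>\<^sub>F n in sequentially. x + 1 / real (Suc n) < \<bar>tau r\<bar>"
          using False by (intro order_tendstoD(2)) auto
        then have "\<forall>\<^sub>F n in sequentially. f n r = 0"
          by eventually_elim (use False in \<open>simp add: f_def\<close>)
        then show ?thesis using False by (simp add: tendsto_eventually)
      qed
    qed
    show "AE r in \<mu>. norm (f n r) \<le> 1" for n
    proof (rule AE_I2)
      fix r
      have scale: "\<bar>real (Suc n) * u\<bar> \<le> 1" if "0 \<le> u" "u \<le> 1 / real (Suc n)" for u
      proof -
        have "\<bar>real (Suc n) * u\<bar> = real (Suc n) * u" using that(1) by (intro abs_of_nonneg) simp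
        also have "\<dots> \<le> real (Suc n) * (1 / real (Suc n))" using that(2) by (intro mult_left_mono) auto
        finally show ?thesis by simp
      qed
      have "0 \<le> max \<bar>tau r\<bar> (x + 1 / real (Suc n)) - max \<bar>tau r\<bar> x" "max \<bar>tau r\<bar> (x + 1 / real (Suc n)) - max \<bar>tau r\<bar> x \<le> 1 / real (Suc n)"
        using divide_pos_pos[of 1 "real (Suc n)"] by linarith+
      then show "norm (f n r) \<le> 1"
        unfolding f_def real_norm_def by (rule scale)
    qed
  qed (auto simp: f_def)
  moreover have "(\<integral>r. f n r \<partial>\<mu>) = real (Suc n) * (mag \<mu> (x + 1 / real (Suc n)) - mag \<mu> x)" for n
    unfolding f_def mag_def using mag_integrable[OF \<mu>] by simp
  moreover have "(\<integral>r. indicator {..x} \<bar>tau r\<bar> \<partial>\<mu>) = cdf (abs_law \<mu>) x"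
    using integral_abs_law[OF \<mu>, of "indicator {..x}"] by (simp add: cdf_def abs_law_def)
  ultimately show ?thesis by simp
qed

lemma mag_nonpos: "a \<le> 0 \<Longrightarrow> mag \<mu> a = mag \<mu> 0"
  unfolding mag_def by (intro Bochner_Integration.integral_cong refl) auto

lemma mag_inject:
  assumes \<mu>: "symmetric_distribution \<mu>" and \<nu>: "symmetric_distribution \<nu>"
    and eq: "\<And>a. 0 \<le> a \<Longrightarrow> a \<le> 1 \<Longrightarrow> mag \<mu> a = mag \<nu> a"
  shows "\<mu> = \<nu>"
proof (rule symmetric_eqI[OF \<mu> \<nu>], rule cdf_unique)
  \<comment> \<open>Outside [0, 1] the values are forced: constant to the left, the identity to the
    right.\<close>
  have eq': "mag \<mu> a = mag \<nu> a" for a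
    using eq[of a] mag_nonpos[of a \<mu>] mag_nonpos[of a \<nu>] eq[of 0] mag_bounds(3)[OF \<mu>, of a] mag_bounds(3)[OF \<nu>, of a]
    by (metis linear zero_le_one order_refl)
  show "cdf (abs_law \<mu>) = cdf (abs_law \<nu>)"
    by (rule ext, rule LIMSEQ_unique[OF cdf_abs_law_limit[OF \<mu>]])
       (use cdf_abs_law_limit[OF \<nu>] in \<open>simp add: eq'\<close>)
qed (rule real_distribution_abs_law \<mu> \<nu>)+

lemma deg_antisym:
  assumes "symmetric_distribution \<mu>" "symmetric_distribution \<nu>" "\<mu> \<preceq> \<nu>" "\<nu> \<preceq> \<mu>"
  shows "\<mu> = \<nu>"
  by (rule mag_inject[OF assms(1,2)]) (use degD[OF assms(3)] degD[OF assms(4)] in \<open>auto intro: antisym\<close>)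

text \<open>The inverse of \<open>abs_law\<close>: given the absolute value \<open>x\<close>, the sign is positive with
  probability \<open>(1 + x) / 2\<close>, written as a density with respect to a fair coin.\<close>

definition lift_law :: "real measure \<Rightarrow> ereal measure" where
  "lift_law M = distr
     (density (M \<Otimes>\<^sub>M measure_pmf (bernoulli_pmf (1 / 2)))
       (\<lambda>(x, b). ennreal (1 + (if b then clamp01 x else - clamp01 x))))
     borel (\<lambda>(x, b). if b then rho (clamp01 x) else - rho (clamp01 x))"

lemma
  assumes M: "prob_space M" "sets M = sets borel"
  shows prob_space_lift_law: "prob_space (lift_law M)"
    and integral_lift_law: "h \<in> borel_measurable borel \<Longrightarrow> (\<And>r. \<bar>h r\<bar> \<le> B) \<Longrightarrow>
      (\<integral>r. h r \<partial>lift_law M) = (\<integral>x. mixed h (clamp01 x) \<partial>M)"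
proof -
  let ?b = "measure_pmf (bernoulli_pmf (1 / 2))"
  interpret M: prob_space M by fact
  interpret pair_prob_space M ?b ..
  note [measurable_cong] = M(2)
  define d where "d p = (case p of (x, b) \<Rightarrow> 1 + (if b then clamp01 x else - clamp01 x))" for p
  define g where "g p = (case p of (x, b) \<Rightarrow> if b then rho (clamp01 x) else - rho (clamp01 x))" for p
  have [measurable]: "d \<in> borel_measurable (M \<Otimes>\<^sub>M ?b)" "g \<in> borel_measurable (M \<Otimes>\<^sub>M ?b)"
    unfolding d_def g_def by measurable
  have d0: "0 \<le> d p" "d p \<le> 2" for p using clamp01[of "fst p"] by (auto simp: d_def split: prod.splits)
  have L: "lift_law M = distr (density (M \<Otimes>\<^sub>M ?b) (\<lambda>p. ennreal (d p))) borel g"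
    unfolding lift_law_def d_def g_def by (simp add: split_beta')
  have int: "(\<integral>r. h r \<partial>lift_law M) = (\<integral>x. mixed h (clamp01 x) \<partial>M)"
    if [measurable]: "h \<in> borel_measurable borel" and B: "\<And>r. \<bar>h r\<bar> \<le> B" for h B
  proof -
    have "(\<integral>r. h r \<partial>lift_law M) = (\<integral>p. h (g p) \<partial>density (M \<Otimes>\<^sub>M ?b) (\<lambda>p. ennreal (d p)))"
      unfolding L by (rule integral_distr) auto
    also have "\<dots> = (\<integral>p. d p *\<^sub>R h (g p) \<partial>(M \<Otimes>\<^sub>M ?b))"
      by (rule integral_density) (auto simp: d0)
    also have "\<dots> = (\<integral>x. \<integral>b. d (x, b) *\<^sub>R h (g (x, b)) \<partial>?b \<partial>M)"
    proof (rule integral_fst'[symmetric], rule P.integrable_bounded[where B="2 * B"])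
      show "\<bar>d p *\<^sub>R h (g p)\<bar> \<le> 2 * B" for p
        using d0[of p] B[of "g p"] by (simp add: abs_mult mult_mono)
    qed measurable
    also have "\<dots> = (\<integral>x. mixed h (clamp01 x) \<partial>M)"
      by (intro Bochner_Integration.integral_cong refl) (simp add: d_def g_def mixed_def field_simps)
    finally show ?thesis .
  qed
  then show "h \<in> borel_measurable borel \<Longrightarrow> (\<And>r. \<bar>h r\<bar> \<le> B) \<Longrightarrow>
      (\<integral>r. h r \<partial>lift_law M) = (\<integral>x. mixed h (clamp01 x) \<partial>M)" .
  have "emeasure (lift_law M) (space (lift_law M)) = (\<integral>\<^sup>+p. ennreal (d p) \<partial>(M \<Otimes>\<^sub>M ?b))"
    unfolding L by (subst emeasure_distr) (auto simp: emeasure_density cong: nn_integral_cong)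
  also have "\<dots> = ennreal (\<integral>p. d p \<partial>(M \<Otimes>\<^sub>M ?b))"
    by (intro nn_integral_eq_integral P.integrable_bounded[where B=2]) (auto simp: d0)
  also have "(\<integral>p. d p \<partial>(M \<Otimes>\<^sub>M ?b)) = (\<integral>x. \<integral>b. d (x, b) \<partial>?b \<partial>M)"
    by (rule integral_fst'[symmetric], rule P.integrable_bounded[where B=2]) (auto simp: d0)
  also have "\<dots> = (\<integral>x. 1 \<partial>M)"
    by (intro Bochner_Integration.integral_cong refl) (simp add: d_def field_simps)
  finally show "prob_space (lift_law M)" by (intro prob_spaceI) (simp add: M.prob_space)
qed

lemma sets_lift_law [simp]: "sets (lift_law M) = sets borel"
  by (simp add: lift_law_def)

lemma symmetric_lift_law:
  assumes M: "prob_space M" "sets M = sets borel"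
  shows "symmetric_distribution (lift_law M)"
proof (rule symmetric_distributionI)
  interpret prob_space "lift_law M" by (rule prob_space_lift_law[OF M])
  have [measurable_cong]: "sets (lift_law M) = sets borel" by simp
  show "prob_space (lift_law M)" by (rule prob_space_lift_law[OF M])
  have "measure (lift_law M) {-\<infinity>} = (\<integral>r. indicator {-\<infinity>} r \<partial>lift_law M)" by simp
  also have "\<dots> = (\<integral>x. mixed (indicator {-\<infinity>}) (clamp01 x) \<partial>M)"
    by (rule integral_lift_law[OF M, where B=1]) auto
  also have "\<dots> = (\<integral>x. 0 \<partial>M)"
  proof (intro Bochner_Integration.integral_cong refl)
    fix x
    have "rho (clamp01 x) \<noteq> -\<infinity>" using clamp01[of x] by (simp add: rho_def)
    \<comment> \<open>The value -\<infinity> arises only as - rho 1, where the weight (1 - x) / 2 is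
      0.\<close>
    moreover have "clamp01 x = 1 \<or> - rho (clamp01 x) \<noteq> -\<infinity>"
      using clamp01[of x] by (cases "1 \<le> clamp01 x") (simp_all add: rho_def)
    ultimately show "mixed (indicator {-\<infinity>}) (clamp01 x) = 0" by (auto simp: mixed_def indicator_def)
  qed
  finally have "emeasure (lift_law M) {-\<infinity>} = 0" by (simp add: emeasure_eq_measure)
  then show "AE r in lift_law M. r \<noteq> -\<infinity>"
    by (intro AE_I[where N="{-\<infinity>}"]) auto
  fix A :: "ereal set" assume [measurable]: "A \<in> sets borel"
  have "mixed (\<lambda>r. (1 - tau r) * indicator A r) (clamp01 x) = mixed (\<lambda>r. (1 - tau r) * indicator A (- r)) (clamp01 x)" for x
    using clamp01[of x] by (simp add: mixed_def tau_rho field_simps)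
  then show "(\<integral>r. (1 - tau r) * indicator A r \<partial>lift_law M) = (\<integral>r. (1 - tau r) * indicator A (- r) \<partial>lift_law M)"
    by (subst (1 2) integral_lift_law[OF M _ one_minus_tau_indicator_le_2]) auto
qed simp

lemma abs_law_lift_law:
  assumes M: "real_distribution M" and "AE x in M. 0 \<le> x \<and> x \<le> 1"
  shows "abs_law (lift_law M) = M"
proof (rule measure_eqI)
  interpret M: real_distribution M by fact
  have M': "prob_space M" "sets M = sets borel" by (auto intro: M.prob_space_axioms)
  note s = symmetric_lift_law[OF M']
  interpret A: real_distribution "abs_law (lift_law M)" by (rule real_distribution_abs_law[OF s])
  show "sets (abs_law (lift_law M)) = sets M" by simp
  fix E assume "E \<in> sets (abs_law (lift_law M))"
  then have [measurable]: "E \<in> sets borel" by simp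
  have "measure (abs_law (lift_law M)) E = (\<integral>x. indicator E x \<partial>abs_law (lift_law M))" by simp
  also have "\<dots> = (\<integral>r. indicator E \<bar>tau r\<bar> \<partial>lift_law M)"
    by (rule integral_abs_law[OF s]) auto
  also have "\<dots> = (\<integral>x. mixed (\<lambda>r. indicator E \<bar>tau r\<bar>) (clamp01 x) \<partial>M)"
    by (rule integral_lift_law[OF M', where B=1]) (auto simp: indicator_def)
  also have "\<dots> = (\<integral>x. indicator E x \<partial>M)"
  proof (rule integral_cong_AE)
    show "AE x in M. mixed (\<lambda>r. indicator E \<bar>tau r\<bar>) (clamp01 x) = indicator E x"
      using assms(2) by eventually_elim (simp add: clamp01 mixed_def tau_rho field_simps)
  qed auto
  also have "\<dots> = measure M E" by simp
  finally show "emeasure (abs_law (lift_law M)) E = emeasure M E"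
    by (simp add: A.emeasure_eq_measure M.emeasure_eq_measure)
qed

lemma tight_abs_law:
  assumes "\<And>n. symmetric_distribution (L n)"
  shows "tight (\<lambda>n. abs_law (L n))"
  unfolding tight_def
proof (intro conjI allI impI)
  show "real_distribution (abs_law (L n))" for n by (rule real_distribution_abs_law[OF assms])
  fix \<epsilon> :: real assume "0 < \<epsilon>"
  have "1 - \<epsilon> < measure (abs_law (L n)) {-1<..1}" for n
  proof -
    interpret prob_space "L n" using symmetric_distributionD[OF assms] by simp
    note [measurable_cong] = symmetric_distributionD(2)[OF assms, of n]
    have "measure (abs_law (L n)) {-1<..1} = measure (L n) ((\<lambda>r. \<bar>tau r\<bar>) -` {-1<..1} \<inter> space (L n))"
      unfolding abs_law_def by (rule measure_distr) auto
    also have "(\<lambda>r. \<bar>tau r\<bar>) -` {-1<..1} = UNIV"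
      using abs_tau_le_1 by (auto intro: less_le_trans[of _ 0])
    finally show ?thesis using \<open>0 < \<epsilon>\<close> by (simp add: prob_space)
  qed
  then show "\<exists>a b. a < b \<and> (\<forall>n. 1 - \<epsilon> < measure (abs_law (L n)) {a<..b})"
    by (intro exI[of _ "-1"] exI[of _ 1]) auto
qed

lemma weak_limit_abs_law:
  assumes L: "\<And>n. symmetric_distribution (L n)" and M: "real_distribution M"
    and w: "weak_conv_m (\<lambda>n. abs_law (L n)) M"
  obtains K where "symmetric_distribution K" "abs_law K = M" "\<And>a. (\<lambda>n. mag (L n) a) \<longlonglongrightarrow> mag K a"
proof -
  interpret M: real_distribution M by fact
  have M': "prob_space M" "sets M = sets borel" by (auto intro: M.prob_space_axioms)
  have conv: "(\<lambda>n. \<integral>r. f \<bar>tau r\<bar> \<partial>L n) \<longlonglongrightarrow> (\<integral>x. f x \<partial>M)"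
    if c: "continuous_on UNIV f" and b: "\<And>x. \<bar>f x\<bar> \<le> B" for f :: "real \<Rightarrow> real" and B
  proof -
    have [measurable]: "f \<in> borel_measurable borel" by (rule borel_measurable_continuous_onI[OF c])
    have "(\<lambda>n. \<integral>x. f x \<partial>abs_law (L n)) \<longlonglongrightarrow> (\<integral>x. f x \<partial>M)"
      using c b by (intro weak_conv_imp_integral_bdd_continuous_conv[OF real_distribution_abs_law[OF L] M w])
        (auto simp: continuous_on_eq_continuous_at)
    then show ?thesis by (simp add: integral_abs_law[OF L])
  qed
  \<comment> \<open>A bounded continuous function that vanishes exactly on [0, 1]. Its mean passes
    to the limit, so M is concentrated on [0, 1] and can be lifted to a symmetric law.\<close>
  define g where "g x = min 1 (max 0 (max (- x) (x - 1)))" for x :: real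
  have "(\<lambda>n. \<integral>r. g \<bar>tau r\<bar> \<partial>L n) \<longlonglongrightarrow> (\<integral>x. g x \<partial>M)"
    by (rule conv[of _ 1]) (auto simp: g_def intro!: continuous_intros)
  moreover have "g \<bar>tau r\<bar> = 0" for r using abs_tau_le_1[of r] by (simp add: g_def)
  ultimately have "(\<integral>x. g x \<partial>M) = 0" by (simp add: LIMSEQ_const_iff)
  moreover have [measurable]: "g \<in> borel_measurable borel" unfolding g_def by measurable
  moreover have g0: "0 \<le> g x" "\<bar>g x\<bar> \<le> 1" for x by (auto simp: g_def)
  moreover have "integrable M g" by (rule M.integrable_bounded[OF _ g0(2)]) simp
  ultimately have "AE x in M. g x = 0"
    by (subst (asm) integral_nonneg_eq_0_iff_AE) auto
  then have ae: "AE x in M. 0 \<le> x \<and> x \<le> 1"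
    by eventually_elim (auto simp: g_def min_def max_def split: if_splits)
  let ?K = "lift_law M"
  have s: "symmetric_distribution ?K" by (rule symmetric_lift_law[OF M'])
  have a: "abs_law ?K = M" by (rule abs_law_lift_law[OF M ae])
  have "(\<lambda>n. mag (L n) a) \<longlonglongrightarrow> mag ?K a" for a
  proof -
    \<comment> \<open>Clamping makes the test function bounded without changing it at values of
      |tau|.\<close>
    define f where "f x = max (clamp01 x) a" for x
    have f: "f \<bar>tau r\<bar> = max \<bar>tau r\<bar> a" for r using abs_tau_le_1[of r] by (simp add: f_def clamp01)
    have c: "continuous_on UNIV f" unfolding f_def by (intro continuous_intros continuous_clamp01)
    have [measurable]: "f \<in> borel_measurable borel" by (rule borel_measurable_continuous_onI[OF c])
    have "(\<lambda>n. \<integral>r. f \<bar>tau r\<bar> \<partial>L n) \<longlonglongrightarrow> (\<integral>x. f x \<partial>M)"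
    proof (rule conv[OF c, of "1 + \<bar>a\<bar>"])
      show "\<bar>f x\<bar> \<le> 1 + \<bar>a\<bar>" for x using clamp01[of x] by (simp add: f_def) linarith
    qed
    also have "(\<integral>x. f x \<partial>M) = (\<integral>r. f \<bar>tau r\<bar> \<partial>?K)"
      by (subst a[symmetric], rule integral_abs_law[OF s]) simp
    finally show ?thesis by (simp add: f mag_def)
  qed
  with s a that show thesis by blast
qed

text \<open>One weakly convergent subsequence is enough: the limit g exists along the whole
  sequence, so it must be \<open>mag\<close> of the subsequential limit.\<close>

lemma mag_limit_exists:
  assumes L: "\<And>n. symmetric_distribution (L n)" and g: "\<And>a. 0 \<le> a \<Longrightarrow> a \<le> 1 \<Longrightarrow> (\<lambda>n. mag (L n) a) \<longlonglongrightarrow> g a"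
  obtains K where "symmetric_distribution K" "\<And>a. 0 \<le> a \<Longrightarrow> a \<le> 1 \<Longrightarrow> (\<lambda>n. mag (L n) a) \<longlonglongrightarrow> mag K a"
proof -
  obtain r M where r: "strict_mono (r :: nat \<Rightarrow> nat)" "real_distribution M" "weak_conv_m ((\<lambda>n. abs_law (L n)) \<circ> id \<circ> r) M"
    using tight_imp_convergent_subsubsequence[OF tight_abs_law[of L, OF L] strict_mono_id] by auto
  then obtain K where K: "symmetric_distribution K" "\<And>a. (\<lambda>n. mag (L (r n)) a) \<longlonglongrightarrow> mag K a"
    using weak_limit_abs_law[of "\<lambda>n. L (r n)" M] L by (auto simp: comp_def)
  have "mag K a = g a" if "0 \<le> a" "a \<le> 1" for a
    using LIMSEQ_unique[OF K(2) LIMSEQ_subseq_LIMSEQ[OF g[OF that] r(1), unfolded comp_def]] .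
  with g K(1) that show thesis by simp
qed

text \<open>Near -\<infinity> the function f may oscillate, but f (- rho x) carries the weight (1 -
  x) / 2, which tends to 0 as x tends to 1. So continuity on (-\<infinity>, \<infinity>] is
  enough.\<close>

lemma continuous_mixed:
  fixes f :: "ereal \<Rightarrow> real"
  assumes c: "continuous_on {-\<infinity><..} f" and b: "\<And>r. r \<noteq> -\<infinity> \<Longrightarrow> \<bar>f r\<bar> \<le> B"
    and f0: "f (-\<infinity>) = 0"
  shows "continuous_on {0..1} (mixed f)"
proof -
  have B: "\<bar>f r\<bar> \<le> B" for r
    using b[of r] b[of 0] f0 by (cases "r = -\<infinity>") auto
  have half: "continuous_on A (\<lambda>x. (1 - x) / 2)" "continuous_on A (\<lambda>x. (1 + x) / 2)" for A :: "real set"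
    by (intro continuous_on_divide continuous_on_add continuous_on_diff continuous_on_const continuous_on_id; simp)+
  have 1: "continuous_on {0..1} (\<lambda>x. f (rho x))"
    by (rule continuous_on_compose2[OF c continuous_on_rho]) (auto simp: rho_def)
  have un: "continuous_on {0..<1} (\<lambda>x. rho (- x))"
    by (rule continuous_on_compose2[OF continuous_on_rho]) (auto intro!: continuous_intros)
  have 2: "continuous_on {0..<1} (\<lambda>x. f (rho (- x)))"
    by (rule continuous_on_compose2[OF c un]) (auto simp: rho_def)
  have 3: "continuous_on {0..1} (\<lambda>x. (1 - x) / 2 * f (rho (- x)))"
    unfolding continuous_on_eq_continuous_within
  proof
    fix x :: real assume x: "x \<in> {0..1}"
    show "continuous (at x within {0..1}) (\<lambda>x. (1 - x) / 2 * f (rho (- x)))"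
    proof (cases "x = 1")
      case True
      have "((\<lambda>x. (1 - x) / 2 * f (rho (- x))) \<longlongrightarrow> 0) (at x within {0..1})"
      proof (rule Lim_null_comparison)
        show "\<forall>\<^sub>F x in at x within {0..1}. norm ((1 - x) / 2 * f (rho (- x))) \<le> \<bar>1 - x\<bar> / 2 * B"
          using B by (intro always_eventually allI) (simp add: abs_mult mult_left_mono)
        have "((\<lambda>x. \<bar>1 - x\<bar> / 2 * B) \<longlongrightarrow> \<bar>1 - x\<bar> / 2 * B) (at x within {0..1})"
          by (intro tendsto_intros) simp
        then show "((\<lambda>x. \<bar>1 - x\<bar> / 2 * B) \<longlongrightarrow> 0) (at x within {0..1})" using True by simp
      qed
      then show ?thesis using True by (simp add: continuous_within)
    next
      case False
      then have x': "x \<in> {0..<1}" using x by auto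
      have "continuous (at x within {0..<1}) (\<lambda>x. (1 - x) / 2 * f (rho (- x)))"
        using continuous_on_mult[OF half(1) 2] x' by (simp add: continuous_on_eq_continuous_within)
      moreover have "at x within {0..1} = at x within {0..<1}"
        using x' by (intro at_within_nhd[where S="{..<1}"]) auto
      ultimately show ?thesis by simp
    qed
  qed
  have "mixed f = (\<lambda>x. (1 + x) / 2 * f (rho x) + (1 - x) / 2 * f (rho (- x)))"
    by (simp add: mixed_def fun_eq_iff rho_uminus)
  moreover have "continuous_on {0..1} (\<lambda>x. (1 + x) / 2 * f (rho x))"
    by (rule continuous_on_mult[OF half(2) 1])
  ultimately show ?thesis by (simp only:) (intro continuous_on_add 3)
qed

text \<open>Every weak subsequential limit of the laws of |tau| has the \<open>mag\<close> of K,
  hence is the law for K. Test functions on (-\<infinity>, \<infinity>] are carried to [0, 1] by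
  \<open>mixed\<close>.\<close>

lemma weakly_convergesI:
  assumes L: "\<And>n. symmetric_distribution (L n)" and K: "symmetric_distribution K"
    and conv: "\<And>a. 0 \<le> a \<Longrightarrow> a \<le> 1 \<Longrightarrow> (\<lambda>n. mag (L n) a) \<longlonglongrightarrow> mag K a"
  shows "weakly_converges L K"
proof -
  have w: "weak_conv_m (\<lambda>n. abs_law (L n)) (abs_law K)"
  proof (rule tight_subseq_weak_converge[OF real_distribution_abs_law[OF L] real_distribution_abs_law[OF K] tight_abs_law[OF L]])
    fix s :: "nat \<Rightarrow> nat" and M
    assume s: "strict_mono s" and M: "real_distribution M" and w: "weak_conv_m ((\<lambda>n. abs_law (L n)) \<circ> s) M"
    then obtain K' where K': "symmetric_distribution K'" "abs_law K' = M" "\<And>a. (\<lambda>n. mag (L (s n)) a) \<longlonglongrightarrow> mag K' a"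
      using weak_limit_abs_law[of "\<lambda>n. L (s n)" M] L by (auto simp: comp_def)
    have "K' = K"
      by (rule mag_inject[OF K'(1) K])
         (rule LIMSEQ_unique[OF K'(3) LIMSEQ_subseq_LIMSEQ[OF conv s, unfolded comp_def]])
    with K'(2) w show "weak_conv_m ((\<lambda>n. abs_law (L n)) \<circ> s) (abs_law K)" by simp
  qed
  show ?thesis
    unfolding weakly_converges_def
  proof (intro allI impI, elim conjE)
    fix f :: "ereal \<Rightarrow> real"
    assume c: "continuous_on {-\<infinity><..} f" and b: "bounded (f ` {-\<infinity><..})"
    obtain B where B: "\<And>r. r \<noteq> -\<infinity> \<Longrightarrow> \<bar>f r\<bar> \<le> B"
      using b unfolding bounded_iff by (auto simp: less_le)
    \<comment> \<open>The value of f at -\<infinity> is arbitrary; setting it to 0 gives a bounded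
      measurable function with the same integrals over the half line.\<close>
    define f' where "f' r = indicator {-\<infinity><..} r *\<^sub>R f r" for r
    have m [measurable]: "f' \<in> borel_measurable borel"
      unfolding f'_def by (rule borel_measurable_continuous_on_indicator[OF _ c]) simp
    have f': "f' r = f r" if "r \<noteq> -\<infinity>" for r using that by (simp add: f'_def indicator_def less_le)
    have f'0: "f' (-\<infinity>) = 0" by (simp add: f'_def)
    have B': "\<bar>f' r\<bar> \<le> B" for r
      using B[of 0] B[of r] f'[of r] f'0 by (cases "r = -\<infinity>") auto
    have c': "continuous_on {-\<infinity><..} f'"
      using c by (rule continuous_on_eq) (auto simp: f')
    define h where "h x = mixed f' (clamp01 x)" for x
    have ch: "continuous_on UNIV h"
      unfolding h_def
      by (rule continuous_on_compose2[OF continuous_mixed[OF c' _ f'0] continuous_clamp01]) (use B' clamp01 in auto)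
    have hB: "\<bar>h x\<bar> \<le> B" for x unfolding h_def by (rule mixed_bound[OF B' clamp01(1,2)])
    have [measurable]: "h \<in> borel_measurable borel" by (rule borel_measurable_continuous_onI[OF ch])
    have eq: "(LINT r:{-\<infinity><..}|N. f r) = (\<integral>x. h x \<partial>abs_law N)" if N: "symmetric_distribution N" for N
    proof -
      have "(LINT r:{-\<infinity><..}|N. f r) = (\<integral>r. f' r \<partial>N)"
        by (simp add: set_lebesgue_integral_def f'_def)
      also have "\<dots> = (\<integral>x. mixed f' x \<partial>abs_law N)" by (rule integral_eq_mixed[OF N m B'])
      also have "\<dots> = (\<integral>r. mixed f' \<bar>tau r\<bar> \<partial>N)" by (rule integral_abs_law[OF N]) simp
      also have "\<dots> = (\<integral>r. h \<bar>tau r\<bar> \<partial>N)" by (simp add: h_def clamp01 abs_tau_le_1)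
      also have "\<dots> = (\<integral>x. h x \<partial>abs_law N)" by (rule integral_abs_law[OF N, symmetric]) simp
      finally show ?thesis .
    qed
    show "(\<lambda>n. LINT r:{-\<infinity><..}|L n. f r) \<longlonglongrightarrow> (LINT r:{-\<infinity><..}|K. f r)"
      unfolding eq[OF L] eq[OF K]
      using ch hB by (intro weak_conv_imp_integral_bdd_continuous_conv[OF real_distribution_abs_law[OF L] real_distribution_abs_law[OF K] w])
        (auto simp: continuous_on_eq_continuous_at)
  qed
qed

section \<open>Continuity of the BP operator and supports\<close>

lemma symmetric_trivial: "symmetric_distribution trivial_distribution"
  unfolding trivial_distribution_def
proof (rule symmetric_distributionI)
  show "prob_space (return borel (0::ereal))" by (rule prob_space_return) simp
  show "AE r in return borel 0. r \<noteq> - (\<infinity>::ereal)"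
    by (subst AE_return) auto
  fix A :: "ereal set" assume [measurable]: "A \<in> sets borel"
  show "(\<integral>r. (1 - tau r) * indicator A r \<partial>return borel 0) = (\<integral>r. (1 - tau r) * indicator A (- r) \<partial>return borel 0)"
    by (subst (1 2) integral_return) auto
qed simp

lemma mag_trivial: "0 \<le> a \<Longrightarrow> mag trivial_distribution a = a"
  unfolding mag_def trivial_distribution_def by (subst integral_return) auto

lemma mag_top: "mag (return borel \<infinity>) a = max 1 a"
  unfolding mag_def by (subst integral_return) auto

lemma deg_top: "symmetric_distribution \<mu> \<Longrightarrow> \<mu> \<preceq> return borel \<infinity>"
  unfolding deg_def using mag_bounds(2)[of \<mu>] by (auto simp: mag_top)

text \<open>If the mean of |tau| is 0, the Lipschitz bound leaves only
  \<open>mag \<mu> a = a\<close>, which is the function of the point mass at 0.\<close>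

lemma mag_0_pos:
  assumes \<mu>: "symmetric_distribution \<mu>" and "\<mu> \<noteq> trivial_distribution"
  shows "0 < mag \<mu> 0"
proof (rule ccontr)
  assume "\<not> 0 < mag \<mu> 0"
  then have 0: "mag \<mu> 0 = 0" using mag_bounds(4)[OF \<mu>, of 0] by simp
  have "mag \<mu> a = mag trivial_distribution a" if "0 \<le> a" for a
    using mag_lipschitz[OF \<mu>, of a 0] mag_bounds(1)[OF \<mu>, of a] that by (simp add: mag_trivial 0)
  then have "\<mu> = trivial_distribution"
    by (intro mag_inject \<mu> symmetric_trivial)
  with assms(2) show False by simp
qed

text \<open>The average in \<open>mag_iconv\<close> is over the same law for \<mu> and \<mu>', so it
  does not increase the uniform distance.\<close>

lemma mag_iconv_close:
  assumes \<mu>: "symmetric_distribution \<mu>" "symmetric_distribution \<mu>'" and \<nu>: "symmetric_distribution \<nu>"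
    and c: "\<And>c. 0 \<le> c \<Longrightarrow> c \<le> 1 \<Longrightarrow> \<bar>mag \<mu> c - mag \<mu>' c\<bar> \<le> \<epsilon>" and a: "0 \<le> a" "a \<le> 1"
  shows "\<bar>mag (\<mu> \<star>\<star> \<nu>) a - mag (\<mu>' \<star>\<star> \<nu>) a\<bar> \<le> \<epsilon>"
proof -
  have k: "symmetric_distribution (\<nu> \<star>\<star> bsc a)" by (intro symmetric_iconv \<nu> symmetric_bsc a)
  note i = mag_tau_integrable[OF \<mu>(1) k] mag_tau_integrable[OF \<mu>(2) k]
  note [measurable] = measurable_mag[OF \<mu>(1)] measurable_mag[OF \<mu>(2)]
  have "mag (\<mu> \<star>\<star> \<nu>) a - mag (\<mu>' \<star>\<star> \<nu>) a = (\<integral>r. mag \<mu> \<bar>tau r\<bar> - mag \<mu>' \<bar>tau r\<bar> \<partial>(\<nu> \<star>\<star> bsc a))"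
    unfolding mag_iconv[OF \<mu>(1) \<nu> a] mag_iconv[OF \<mu>(2) \<nu> a] using i by simp
  also have "\<bar>\<dots>\<bar> \<le> \<epsilon>"
    by (rule symmetric_integral_bound[OF k]) (measurable, intro c, simp_all add: abs_tau_le_1)
  finally show ?thesis .
qed

text \<open>One factor is exchanged at a time, each at cost \<epsilon>; commutativity brings the
  remaining power into the left place.\<close>

lemma mag_iconv_pow_close:
  assumes \<mu>: "symmetric_distribution \<mu>" "symmetric_distribution \<mu>'" and \<nu>: "symmetric_distribution \<nu>"
    and c: "\<And>c. 0 \<le> c \<Longrightarrow> c \<le> 1 \<Longrightarrow> \<bar>mag \<mu> c - mag \<mu>' c\<bar> \<le> \<epsilon>"
  shows "0 \<le> a \<Longrightarrow> a \<le> 1 \<Longrightarrow> \<bar>mag (iconv_pow \<mu> n \<nu>) a - mag (iconv_pow \<mu>' n \<nu>) a\<bar> \<le> real n * \<epsilon>"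
proof (induction n arbitrary: a)
  case (Suc n)
  note m = symmetric_distributionD(1,2)
  let ?p = "iconv_pow \<mu> n \<nu>" and ?p' = "iconv_pow \<mu>' n \<nu>"
  have p: "symmetric_distribution ?p" "symmetric_distribution ?p'"
    by (intro symmetric_iconv_pow \<mu> \<nu>)+
  have "\<bar>mag (\<mu> \<star>\<star> ?p) a - mag (\<mu>' \<star>\<star> ?p) a\<bar> \<le> \<epsilon>"
    by (rule mag_iconv_close[OF \<mu> p(1) c Suc.prems])
  moreover have "\<bar>mag (?p \<star>\<star> \<mu>') a - mag (?p' \<star>\<star> \<mu>') a\<bar> \<le> real n * \<epsilon>"
    by (rule mag_iconv_close[OF p \<mu>(2) Suc.IH Suc.prems])
  moreover have "?p \<star>\<star> \<mu>' = \<mu>' \<star>\<star> ?p" "?p' \<star>\<star> \<mu>' = \<mu>' \<star>\<star> ?p'"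
    by (intro iconv_commute m \<mu> p)+
  ultimately have "\<bar>mag (\<mu> \<star>\<star> ?p) a - mag (\<mu>' \<star>\<star> ?p') a\<bar> \<le> \<epsilon> + real n * \<epsilon>"
    by simp
  then show ?case by (simp add: algebra_simps)
qed simp

lemma mag_noise_close:
  assumes \<mu>: "symmetric_distribution \<mu>" "symmetric_distribution \<mu>'" and e: "0 \<le> e" "e \<le> 1"
    and c: "\<And>c. 0 \<le> c \<Longrightarrow> c \<le> 1 \<Longrightarrow> \<bar>mag \<mu> c - mag \<mu>' c\<bar> \<le> \<epsilon>" and a: "0 \<le> a" "a \<le> 1"
  shows "\<bar>mag (noise e \<mu>) a - mag (noise e \<mu>') a\<bar> \<le> \<epsilon>"
proof -
  have "0 \<le> \<epsilon>" using c[of 0] by simp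
  have c': "\<bar>mag \<mu> b - mag \<mu>' b\<bar> \<le> \<epsilon>" if "0 \<le> b" for b
    using c[OF that] mag_bounds(3)[OF \<mu>(1), of b] mag_bounds(3)[OF \<mu>(2), of b] \<open>0 \<le> \<epsilon>\<close> by (cases "b \<le> 1") auto
  have t: "\<bar>1 - 2 * e\<bar> \<le> 1" using e by auto
  show ?thesis
  proof (cases "e = 1 / 2")
    case True
    then show ?thesis using \<open>0 \<le> \<epsilon>\<close> by (simp add: mag_noise[OF \<mu>(1) e a(1)] mag_noise[OF \<mu>(2) e a(1)])
  next
    case False
    let ?b = "a / \<bar>1 - 2 * e\<bar>"
    have "\<bar>mag (noise e \<mu>) a - mag (noise e \<mu>') a\<bar> = \<bar>1 - 2 * e\<bar> * \<bar>mag \<mu> ?b - mag \<mu>' ?b\<bar>"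
      using False by (simp add: mag_noise[OF \<mu>(1) e a(1)] mag_noise[OF \<mu>(2) e a(1)] abs_mult flip: right_diff_distrib)
    also have "\<dots> \<le> 1 * \<epsilon>" using t c'[of ?b] a by (intro mult_mono) auto
    finally show ?thesis by simp
  qed
qed

text \<open>Convergence on a finite grid of mesh below \<epsilon> / 3 extends to all of [0, 1] by
  the common Lipschitz constant 1.\<close>

lemma mag_uniform:
  assumes L: "\<And>n. symmetric_distribution (L n)" and K: "symmetric_distribution K"
    and conv: "\<And>a. 0 \<le> a \<Longrightarrow> a \<le> 1 \<Longrightarrow> (\<lambda>n. mag (L n) a) \<longlonglongrightarrow> mag K a" and \<epsilon>: "0 < \<epsilon>"
  shows "\<forall>\<^sub>F n in sequentially. \<forall>a. 0 \<le> a \<longrightarrow> a \<le> 1 \<longrightarrow> \<bar>mag (L n) a - mag K a\<bar> \<le> \<epsilon>"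
proof -
  obtain N where N: "0 < N" "1 / real N < \<epsilon> / 3"
    using real_arch_inverse[of "\<epsilon> / 3"] \<epsilon> by (auto simp: inverse_eq_divide)
  have "\<forall>\<^sub>F n in sequentially. \<forall>i\<in>{..N}. \<bar>mag (L n) (real i / real N) - mag K (real i / real N)\<bar> < \<epsilon> / 3"
  proof (subst eventually_ball_finite_distrib, simp, intro ballI)
    fix i assume "i \<in> {..N}"
    then have "(\<lambda>n. mag (L n) (real i / real N)) \<longlonglongrightarrow> mag K (real i / real N)"
      using N by (intro conv) auto
    from tendstoD[OF this, of "\<epsilon> / 3"] \<epsilon>
    show "\<forall>\<^sub>F n in sequentially. \<bar>mag (L n) (real i / real N) - mag K (real i / real N)\<bar> < \<epsilon> / 3"
      by (simp add: dist_real_def)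
  qed
  then show ?thesis
  proof eventually_elim
    case (elim n)
    show ?case
    proof (intro allI impI)
      fix a :: real assume a: "0 \<le> a" "a \<le> 1"
      define i where "i = nat \<lfloor>a * real N\<rfloor>"
      have i: "real i \<le> a * real N" "a * real N < real i + 1"
        using a by (simp_all add: i_def)
      have "real i \<le> 1 * real N" using i(1) mult_right_mono[OF a(2), of "real N"] by linarith
      then have iN: "i \<in> {..N}" by simp
      have "\<bar>a - real i / real N\<bar> \<le> 1 / real N"
      proof -
        have "a - real i / real N = (a * real N - real i) / real N" using N by (simp add: diff_divide_distrib)
        also have "\<bar>\<dots>\<bar> \<le> 1 / real N"
          unfolding abs_divide using i N by (intro frac_le) auto
        finally show ?thesis .
      qed
      then have d: "\<bar>a - real i / real N\<bar> < \<epsilon> / 3" using N(2) by linarith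
      show "\<bar>mag (L n) a - mag K a\<bar> \<le> \<epsilon>"
        using bspec[OF elim iN] d mag_lipschitz[OF L, of n a "real i / real N"] mag_lipschitz[OF K, of a "real i / real N"]
        by linarith
    qed
  qed
qed

text \<open>The error bound grows with the degree, so the limit is taken for each degree separately
  and passed through the average over P by dominated convergence.\<close>

lemma mag_bp_tendsto:
  assumes L: "\<And>n. symmetric_distribution (L n)" and K: "symmetric_distribution K" and \<nu>: "symmetric_distribution \<nu>"
    and \<delta>: "0 \<le> \<delta>" "\<delta> \<le> 1"
    and conv: "\<And>a. 0 \<le> a \<Longrightarrow> a \<le> 1 \<Longrightarrow> (\<lambda>n. mag (L n) a) \<longlonglongrightarrow> mag K a" and a: "0 \<le> a" "a \<le> 1"
  shows "(\<lambda>n. mag (bp_operator \<delta> P \<nu> (L n)) a) \<longlonglongrightarrow> mag (bp_operator \<delta> P \<nu> K) a"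
  unfolding mag_bp_operator[OF L \<nu>] mag_bp_operator[OF K \<nu>]
proof (rule integral_dominated_convergence[where w="\<lambda>_. 1"])
  note s = symmetric_noise[OF L \<delta>] symmetric_noise[OF K \<delta>]
  show "AE d in measure_pmf P. (\<lambda>n. mag (iconv_pow (noise \<delta> (L n)) d \<nu>) a) \<longlonglongrightarrow> mag (iconv_pow (noise \<delta> K) d \<nu>) a"
  proof (intro AE_I2 tendstoI)
    fix d and \<epsilon> :: real assume "0 < \<epsilon>"
    \<comment> \<open>An error of \<eta> in each of d factors stays below \<epsilon> in total; Suc d
      covers the degree 0.\<close>
    define \<eta> where "\<eta> = \<epsilon> / (2 * real (Suc d))"
    have "0 < \<epsilon> * real d + \<epsilon> * 2" using \<open>0 < \<epsilon>\<close> by (intro add_nonneg_pos) auto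
    then have \<eta>: "0 < \<eta>" "real d * \<eta> < \<epsilon>" using \<open>0 < \<epsilon>\<close> by (simp_all add: \<eta>_def field_simps)
    have U: "\<forall>\<^sub>F n in sequentially. \<forall>a. 0 \<le> a \<longrightarrow> a \<le> 1 \<longrightarrow> \<bar>mag (L n) a - mag K a\<bar> \<le> \<eta>"
      by (rule mag_uniform[OF L K _ \<eta>(1)]) (rule conv)
    then show "\<forall>\<^sub>F n in sequentially. dist (mag (iconv_pow (noise \<delta> (L n)) d \<nu>) a) (mag (iconv_pow (noise \<delta> K) d \<nu>) a) < \<epsilon>"
    proof eventually_elim
      case (elim n)
      have "\<bar>mag (noise \<delta> (L n)) c - mag (noise \<delta> K) c\<bar> \<le> \<eta>" if "0 \<le> c" "c \<le> 1" for c
        by (rule mag_noise_close[OF L K \<delta> _ that]) (use elim in auto)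
      from mag_iconv_pow_close[OF s(1)[of n] s(2) \<nu> this a, where n=d]
      show ?case using \<eta>(2) by (simp add: dist_real_def)
    qed
  qed
  show "AE d in measure_pmf P. norm (mag (iconv_pow (noise \<delta> (L n)) d \<nu>) a) \<le> 1" for n
    using mag_bounds[OF symmetric_iconv_pow[OF s(1)[of n] \<nu>], where a=a] a by (auto intro!: AE_I2)
qed auto

lemma bp_iterate_limit:
  fixes L0 \<delta> P \<nu>
  defines "L \<equiv> \<lambda>h. (bp_operator \<delta> P \<nu> ^^ h) L0"
  assumes L0: "symmetric_distribution L0" and \<nu>: "symmetric_distribution \<nu>" and \<delta>: "0 \<le> \<delta>" "\<delta> \<le> 1"
    and mono: "L0 \<preceq> bp_operator \<delta> P \<nu> L0 \<or> bp_operator \<delta> P \<nu> L0 \<preceq> L0"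
  obtains K where "symmetric_distribution K" "bp_operator \<delta> P \<nu> K = K"
    "\<And>a. 0 \<le> a \<Longrightarrow> a \<le> 1 \<Longrightarrow> (\<lambda>h. mag (L h) a) \<longlonglongrightarrow> mag K a"
    "L0 \<preceq> bp_operator \<delta> P \<nu> L0 \<Longrightarrow> L0 \<preceq> K"
proof -
  let ?Q = "bp_operator \<delta> P \<nu>"
  have s: "symmetric_distribution (L h)" for h
    unfolding L_def using L0 by (induction h) (auto intro: symmetric_bp_operator \<nu> \<delta>)
  have LSuc: "L (Suc h) = ?Q (L h)" for h by (simp add: L_def)
  have inc: "L h \<preceq> L (Suc h)" if "L0 \<preceq> ?Q L0" for h
  proof (induction h)
    case (Suc h)
    then show ?case using deg_bp_operator[OF s s \<nu> \<delta>, of h "Suc h"] by (simp add: LSuc)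
  qed (use that in \<open>simp add: L_def\<close>)
  have dec: "L (Suc h) \<preceq> L h" if "?Q L0 \<preceq> L0" for h
  proof (induction h)
    case (Suc h)
    then show ?case using deg_bp_operator[OF s s \<nu> \<delta>, of "Suc h" h] by (simp add: LSuc)
  qed (use that in \<open>simp add: L_def\<close>)
  have "convergent (\<lambda>h. mag (L h) a)" if a: "0 \<le> a" "a \<le> 1" for a
  proof (rule Bseq_monoseq_convergent)
    show "Bseq (\<lambda>h. mag (L h) a)"
      using mag_bounds[OF s, where a=a] a by (intro BseqI'[of _ 1]) auto
    show "monoseq (\<lambda>h. mag (L h) a)"
      using mono
    proof
      assume "L0 \<preceq> ?Q L0"
      from inc[OF this] show ?thesis
        by (intro incseq_imp_monoseq incseq_SucI degD[OF _ a])
    next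
      assume "?Q L0 \<preceq> L0"
      from dec[OF this] show ?thesis
        by (intro decseq_imp_monoseq decseq_SucI degD[OF _ a])
    qed
  qed
  then obtain K where K: "symmetric_distribution K" "\<And>a. 0 \<le> a \<Longrightarrow> a \<le> 1 \<Longrightarrow> (\<lambda>h. mag (L h) a) \<longlonglongrightarrow> mag K a"
    using mag_limit_exists[of L "\<lambda>a. lim (\<lambda>h. mag (L h) a)"] s by (auto simp: convergent_LIMSEQ_iff)
  have fp: "?Q K = K"
  proof (rule mag_inject[OF symmetric_bp_operator[OF K(1) \<nu> \<delta>] K(1)])
    fix a :: real assume a: "0 \<le> a" "a \<le> 1"
    have "(\<lambda>h. mag (L (Suc h)) a) \<longlonglongrightarrow> mag (?Q K) a"
      unfolding LSuc by (rule mag_bp_tendsto[OF s K(1) \<nu> \<delta> K(2) a])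
    then show "mag (?Q K) a = mag K a"
      using LIMSEQ_unique[OF _ LIMSEQ_Suc[OF K(2)[OF a]]] by blast
  qed
  have "L0 \<preceq> K" if "L0 \<preceq> ?Q L0"
    unfolding deg_def
  proof
    fix a :: real assume "a \<in> {0..1}"
    then have a: "0 \<le> a" "a \<le> 1" by auto
    have "incseq (\<lambda>h. mag (L h) a)" using inc[OF that] by (intro incseq_SucI degD[OF _ a])
    from incseq_le[OF this K(2)[OF a], of 0] show "mag L0 a \<le> mag K a" by (simp add: L_def)
  qed
  with K fp that show thesis by blast
qed

text \<open>Addition of velocities: the value of |tau (r + s)| when r and s have the same
  sign.\<close>

definition vadd :: "real \<Rightarrow> real \<Rightarrow> real" where
  "vadd x y = (x + y) / (1 + x * y)"

lemma vadd_le_iff: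
  assumes "0 \<le> x" "0 \<le> y"
  shows "vadd x y \<le> z \<longleftrightarrow> x + y \<le> z * (1 + x * y)" "z \<le> vadd x y \<longleftrightarrow> z * (1 + x * y) \<le> x + y"
    "vadd x y < z \<longleftrightarrow> x + y < z * (1 + x * y)" "z < vadd x y \<longleftrightarrow> z * (1 + x * y) < x + y"
proof -
  have "0 < 1 + x * y" using assms by (simp add: add_pos_nonneg)
  then show "vadd x y \<le> z \<longleftrightarrow> x + y \<le> z * (1 + x * y)" "z \<le> vadd x y \<longleftrightarrow> z * (1 + x * y) \<le> x + y"
    "vadd x y < z \<longleftrightarrow> x + y < z * (1 + x * y)" "z < vadd x y \<longleftrightarrow> z * (1 + x * y) < x + y"
    by (simp_all add: vadd_def pos_divide_le_eq pos_le_divide_eq pos_divide_less_eq pos_less_divide_eq)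
qed

lemma vadd_bounds:
  assumes "0 \<le> x" "x \<le> 1" "0 \<le> y" "y \<le> 1"
  shows "0 \<le> vadd x y" "vadd x y \<le> 1" "x \<le> vadd x y" "y \<le> vadd x y"
proof -
  have 1: "0 \<le> (1 - x) * (1 - y)" using assms by simp
  have 2: "x * (x * y) \<le> y" "y * (x * y) \<le> x"
    using assms mult_left_le_one_le[of y "x * x"] mult_left_le_one_le[of x "y * y"]
    by (simp_all add: mult_ac mult_le_one)
  show "0 \<le> vadd x y" "vadd x y \<le> 1" "x \<le> vadd x y" "y \<le> vadd x y"
    using assms 1 2 by (simp_all add: vadd_le_iff algebra_simps)
qed

lemma vadd_0 [simp]: "vadd 0 x = x" "vadd x 0 = x"
  by (simp_all add: vadd_def)

text \<open>The essential supremum of |tau|, since \<open>mag \<mu> z = z\<close> holds exactly if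
  |tau| \<le> z almost surely.\<close>

definition mtop :: "ereal measure \<Rightarrow> real" where
  "mtop \<mu> = Inf {z. 0 \<le> z \<and> mag \<mu> z = z}"

lemma
  assumes \<mu>: "symmetric_distribution \<mu>"
  shows mtop_bounds: "0 \<le> mtop \<mu>" "mtop \<mu> \<le> 1"
    and mag_ge_mtop: "mtop \<mu> \<le> z \<Longrightarrow> mag \<mu> z = z"
    and mag_less_mtop: "0 \<le> z \<Longrightarrow> z < mtop \<mu> \<Longrightarrow> z < mag \<mu> z"
    and mtop_le: "0 \<le> z \<Longrightarrow> mag \<mu> z = z \<Longrightarrow> mtop \<mu> \<le> z"
proof -
  let ?S = "{z. 0 \<le> z \<and> mag \<mu> z = z}"
  have 1: "1 \<in> ?S" using mag_bounds(3)[OF \<mu>, of 1] by simp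
  have b: "bdd_below ?S" by (intro bdd_belowI[of _ 0]) auto
  show le: "0 \<le> z \<Longrightarrow> mag \<mu> z = z \<Longrightarrow> mtop \<mu> \<le> z" for z
    unfolding mtop_def by (rule cInf_lower[OF _ b]) simp
  show "mtop \<mu> \<le> 1" using le[of 1] 1 by simp
  show "0 \<le> mtop \<mu>" unfolding mtop_def using 1 by (intro cInf_greatest) blast+
  show "0 \<le> z \<Longrightarrow> z < mtop \<mu> \<Longrightarrow> z < mag \<mu> z"
    using le[of z] mag_bounds(1)[OF \<mu>, of z] by force
  have up: "mag \<mu> z = z" if "mag \<mu> w = w" "w \<le> z" for w z
    using mag_lipschitz[OF \<mu>, of z w] mag_bounds(1)[OF \<mu>, of z] that by linarith
  \<comment> \<open>Closedness puts the infimum into the set, so \<open>mag \<mu>\<close> is the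
    identity from \<open>mtop \<mu>\<close> on, inclusive.\<close>
  have "closed ?S"
  proof -
    have "?S = {0..} \<inter> {z. mag \<mu> z = z}" by auto
    moreover have "closed {z. mag \<mu> z = z}"
      by (intro closed_Collect_eq mag_continuous[OF \<mu>] continuous_on_id)
    ultimately show ?thesis by (simp add: closed_Int)
  qed
  then have "mtop \<mu> \<in> ?S"
    unfolding mtop_def using 1 b by (intro closed_contains_Inf) blast+
  then show "mtop \<mu> \<le> z \<Longrightarrow> mag \<mu> z = z" using up[of "mtop \<mu>" z] by simp
qed

lemma mtop_pos:
  assumes \<mu>: "symmetric_distribution \<mu>" and "0 < mag \<mu> 0"
  shows "0 < mtop \<mu>"
proof (rule ccontr)
  assume "\<not> 0 < mtop \<mu>"
  then show False using mag_ge_mtop[OF \<mu>, of 0] assms(2) by simp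
qed

lemma AE_le_mtop:
  assumes \<mu>: "symmetric_distribution \<mu>" and z: "mag \<mu> z = z"
  shows "AE r in \<mu>. \<bar>tau r\<bar> \<le> z"
proof -
  interpret prob_space \<mu> using symmetric_distributionD[OF \<mu>] by simp
  note i = mag_integrable[OF \<mu>, of z]
  have "(\<integral>r. max \<bar>tau r\<bar> z - z \<partial>\<mu>) = 0" using i z by (simp add: mag_def prob_space)
  then have "AE r in \<mu>. max \<bar>tau r\<bar> z - z = 0"
    using i by (subst (asm) integral_nonneg_eq_0_iff_AE) auto
  then show ?thesis by eventually_elim (auto simp: max_def split: if_splits)
qed

lemma mag_eqI_AE:
  assumes \<mu>: "symmetric_distribution \<mu>" and "AE r in \<mu>. \<bar>tau r\<bar> \<le> z"
  shows "mag \<mu> z = z"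
proof -
  interpret prob_space \<mu> using symmetric_distributionD[OF \<mu>] by simp
  note [measurable_cong] = symmetric_distributionD(2)[OF \<mu>]
  have "mag \<mu> z = (\<integral>r. z \<partial>\<mu>)"
    unfolding mag_def by (rule integral_cong_AE) (use assms(2) in \<open>auto elim!: eventually_mono\<close>)
  then show ?thesis by (simp add: prob_space)
qed

text \<open>After clearing the denominator the claim is (X - x)(1 - y Y) + (Y - y)(1 - x X) \<ge> 0;
  negating both x and y gives the other sign.\<close>

lemma vadd_abs_le:
  assumes "\<bar>x\<bar> \<le> X" "X \<le> 1" "\<bar>y\<bar> \<le> Y" "Y \<le> 1"
  shows "\<bar>x + y\<bar> \<le> vadd X Y * (1 + x * y)"
proof -
  have *: "x + y \<le> vadd X Y * (1 + x * y)" if "\<bar>x\<bar> \<le> X" "X \<le> 1" "\<bar>y\<bar> \<le> Y" "Y \<le> 1" for x y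
  proof -
    have XY: "0 < 1 + X * Y" using that by (intro add_pos_nonneg mult_nonneg_nonneg) auto
    have "\<bar>y * Y\<bar> \<le> 1" "\<bar>x * X\<bar> \<le> 1" unfolding abs_mult using that by (intro mult_le_one; auto)+
    then have "0 \<le> (X - x) * (1 - y * Y) + (Y - y) * (1 - x * X)" using that
      by (intro add_nonneg_nonneg mult_nonneg_nonneg) auto
    then have "(x + y) * (1 + X * Y) \<le> (X + Y) * (1 + x * y)" by (simp add: algebra_simps)
    then show ?thesis using XY by (simp add: vadd_def pos_le_divide_eq)
  qed
  from *[of x y] *[of "- x" "- y"] assms show ?thesis by (simp add: abs_le_iff)
qed

text \<open>At the parameter \<open>vadd X Y\<close> both maxima in \<open>kern\<close> resolve to
  their second argument for all pairs below the tops, and the terms with the product cancel.\<close>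

lemma mtop_iconv_le:
  assumes \<mu>: "symmetric_distribution \<mu>" and \<nu>: "symmetric_distribution \<nu>"
  shows "mtop (\<mu> \<star>\<star> \<nu>) \<le> vadd (mtop \<mu>) (mtop \<nu>)"
proof -
  let ?X = "mtop \<mu>" and ?Y = "mtop \<nu>"
  let ?z = "vadd ?X ?Y"
  interpret \<mu>: prob_space \<mu> using symmetric_distributionD[OF \<mu>] by simp
  interpret \<nu>: prob_space \<nu> using symmetric_distributionD[OF \<nu>] by simp
  note [measurable_cong] = symmetric_distributionD(2)[OF \<mu>] symmetric_distributionD(2)[OF \<nu>]
  note b = mtop_bounds[OF \<mu>] mtop_bounds[OF \<nu>]
  have z: "0 \<le> ?z" using vadd_bounds b by simp
  have k: "kern 1 ?z (tau x) (tau y) = ?z" if "\<bar>tau x\<bar> \<le> ?X" "\<bar>tau y\<bar> \<le> ?Y" for x y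
    using vadd_abs_le[of "tau x" ?X "tau y" ?Y] vadd_abs_le[of "tau x" ?X "- tau y" ?Y] that b
    by (simp add: kern_def max_def algebra_simps)
  have "mag (\<mu> \<star>\<star> \<nu>) ?z = (\<integral>x. \<integral>y. kern 1 ?z (tau x) (tau y) \<partial>\<nu> \<partial>\<mu>)"
    using integral_max_iconv[OF \<mu> \<nu> _ z, of 1] by (simp add: mag_def)
  also have "\<dots> = (\<integral>x. ?z \<partial>\<mu>)"
  proof (rule integral_cong_AE)
    show "AE x in \<mu>. (\<integral>y. kern 1 ?z (tau x) (tau y) \<partial>\<nu>) = ?z"
      using AE_le_mtop[OF \<mu> mag_ge_mtop[OF \<mu> order_refl]]
    proof eventually_elim
      case (elim x)
      have "(\<integral>y. kern 1 ?z (tau x) (tau y) \<partial>\<nu>) = (\<integral>y. ?z \<partial>\<nu>)"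
      proof (rule integral_cong_AE)
        show "AE y in \<nu>. kern 1 ?z (tau x) (tau y) = ?z"
          using AE_le_mtop[OF \<nu> mag_ge_mtop[OF \<nu> order_refl]]
          by eventually_elim (rule k[OF elim])
      qed auto
      then show ?case by (simp add: \<nu>.prob_space)
    qed
  qed auto
  finally have "mag (\<mu> \<star>\<star> \<nu>) ?z = ?z" by (simp add: \<mu>.prob_space)
  then show ?thesis by (rule mtop_le[OF symmetric_iconv[OF \<mu> \<nu>] z])
qed

lemma mtop_noise_le:
  assumes \<mu>: "symmetric_distribution \<mu>" and e: "0 \<le> e" "e \<le> 1"
  shows "mtop (noise e \<mu>) \<le> \<bar>1 - 2 * e\<bar> * mtop \<mu>"
proof (rule mtop_le[OF symmetric_noise[OF \<mu> e]])
  interpret \<mu>: prob_space \<mu> using symmetric_distributionD[OF \<mu>] by simp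
  note [measurable_cong] = symmetric_distributionD(2)[OF \<mu>]
  show "0 \<le> \<bar>1 - 2 * e\<bar> * mtop \<mu>" using mtop_bounds[OF \<mu>] by simp
  have "mag (noise e \<mu>) (\<bar>1 - 2 * e\<bar> * mtop \<mu>) = (\<integral>r. \<bar>1 - 2 * e\<bar> * mtop \<mu> \<partial>\<mu>)"
    unfolding mag_noise_eq[OF \<mu> e]
  proof (rule integral_cong_AE)
    show "AE r in \<mu>. max (\<bar>1 - 2 * e\<bar> * \<bar>tau r\<bar>) (\<bar>1 - 2 * e\<bar> * mtop \<mu>) = \<bar>1 - 2 * e\<bar> * mtop \<mu>"
      using AE_le_mtop[OF \<mu> mag_ge_mtop[OF \<mu> order_refl]]
      by eventually_elim (simp add: max_def mult_left_mono)
  qed auto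
  then show "mag (noise e \<mu>) (\<bar>1 - 2 * e\<bar> * mtop \<mu>) = \<bar>1 - 2 * e\<bar> * mtop \<mu>" by (simp add: \<mu>.prob_space)
qed

text \<open>The support of |tau|, tested with continuous functions instead of neighbourhoods,
  because the gaps of \<open>mag\<close> and \<open>kern\<close> to be tested are nonnegative
  continuous functions.\<close>

definition insupp :: "ereal measure \<Rightarrow> real \<Rightarrow> bool" where
  "insupp \<mu> x \<longleftrightarrow> 0 \<le> x \<and> x \<le> 1 \<and>
    (\<forall>h :: real \<Rightarrow> real. continuous_on {0..1} h \<longrightarrow> (\<forall>t\<in>{0..1}. 0 \<le> h t) \<longrightarrow> 0 < h x \<longrightarrow> 0 < (\<integral>r. h \<bar>tau r\<bar> \<partial>\<mu>))"

lemma continuous_abs_tau: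
  fixes h :: "real \<Rightarrow> real"
  assumes "continuous_on {0..1} h"
  shows "(\<lambda>r. h \<bar>tau r\<bar>) \<in> borel_measurable borel" "\<exists>B. \<forall>r. \<bar>h \<bar>tau r\<bar>\<bar> \<le> B"
proof -
  have "continuous_on UNIV (\<lambda>x. h (clamp01 x))"
    by (rule continuous_on_compose2[OF assms continuous_clamp01]) (auto simp: clamp01)
  from borel_measurable_continuous_onI[OF this]
  have "(\<lambda>r. h (clamp01 \<bar>tau r\<bar>)) \<in> borel_measurable borel" by measurable
  then show "(\<lambda>r. h \<bar>tau r\<bar>) \<in> borel_measurable borel" by (simp add: clamp01 abs_tau_le_1)
  have "bounded (h ` {0..1})" by (rule compact_imp_bounded[OF compact_continuous_image[OF assms]]) simp
  then obtain B where "\<forall>x\<in>{0..1}. \<bar>h x\<bar> \<le> B" unfolding bounded_iff by auto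
  then show "\<exists>B. \<forall>r. \<bar>h \<bar>tau r\<bar>\<bar> \<le> B" by (intro exI[of _ B]) (simp add: abs_tau_le_1)
qed

lemma continuous_abs_tau_integrable:
  fixes h :: "real \<Rightarrow> real"
  assumes "symmetric_distribution \<mu>" "continuous_on {0..1} h"
  shows "integrable \<mu> (\<lambda>r. h \<bar>tau r\<bar>)"
proof -
  obtain B where "\<forall>r. \<bar>h \<bar>tau r\<bar>\<bar> \<le> B" using continuous_abs_tau(2)[OF assms(2)] by blast
  then show ?thesis by (intro symmetric_integrable[OF assms(1) continuous_abs_tau(1)[OF assms(2)]]) auto
qed

lemma insuppD:
  fixes h :: "real \<Rightarrow> real"
  assumes "insupp \<mu> x" "continuous_on {0..1} h" "\<And>t. 0 \<le> t \<Longrightarrow> t \<le> 1 \<Longrightarrow> 0 \<le> h t" "0 < h x"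
  shows "0 < (\<integral>r. h \<bar>tau r\<bar> \<partial>\<mu>)"
  using assms unfolding insupp_def by auto

lemma continuous_on_slices:
  fixes f :: "real \<Rightarrow> real \<Rightarrow> real"
  assumes c: "continuous_on ({0..1} \<times> {0..1}) (\<lambda>p. f (fst p) (snd p))" and y: "0 \<le> y" "y \<le> 1"
  shows "continuous_on {0..1} (\<lambda>x. f x y)" "continuous_on {0..1} (\<lambda>x. f y x)"
proof -
  have 1: "continuous_on {0..1} (\<lambda>x. (x, y))" "continuous_on {0..1} (\<lambda>x. (y, x))"
    by (intro continuous_intros)+
  have 2: "(\<lambda>x. (x, y)) ` {0..1} \<subseteq> {0..1} \<times> {0..1}" "(\<lambda>x. (y, x)) ` {0..1} \<subseteq> {0..1} \<times> {0..1}"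
    using y by auto
  show "continuous_on {0..1} (\<lambda>x. f x y)" "continuous_on {0..1} (\<lambda>x. f y x)"
    using continuous_on_compose2[OF c 1(1) 2(1)] continuous_on_compose2[OF c 1(2) 2(2)] by simp_all
qed

lemma insupp_bounds: "insupp \<mu> x \<Longrightarrow> 0 \<le> x" "insupp \<mu> x \<Longrightarrow> x \<le> 1"
  by (auto simp: insupp_def)

text \<open>If h had mean 0, |tau| would avoid a neighbourhood of \<open>mtop \<mu>\<close> and the
  essential supremum would be smaller.\<close>

lemma insupp_mtop:
  assumes \<mu>: "symmetric_distribution \<mu>"
  shows "insupp \<mu> (mtop \<mu>)"
  unfolding insupp_def
proof (intro conjI allI impI)
  interpret prob_space \<mu> using symmetric_distributionD[OF \<mu>] by simp
  let ?M = "mtop \<mu>"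
  show M: "0 \<le> ?M" "?M \<le> 1" by (rule mtop_bounds[OF \<mu>])+
  fix h :: "real \<Rightarrow> real"
  assume c: "continuous_on {0..1} h" and nn: "\<forall>t\<in>{0..1}. 0 \<le> h t" and pos: "0 < h ?M"
  note i = continuous_abs_tau_integrable[OF \<mu> c]
  have nn': "0 \<le> h \<bar>tau r\<bar>" for r using nn by (simp add: abs_tau_le_1)
  show "0 < (\<integral>r. h \<bar>tau r\<bar> \<partial>\<mu>)"
  proof (rule ccontr)
    assume "\<not> ?thesis"
    then have "(\<integral>r. h \<bar>tau r\<bar> \<partial>\<mu>) = 0"
      using Bochner_Integration.integral_nonneg[of \<mu> "\<lambda>r. h \<bar>tau r\<bar>", OF nn'] by linarith
    then have ae: "AE r in \<mu>. h \<bar>tau r\<bar> = 0"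
      using i nn' by (subst (asm) integral_nonneg_eq_0_iff_AE) auto
    have "(h \<longlongrightarrow> h ?M) (at ?M within {0..1})"
      using c M by (simp add: continuous_on)
    from order_tendstoD(1)[OF this pos] obtain \<eta> where \<eta>: "0 < \<eta>" "\<And>t. t \<in> {0..1} \<Longrightarrow> t \<noteq> ?M \<Longrightarrow> dist t ?M < \<eta> \<Longrightarrow> 0 < h t"
      by (auto simp: eventually_at)
    have "AE r in \<mu>. \<bar>tau r\<bar> \<le> ?M - \<eta>"
      using ae AE_le_mtop[OF \<mu> mag_ge_mtop[OF \<mu> order_refl]]
    proof eventually_elim
      case (elim r)
      show ?case
      proof (rule ccontr)
        assume "\<not> ?thesis"
        then have "dist \<bar>tau r\<bar> ?M < \<eta>" using elim(2) by (simp add: dist_real_def)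
        then have "0 < h \<bar>tau r\<bar>" using \<eta>(2)[of "\<bar>tau r\<bar>"] pos abs_tau_le_1[of r] by (cases "\<bar>tau r\<bar> = ?M") auto
        with elim(1) show False by simp
      qed
    qed
    then have e: "mag \<mu> (?M - \<eta>) = ?M - \<eta>" by (rule mag_eqI_AE[OF \<mu>])
    \<comment> \<open>The infimum defining \<open>mtop\<close> runs over nonnegative points only;
      \<open>mag\<close> supplies the sign.\<close>
    moreover have "0 \<le> ?M - \<eta>" using e mag_bounds(4)[OF \<mu>, of "?M - \<eta>"] by simp
    ultimately have "?M \<le> ?M - \<eta>" by (intro mtop_le[OF \<mu>])
    with \<eta>(1) show False by simp
  qed
qed

lemma continuous_integral_abs_tau:
  fixes f :: "real \<Rightarrow> real \<Rightarrow> real"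
  assumes \<mu>: "symmetric_distribution \<mu>" and c: "continuous_on ({0..1} \<times> {0..1}) (\<lambda>p. f (fst p) (snd p))"
  shows "continuous_on {0..1} (\<lambda>y. \<integral>r. f \<bar>tau r\<bar> y \<partial>\<mu>)"
  unfolding continuous_on_sequentially
proof (intro allI ballI impI, elim conjE)
  fix Y :: "nat \<Rightarrow> real" and y :: real
  assume y: "y \<in> {0..1}" and Y: "\<forall>n. Y n \<in> {0..1}" and lim: "Y \<longlonglongrightarrow> y"
  interpret prob_space \<mu> using symmetric_distributionD[OF \<mu>] by simp
  note [measurable_cong] = symmetric_distributionD(2)[OF \<mu>]
  have "bounded ((\<lambda>p. f (fst p) (snd p)) ` ({0..1} \<times> {0..1}))"
    by (rule compact_imp_bounded[OF compact_continuous_image[OF c]]) (intro compact_Times; simp)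
  then obtain B where B': "\<forall>p\<in>{0..1} \<times> {0..1}. \<bar>f (fst p) (snd p)\<bar> \<le> B" unfolding bounded_iff by auto
  have B: "\<bar>f x z\<bar> \<le> B" if "x \<in> {0..1}" "z \<in> {0..1}" for x z
    using bspec[OF B', of "(x, z)"] that by simp
  have m: "(\<lambda>r. f \<bar>tau r\<bar> z) \<in> borel_measurable borel" if "z \<in> {0..1}" for z
  proof (rule continuous_abs_tau(1)[where h="\<lambda>x. f x z"])
    show "continuous_on {0..1} (\<lambda>x. f x z)"
      using that by (intro continuous_on_slices[OF c]) auto
  qed
  show "((\<lambda>y. \<integral>r. f \<bar>tau r\<bar> y \<partial>\<mu>) \<circ> Y) \<longlonglongrightarrow> (\<integral>r. f \<bar>tau r\<bar> y \<partial>\<mu>)"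
    unfolding comp_def
  proof (rule integral_dominated_convergence[where w="\<lambda>_. B"])
    show "(\<lambda>r. f \<bar>tau r\<bar> y) \<in> borel_measurable \<mu>" "(\<lambda>r. f \<bar>tau r\<bar> (Y n)) \<in> borel_measurable \<mu>" for n
      using m[of y] m[of "Y n"] y Y by (simp_all cong: measurable_cong_sets)
    show "AE r in \<mu>. (\<lambda>n. f \<bar>tau r\<bar> (Y n)) \<longlonglongrightarrow> f \<bar>tau r\<bar> y"
    proof (rule AE_I2)
      fix r
      have "continuous_on {0..1} (\<lambda>z. f \<bar>tau r\<bar> z)"
        by (intro continuous_on_slices[OF c]) (simp_all add: abs_tau_le_1)
      from continuous_on_tendsto_compose[OF this lim y] Y
      show "(\<lambda>n. f \<bar>tau r\<bar> (Y n)) \<longlonglongrightarrow> f \<bar>tau r\<bar> y" by simp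
    qed
    show "AE r in \<mu>. norm (f \<bar>tau r\<bar> (Y n)) \<le> B" for n
      using B Y by (intro AE_I2) (simp add: abs_tau_le_1)
  qed simp
qed

text \<open>The outer law is tested with the partial integral, which is continuous and, by the inner
  law, positive at y.\<close>

lemma insuppD2:
  fixes f :: "real \<Rightarrow> real \<Rightarrow> real"
  assumes \<mu>: "symmetric_distribution \<mu>" and x: "insupp \<mu> x" and y: "insupp \<nu> y"
    and c: "continuous_on ({0..1} \<times> {0..1}) (\<lambda>p. f (fst p) (snd p))"
    and nn: "\<And>s t. 0 \<le> s \<Longrightarrow> s \<le> 1 \<Longrightarrow> 0 \<le> t \<Longrightarrow> t \<le> 1 \<Longrightarrow> 0 \<le> f s t" and pos: "0 < f x y"
  shows "0 < (\<integral>s. \<integral>r. f \<bar>tau r\<bar> \<bar>tau s\<bar> \<partial>\<mu> \<partial>\<nu>)"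
proof (rule insuppD[OF y continuous_integral_abs_tau[OF \<mu> c]])
  show "0 \<le> (\<integral>r. f \<bar>tau r\<bar> t \<partial>\<mu>)" if "0 \<le> t" "t \<le> 1" for t
    using that by (intro Bochner_Integration.integral_nonneg nn) (auto simp: abs_tau_le_1)
  show "0 < (\<integral>r. f \<bar>tau r\<bar> y \<partial>\<mu>)"
  proof (rule insuppD[OF x, where h="\<lambda>s. f s y"])
    show "continuous_on {0..1} (\<lambda>s. f s y)"
      by (intro continuous_on_slices[OF c] insupp_bounds[OF y])
  qed (use nn insupp_bounds[OF y] pos in auto)
qed

lemma insupp_noise:
  assumes \<mu>: "symmetric_distribution \<mu>" and e: "0 \<le> e" "e \<le> 1" and x: "insupp \<mu> x"
  shows "insupp (noise e \<mu>) (\<bar>1 - 2 * e\<bar> * x)"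
  unfolding insupp_def
proof (intro conjI allI impI)
  have t: "\<bar>1 - 2 * e\<bar> \<le> 1" using e by auto
  have s: "0 \<le> \<bar>1 - 2 * e\<bar> * u" "\<bar>1 - 2 * e\<bar> * u \<le> 1" if "0 \<le> u" "u \<le> 1" for u
    using that t by (auto intro: mult_le_one)
  show "0 \<le> \<bar>1 - 2 * e\<bar> * x" "\<bar>1 - 2 * e\<bar> * x \<le> 1" using s insupp_bounds[OF x] by auto
  fix h :: "real \<Rightarrow> real"
  assume c: "continuous_on {0..1} h" and nn: "\<forall>t\<in>{0..1}. 0 \<le> h t" and pos: "0 < h (\<bar>1 - 2 * e\<bar> * x)"
  obtain B where B: "\<And>r. \<bar>h \<bar>tau r\<bar>\<bar> \<le> B" using continuous_abs_tau(2)[OF c] by blast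
  have hm: "(\<lambda>x. h (clamp01 x)) \<in> borel_measurable borel"
    by (rule borel_measurable_continuous_onI, rule continuous_on_compose2[OF c continuous_clamp01]) (auto simp: clamp01)
  have "(\<integral>r. h (clamp01 \<bar>tau r\<bar>) \<partial>noise e \<mu>) = (\<integral>r. h (clamp01 (\<bar>1 - 2 * e\<bar> * \<bar>tau r\<bar>)) \<partial>\<mu>)"
    by (rule integral_noise_abs[OF \<mu> e hm, where B=B]) (simp add: B clamp01 abs_tau_le_1)
  then have "(\<integral>r. h \<bar>tau r\<bar> \<partial>noise e \<mu>) = (\<integral>r. h (\<bar>1 - 2 * e\<bar> * \<bar>tau r\<bar>) \<partial>\<mu>)"
    using s[of "\<bar>tau _\<bar>"] by (simp add: clamp01 abs_tau_le_1)
  also have "\<dots> > 0"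
  proof (rule insuppD[OF x, where h="\<lambda>u. h (\<bar>1 - 2 * e\<bar> * u)"])
    show "continuous_on {0..1} (\<lambda>u. h (\<bar>1 - 2 * e\<bar> * u))"
      by (rule continuous_on_compose2[OF c]) (use s in \<open>auto intro!: continuous_intros\<close>)
  qed (use nn s pos in auto)
  finally show "0 < (\<integral>r. h \<bar>tau r\<bar> \<partial>noise e \<mu>)" .
qed

lemma insupp_bsc:
  assumes a: "0 \<le> a" "a \<le> 1"
  shows "insupp (bsc a) a"
  unfolding insupp_def
proof (intro conjI allI impI a)
  fix h :: "real \<Rightarrow> real"
  assume c: "continuous_on {0..1} h" and nn: "\<forall>t\<in>{0..1}. 0 \<le> h t" and pos: "0 < h a"
  obtain B where B: "\<And>r. \<bar>h \<bar>tau r\<bar>\<bar> \<le> B" using continuous_abs_tau(2)[OF c] by blast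
  have hm: "(\<lambda>x. h (clamp01 x)) \<in> borel_measurable borel"
    by (rule borel_measurable_continuous_onI, rule continuous_on_compose2[OF c continuous_clamp01]) (auto simp: clamp01)
  have "(\<integral>r. h (clamp01 \<bar>tau r\<bar>) \<partial>bsc a) = h (clamp01 a)"
    by (rule integral_bsc_abs[OF a hm, where B=B]) (simp add: B clamp01 abs_tau_le_1)
  then show "0 < (\<integral>r. h \<bar>tau r\<bar> \<partial>bsc a)" using pos a by (simp add: clamp01 abs_tau_le_1)
qed

text \<open>One of the two relative signs makes the magnitudes add up to \<open>vadd\<close>, and it
  has probability at least 1 / 2. Keeping only its contribution bounds the mean of h from
  below.\<close>

lemma insupp_iconv:
  assumes \<mu>: "symmetric_distribution \<mu>" and \<nu>: "symmetric_distribution \<nu>" and x: "insupp \<mu> x" and y: "insupp \<nu> y"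
  shows "insupp (\<mu> \<star>\<star> \<nu>) (vadd x y)"
  unfolding insupp_def
proof (intro conjI allI impI)
  note xy = insupp_bounds[OF x] insupp_bounds[OF y]
  show "0 \<le> vadd x y" "vadd x y \<le> 1" using vadd_bounds xy by auto
  fix h :: "real \<Rightarrow> real"
  assume c: "continuous_on {0..1} h" and nn: "\<forall>t\<in>{0..1}. 0 \<le> h t" and pos: "0 < h (vadd x y)"
  note m = symmetric_distributionD(1,2)
  have com: "\<mu> \<star>\<star> \<nu> = \<nu> \<star>\<star> \<mu>" by (intro iconv_commute m \<mu> \<nu>)
  obtain B where B: "\<And>r. \<bar>h \<bar>tau r\<bar>\<bar> \<le> B" using continuous_abs_tau(2)[OF c] by blast
  define f where "f s t = (1 + s * t) / 2 * h (vadd s t)" for s t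
  define g where "g t s = (1 + tau s * tau t) / 2 * h \<bar>tau (s + t)\<bar> + (1 - tau s * tau t) / 2 * h \<bar>tau (s + - t)\<bar>" for s t
  note hm [measurable] = continuous_abs_tau(1)[OF c]
  have nn': "0 \<le> h \<bar>tau r\<bar>" for r using nn by (simp add: abs_tau_le_1)
  have den: "0 < 1 + s * t" if "0 \<le> s" "0 \<le> t" for s t :: real using that by (simp add: add_pos_nonneg)
  have cf: "continuous_on ({0..1} \<times> {0..1}) (\<lambda>p. f (fst p) (snd p))"
  proof -
    have "continuous_on ({0..1} \<times> {0..1}) (\<lambda>p. vadd (fst p) (snd p))"
    proof -
      have "1 + fst p * snd p \<noteq> 0" if "p \<in> {0..1} \<times> {0..1}" for p :: "real \<times> real"
        using den[of "fst p" "snd p"] that by auto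
      then show ?thesis unfolding vadd_def by (intro continuous_intros) auto
    qed
    then have "continuous_on ({0..1} \<times> {0..1}) (\<lambda>p. h (vadd (fst p) (snd p)))"
      by (rule continuous_on_compose2[OF c]) (auto simp: vadd_bounds)
    then show ?thesis unfolding f_def by (intro continuous_intros; simp)
  qed
  have st: "\<bar>tau s * tau t\<bar> \<le> 1" for s t by (simp add: abs_mult abs_tau_le_1 mult_le_one)
  have fg: "f \<bar>tau r\<bar> \<bar>tau s\<bar> \<le> g s r" for r s
  proof -
    have 1: "0 \<le> (1 + tau r * tau s) / 2" "0 \<le> (1 - tau r * tau s) / 2"
      using st[of r s] by auto
    show ?thesis
    proof (cases "0 \<le> tau r * tau s")
      case True
      then have "\<bar>tau r\<bar> * \<bar>tau s\<bar> = tau r * tau s" by (simp flip: abs_mult)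
      moreover have "\<bar>tau r + tau s\<bar> = \<bar>tau r\<bar> + \<bar>tau s\<bar>" using True by (auto simp: zero_le_mult_iff)
      ultimately have "vadd \<bar>tau r\<bar> \<bar>tau s\<bar> = \<bar>tau (r + s)\<bar>"
        using True by (subst tau_add) (auto simp: vadd_def abs_div)
      then show ?thesis unfolding f_def g_def using \<open>\<bar>tau r\<bar> * \<bar>tau s\<bar> = tau r * tau s\<close> 1 nn' by simp
    next
      case False
      then have "\<bar>tau r\<bar> * \<bar>tau s\<bar> = - (tau r * tau s)" by (simp flip: abs_mult)
      moreover have "\<bar>tau r - tau s\<bar> = \<bar>tau r\<bar> + \<bar>tau s\<bar>" using False by (auto simp: not_le mult_less_0_iff)
      ultimately have "vadd \<bar>tau r\<bar> \<bar>tau s\<bar> = \<bar>tau (r + - s)\<bar>"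
        using False by (subst tau_add) (auto simp: vadd_def abs_div)
      then show ?thesis unfolding f_def g_def using \<open>\<bar>tau r\<bar> * \<bar>tau s\<bar> = - (tau r * tau s)\<close> 1 nn' by simp
    qed
  qed
  have "0 < (\<integral>s. \<integral>r. f \<bar>tau r\<bar> \<bar>tau s\<bar> \<partial>\<mu> \<partial>\<nu>)"
  proof (rule insuppD2[OF \<mu> x y cf])
    show "0 \<le> f s t" if "0 \<le> s" "s \<le> 1" "0 \<le> t" "t \<le> 1" for s t
      using that nn vadd_bounds[OF that] den[OF that(1,3)] by (simp add: f_def)
    show "0 < f x y" using pos den[OF xy(1,3)] by (simp add: f_def)
  qed
  also have "\<dots> \<le> (\<integral>s. \<integral>r. g s r \<partial>\<mu> \<partial>\<nu>)"
  proof -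
    have gB: "\<bar>g s r\<bar> \<le> 2 * B" for s r
    proof -
      have "\<bar>(1 + tau r * tau s) / 2 * h \<bar>tau (r + s)\<bar>\<bar> \<le> 1 * B" "\<bar>(1 - tau r * tau s) / 2 * h \<bar>tau (r + - s)\<bar>\<bar> \<le> 1 * B"
        unfolding abs_mult using st[of r s] B by (intro mult_mono; auto)+
      then show ?thesis unfolding g_def by linarith
    qed
    have [measurable]: "(\<lambda>(s, r). g s r) \<in> borel_measurable (borel \<Otimes>\<^sub>M borel)"
      unfolding g_def by measurable
    have ig: "integrable \<mu> (\<lambda>r. g s r)" for s by (rule symmetric_integrable[OF \<mu> _ gB]) measurable
    have jf: "integrable \<mu> (\<lambda>r. f \<bar>tau r\<bar> \<bar>tau s\<bar>)" for s
    proof (rule continuous_abs_tau_integrable[OF \<mu>, where h="\<lambda>u. f u \<bar>tau s\<bar>"])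
      show "continuous_on {0..1} (\<lambda>u. f u \<bar>tau s\<bar>)"
        by (intro continuous_on_slices[OF cf]) (simp_all add: abs_tau_le_1)
    qed
    show ?thesis
    proof (intro integral_mono)
      show "integrable \<nu> (\<lambda>s. \<integral>r. f \<bar>tau r\<bar> \<bar>tau s\<bar> \<partial>\<mu>)"
        by (rule continuous_abs_tau_integrable[OF \<nu> continuous_integral_abs_tau[OF \<mu> cf]])
      show "integrable \<nu> (\<lambda>s. \<integral>r. g s r \<partial>\<mu>)"
        by (rule symmetric_integrable[OF \<nu> symmetric_measurable_integral[OF \<mu>] symmetric_integral_bound[OF \<mu> _ gB]]) measurable
    qed (use jf ig fg in auto)
  qed
  also have "\<dots> = (\<integral>r. h \<bar>tau r\<bar> \<partial>(\<nu> \<star>\<star> \<mu>))"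
  proof (subst integral_iconv_even[OF \<nu> \<mu> hm B])
    show "h \<bar>tau (- r)\<bar> = h \<bar>tau r\<bar>" for r by simp
    have "g s r = (1 + tau s * tau r) / 2 * h \<bar>tau (s + r)\<bar> + (1 - tau s * tau r) / 2 * h \<bar>tau (s + - r)\<bar>" for s r
    proof -
      \<comment> \<open>The two differences are negatives of each other unless r and s are the same
        infinity, and then the weight is 0.\<close>
      have "(1 - tau s * tau r) * h \<bar>tau (r + - s)\<bar> = (1 - tau s * tau r) * h \<bar>tau (s + - r)\<bar>"
      proof (cases "tau s * tau r = 1")
        case False
        then have "tau (r + - s) = - tau (s + - r)"
          by (subst (1 2) tau_add) (auto simp: mult.commute minus_divide_left)
        then show ?thesis by simp
      qed simp
      then show ?thesis unfolding g_def by (simp add: add.commute mult.commute[of "tau r"])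
    qed
    then show "(\<integral>s. \<integral>r. g s r \<partial>\<mu> \<partial>\<nu>) = (\<integral>s. \<integral>r. (1 + tau s * tau r) / 2 * h \<bar>tau (s + r)\<bar> + (1 - tau s * tau r) / 2 * h \<bar>tau (s + - r)\<bar> \<partial>\<mu> \<partial>\<nu>)"
      by simp
  qed
  finally show "0 < (\<integral>r. h \<bar>tau r\<bar> \<partial>(\<mu> \<star>\<star> \<nu>))" by (simp add: com)
qed

section \<open>Strictness and uniqueness\<close>

lemma noise_commute:
  assumes \<mu>: "symmetric_distribution \<mu>" and d: "0 \<le> d" "d \<le> 1" and e: "0 \<le> e" "e \<le> 1"
  shows "noise e (noise d \<mu>) = noise d (noise e \<mu>)"
proof (rule mag_inject)
  have *: "mag (noise e (noise d \<mu>)) a = (\<integral>r. max (\<bar>1 - 2 * e\<bar> * (\<bar>1 - 2 * d\<bar> * \<bar>tau r\<bar>)) a \<partial>\<mu>)"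
    if d: "0 \<le> d" "d \<le> 1" and e: "0 \<le> e" "e \<le> 1" for d e a
  proof -
    have "mag (noise e (noise d \<mu>)) a = (\<integral>r. max (\<bar>1 - 2 * e\<bar> * \<bar>tau r\<bar>) a \<partial>noise d \<mu>)"
      by (rule mag_noise_eq[OF symmetric_noise[OF \<mu> d] e])
    also have "\<dots> = (\<integral>r. max (\<bar>1 - 2 * e\<bar> * (\<bar>1 - 2 * d\<bar> * \<bar>tau r\<bar>)) a \<partial>\<mu>)"
    proof (rule integral_noise_abs[OF \<mu> d, where f="\<lambda>x. max (\<bar>1 - 2 * e\<bar> * x) a" and B="1 + \<bar>a\<bar>"])
      fix r
      have "\<bar>1 - 2 * e\<bar> * \<bar>tau r\<bar> \<le> 1" using abs_tau_le_1[of r] e by (intro mult_le_one) auto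
      then show "\<bar>max (\<bar>1 - 2 * e\<bar> * \<bar>tau r\<bar>) a\<bar> \<le> 1 + \<bar>a\<bar>"
        using mult_nonneg_nonneg[of "\<bar>1 - 2 * e\<bar>" "\<bar>tau r\<bar>"] by linarith
    qed measurable
    finally show ?thesis .
  qed
  show "mag (noise e (noise d \<mu>)) a = mag (noise d (noise e \<mu>)) a" for a
    unfolding *[OF d e] *[OF e d] by (simp add: mult.left_commute)
qed (intro symmetric_noise \<mu> d e)+

section \<open>Equality cases of convolution\<close>

lemma iconv_pow_swap:
  assumes \<mu>: "symmetric_distribution \<mu>" and X: "symmetric_distribution X" and Y: "symmetric_distribution Y"
  shows "iconv_pow \<mu> n X \<star>\<star> Y = X \<star>\<star> iconv_pow \<mu> n Y"
proof (induction n)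
  case (Suc n)
  note s = symmetric_distributionD(1,2)
  note p = symmetric_iconv_pow[OF \<mu> X, of n] symmetric_iconv_pow[OF \<mu> Y, of n]
  have "iconv_pow \<mu> (Suc n) X \<star>\<star> Y = \<mu> \<star>\<star> (iconv_pow \<mu> n X \<star>\<star> Y)"
    unfolding iconv_pow.simps by (intro iconv_assoc s \<mu> p Y)
  also have "\<dots> = \<mu> \<star>\<star> (X \<star>\<star> iconv_pow \<mu> n Y)" by (simp add: Suc.IH)
  also have "\<dots> = (\<mu> \<star>\<star> X) \<star>\<star> iconv_pow \<mu> n Y" by (intro iconv_assoc[symmetric] s \<mu> p X)
  also have "\<mu> \<star>\<star> X = X \<star>\<star> \<mu>" by (intro iconv_commute s \<mu> X)
  also have "(X \<star>\<star> \<mu>) \<star>\<star> iconv_pow \<mu> n Y = X \<star>\<star> (\<mu> \<star>\<star> iconv_pow \<mu> n Y)" by (intro iconv_assoc s \<mu> p X)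
  finally show ?case by simp
qed simp

lemma iconv_pow_add: "iconv_pow \<mu> k (iconv_pow \<mu> m X) = iconv_pow \<mu> (k + m) X"
  by (induction k) auto

text \<open>As in \<open>mag_iconv\<close>, with the n copies of \<mu> moved into the law of the
  parameter and X left as the factor to be varied.\<close>

lemma mag_iconv_pow:
  assumes \<mu>: "symmetric_distribution \<mu>" and X: "symmetric_distribution X" and a: "0 \<le> a" "a \<le> 1"
  shows "mag (iconv_pow \<mu> n X) a = (\<integral>c. mag X \<bar>tau c\<bar> \<partial>iconv_pow \<mu> n (bsc a))"
proof -
  have "mag (iconv_pow \<mu> n X) a = mag (iconv_pow \<mu> n X \<star>\<star> bsc a) 0"
    by (rule mag_eq_mag_0[OF symmetric_iconv_pow[OF \<mu> X] a])
  also have "iconv_pow \<mu> n X \<star>\<star> bsc a = X \<star>\<star> iconv_pow \<mu> n (bsc a)"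
    by (rule iconv_pow_swap[OF \<mu> X symmetric_bsc[OF a]])
  also have "mag \<dots> 0 = (\<integral>c. mag X \<bar>tau c\<bar> \<partial>iconv_pow \<mu> n (bsc a))"
    by (rule mag_0_iconv[OF X symmetric_iconv_pow[OF \<mu> symmetric_bsc[OF a]]])
  finally show ?thesis .
qed

text \<open>A nonnegative continuous gap with mean zero vanishes on the support. This turns an
  equality of averages into an equality at a chosen point.\<close>

lemma mag_eq_at_insupp:
  assumes X: "symmetric_distribution X" and Y: "symmetric_distribution Y" and XY: "X \<preceq> Y"
    and \<kappa>: "symmetric_distribution \<kappa>" and C: "insupp \<kappa> C"
    and eq: "(\<integral>c. mag X \<bar>tau c\<bar> \<partial>\<kappa>) = (\<integral>c. mag Y \<bar>tau c\<bar> \<partial>\<kappa>)"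
  shows "mag X C = mag Y C"
proof (rule ccontr)
  assume "mag X C \<noteq> mag Y C"
  with degD[OF XY insupp_bounds[OF C]] have "0 < mag Y C - mag X C" by simp
  then have "0 < (\<integral>c. mag Y \<bar>tau c\<bar> - mag X \<bar>tau c\<bar> \<partial>\<kappa>)"
    by (intro insuppD[OF C, where h="\<lambda>t. mag Y t - mag X t"] continuous_on_diff mag_continuous X Y)
       (auto intro: degD[OF XY])
  also have "\<dots> = 0" using eq mag_tau_integrable[OF X \<kappa>] mag_tau_integrable[OF Y \<kappa>] by simp
  finally show False by simp
qed

lemma mag_noise_of_iconv:
  assumes \<mu>: "symmetric_distribution \<mu>" and \<nu>: "symmetric_distribution \<nu>" and e: "0 \<le> e" "e \<le> 1" and a: "0 \<le> a"
  shows "mag (noise e (\<mu> \<star>\<star> \<nu>)) a = (\<integral>x. \<integral>y. kern \<bar>1 - 2 * e\<bar> a \<bar>tau x\<bar> \<bar>tau y\<bar> \<partial>\<nu> \<partial>\<mu>)"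
  unfolding mag_noise_eq[OF symmetric_iconv[OF \<mu> \<nu>] e] kern_abs
  by (rule integral_max_iconv[OF \<mu> \<nu> _ a]) simp

lemma mag_iconv_of_noise:
  assumes \<mu>: "symmetric_distribution \<mu>" and \<nu>: "symmetric_distribution \<nu>" and e: "0 \<le> e" "e \<le> 1" and a: "0 \<le> a"
  shows "mag (noise e \<mu> \<star>\<star> noise e \<nu>) a = (\<integral>x. \<integral>y. kern 1 a (\<bar>1 - 2 * e\<bar> * \<bar>tau x\<bar>) (\<bar>1 - 2 * e\<bar> * \<bar>tau y\<bar>) \<partial>\<nu> \<partial>\<mu>)"
proof -
  note n\<mu> = symmetric_noise[OF \<mu> e] and n\<nu> = symmetric_noise[OF \<nu> e]
  let ?t = "\<bar>1 - 2 * e\<bar>"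
  have t: "\<bar>?t * \<bar>tau y\<bar>\<bar> \<le> 1" for y using abs_tau_le_1[of y] e by (simp add: abs_mult mult_le_one)
  have kB: "\<bar>kern 1 a u v\<bar> \<le> 2 * 1 + 2 * a" if "\<bar>u\<bar> \<le> 1" "\<bar>v\<bar> \<le> 1" for u v
    using a that by (intro kern_bound) auto
  have "mag (noise e \<mu> \<star>\<star> noise e \<nu>) a = (\<integral>x. \<integral>y. kern 1 a (tau x) (tau y) \<partial>noise e \<nu> \<partial>noise e \<mu>)"
    using integral_max_iconv[OF n\<mu> n\<nu> _ a, of 1] by (simp add: mag_def)
  also have "\<dots> = (\<integral>x. \<integral>y. kern 1 a \<bar>tau x\<bar> \<bar>tau y\<bar> \<partial>noise e \<nu> \<partial>noise e \<mu>)"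
    by (simp add: kern_abs)
  also have "\<dots> = (\<integral>x. \<integral>y. kern 1 a \<bar>tau x\<bar> (?t * \<bar>tau y\<bar>) \<partial>\<nu> \<partial>noise e \<mu>)"
  proof (rule Bochner_Integration.integral_cong[OF refl])
    fix x
    show "(\<integral>y. kern 1 a \<bar>tau x\<bar> \<bar>tau y\<bar> \<partial>noise e \<nu>) = (\<integral>y. kern 1 a \<bar>tau x\<bar> (?t * \<bar>tau y\<bar>) \<partial>\<nu>)"
      by (rule integral_noise_abs[OF \<nu> e, where f="kern 1 a \<bar>tau x\<bar>" and B="2 * 1 + 2 * a"])
         (measurable, intro kB, simp_all add: abs_tau_le_1)
  qed
  also have "\<dots> = (\<integral>x. \<integral>y. kern 1 a (?t * \<bar>tau x\<bar>) (?t * \<bar>tau y\<bar>) \<partial>\<nu> \<partial>\<mu>)"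
  proof (rule integral_noise_abs[OF \<mu> e, where f="\<lambda>u. \<integral>y. kern 1 a u (?t * \<bar>tau y\<bar>) \<partial>\<nu>" and B="2 * 1 + 2 * a"])
    interpret \<nu>: prob_space \<nu> using symmetric_distributionD[OF \<nu>] by simp
    note [measurable_cong] = symmetric_distributionD(2)[OF \<nu>]
    show "(\<lambda>u. \<integral>y. kern 1 a u (?t * \<bar>tau y\<bar>) \<partial>\<nu>) \<in> borel_measurable borel"
      by measurable
    show "\<bar>\<integral>y. kern 1 a \<bar>tau r\<bar> (?t * \<bar>tau y\<bar>) \<partial>\<nu>\<bar> \<le> 2 * 1 + 2 * a" for r
    proof (rule symmetric_integral_bound[OF \<nu>])
      show "\<bar>kern 1 a \<bar>tau r\<bar> (?t * \<bar>tau y\<bar>)\<bar> \<le> 2 * 1 + 2 * a" for y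
        by (rule kB[OF _ t]) (simp add: abs_tau_le_1)
    qed measurable
  qed
  finally show ?thesis .
qed

lemma kern_integrable:
  assumes \<mu>: "symmetric_distribution \<mu>" and \<nu>: "symmetric_distribution \<nu>"
  shows "integrable \<nu> (\<lambda>y. kern t a (s * u) (s * \<bar>tau y\<bar>))"
    "integrable \<mu> (\<lambda>x. \<integral>y. kern t a (s * \<bar>tau x\<bar>) (s * \<bar>tau y\<bar>) \<partial>\<nu>)"
proof -
  have c: "continuous_on ({0..1} \<times> {0..1}) (\<lambda>p :: real \<times> real. kern t a (s * snd p) (s * fst p))"
    by (intro continuous_intros)
  show "integrable \<nu> (\<lambda>y. kern t a (s * u) (s * \<bar>tau y\<bar>))"
    by (rule continuous_abs_tau_integrable[OF \<nu>, where h="\<lambda>v. kern t a (s * u) (s * v)"]) (intro continuous_intros)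
  show "integrable \<mu> (\<lambda>x. \<integral>y. kern t a (s * \<bar>tau x\<bar>) (s * \<bar>tau y\<bar>) \<partial>\<nu>)"
    by (rule continuous_abs_tau_integrable[OF \<mu> continuous_integral_abs_tau[OF \<nu> c]])
qed

lemma mag_gap_eq:
  assumes \<mu>: "symmetric_distribution \<mu>" and \<nu>: "symmetric_distribution \<nu>" and e: "0 \<le> e" "e \<le> 1" and a: "0 \<le> a"
  shows "mag (noise e \<mu> \<star>\<star> noise e \<nu>) a - mag (noise e (\<mu> \<star>\<star> \<nu>)) a =
    (\<integral>x. \<integral>y. kern 1 a (\<bar>1 - 2 * e\<bar> * \<bar>tau x\<bar>) (\<bar>1 - 2 * e\<bar> * \<bar>tau y\<bar>) - kern \<bar>1 - 2 * e\<bar> a \<bar>tau x\<bar> \<bar>tau y\<bar> \<partial>\<nu> \<partial>\<mu>)"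
  unfolding mag_noise_of_iconv[OF assms] mag_iconv_of_noise[OF assms]
  using kern_integrable[OF \<mu> \<nu>, of 1 a "\<bar>1 - 2 * e\<bar>"] kern_integrable[OF \<mu> \<nu>, of "\<bar>1 - 2 * e\<bar>" a 1]
  by simp

text \<open>The stringy tree inequality: noise on a common edge loses at least as much as
  independent noise on each branch. It holds for each pair of values, by
  \<open>kern_noise_le\<close>.\<close>

lemma deg_noise_iconv:
  assumes \<mu>: "symmetric_distribution \<mu>" and \<nu>: "symmetric_distribution \<nu>" and e: "0 \<le> e" "e \<le> 1"
  shows "noise e (\<mu> \<star>\<star> \<nu>) \<preceq> noise e \<mu> \<star>\<star> noise e \<nu>"
  unfolding deg_def
proof
  fix a :: real assume "a \<in> {0..1}"
  then have a: "0 \<le> a" by simp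
  have "0 \<le> mag (noise e \<mu> \<star>\<star> noise e \<nu>) a - mag (noise e (\<mu> \<star>\<star> \<nu>)) a"
    unfolding mag_gap_eq[OF assms a]
  proof (intro Bochner_Integration.integral_nonneg)
    fix x y
    have "kern \<bar>1 - 2 * e\<bar> a \<bar>tau x\<bar> \<bar>tau y\<bar> \<le> kern 1 a (\<bar>1 - 2 * e\<bar> * \<bar>tau x\<bar>) (\<bar>1 - 2 * e\<bar> * \<bar>tau y\<bar>)"
      using e a by (intro kern_noise_le) (auto simp: abs_tau_le_1)
    then show "0 \<le> kern 1 a (\<bar>1 - 2 * e\<bar> * \<bar>tau x\<bar>) (\<bar>1 - 2 * e\<bar> * \<bar>tau y\<bar>) - kern \<bar>1 - 2 * e\<bar> a \<bar>tau x\<bar> \<bar>tau y\<bar>" by simp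
  qed
  then show "mag (noise e (\<mu> \<star>\<star> \<nu>)) a \<le> mag (noise e \<mu> \<star>\<star> noise e \<nu>) a" by simp
qed

text \<open>If both alternatives failed, \<open>kern_noise_less\<close> would give a positive gap at
  the pair of support points, and hence a positive gap in the mean.\<close>

lemma noise_iconv_eq_imp:
  assumes \<mu>: "symmetric_distribution \<mu>" and \<nu>: "symmetric_distribution \<nu>" and e: "0 \<le> e" "e < 1 / 2" and e0: "0 < e" and C: "0 \<le> C"
    and eq: "mag (noise e (\<mu> \<star>\<star> \<nu>)) C = mag (noise e \<mu> \<star>\<star> noise e \<nu>) C"
    and x: "insupp \<mu> x" "0 < x" and y: "insupp \<nu> y" "0 < y"
  defines "\<theta> \<equiv> 1 - 2 * e"
  shows "C * (1 - \<theta> * x * (\<theta> * y)) \<le> \<theta> * \<bar>x - y\<bar> \<or> \<theta> * (x + y) \<le> C * (1 + \<theta> * x * (\<theta> * y))"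
proof (rule ccontr)
  assume "\<not> ?thesis"
  then have n: "\<theta> * \<bar>x - y\<bar> < C * (1 - \<theta> * x * (\<theta> * y))" "C * (1 + \<theta> * x * (\<theta> * y)) < \<theta> * (x + y)"
    by auto
  have \<theta>: "0 < \<theta>" "\<theta> < 1" and t: "\<bar>1 - 2 * e\<bar> = \<theta>" using e e0 by (auto simp: \<theta>_def)
  have e': "0 \<le> e" "e \<le> 1" using e by auto
  have "0 < C"
    using n(1) C \<theta> by (metis abs_ge_zero less_eq_real_def mult_eq_0_iff mult_nonneg_nonneg not_less)
  define f where "f r s = kern 1 C (\<theta> * s) (\<theta> * r) - kern \<theta> C s r" for r s
  have "0 < (\<integral>s. \<integral>r. f \<bar>tau r\<bar> \<bar>tau s\<bar> \<partial>\<nu> \<partial>\<mu>)"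
  proof (rule insuppD2[OF \<nu> y(1) x(1)])
    show "continuous_on ({0..1} \<times> {0..1}) (\<lambda>p. f (fst p) (snd p))"
      unfolding f_def by (intro continuous_intros)
    show "0 \<le> f s t" if "0 \<le> s" "s \<le> 1" "0 \<le> t" "t \<le> 1" for s t
      using kern_noise_le[of t s \<theta> C] that \<theta> C by (simp add: f_def)
    show "0 < f y x"
      using kern_noise_less[OF x(2) insupp_bounds(2)[OF x(1)] y(2) insupp_bounds(2)[OF y(1)] \<theta> n \<open>0 < C\<close>] by (simp add: f_def)
  qed
  also have "\<dots> = mag (noise e \<mu> \<star>\<star> noise e \<nu>) C - mag (noise e (\<mu> \<star>\<star> \<nu>)) C"
    unfolding mag_gap_eq[OF \<mu> \<nu> e' C] t f_def ..
  finally show False using eq by simp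
qed

lemma deg_noise_self:
  assumes \<mu>: "symmetric_distribution \<mu>" and e: "0 \<le> e" "e \<le> 1"
  shows "noise e \<mu> \<preceq> \<mu>"
  unfolding deg_def
proof
  fix a :: real assume "a \<in> {0..1}"
  have le: "\<bar>1 - 2 * e\<bar> * \<bar>tau r\<bar> \<le> \<bar>tau r\<bar>" for r using e by (intro mult_left_le_one_le) auto
  have "integrable \<mu> (\<lambda>r. max (\<bar>1 - 2 * e\<bar> * \<bar>tau r\<bar>) a)"
    by (rule continuous_abs_tau_integrable[OF \<mu>, where h="\<lambda>u. max (\<bar>1 - 2 * e\<bar> * u) a"]) (intro continuous_intros)
  then have "(\<integral>r. max (\<bar>1 - 2 * e\<bar> * \<bar>tau r\<bar>) a \<partial>\<mu>) \<le> (\<integral>r. max \<bar>tau r\<bar> a \<partial>\<mu>)"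
    using mag_integrable[OF \<mu>] le by (intro integral_mono) (auto intro: max.coboundedI1)
  then show "mag (noise e \<mu>) a \<le> mag \<mu> a"
    unfolding mag_noise_eq[OF assms] by (simp only: mag_def)
qed

lemma deg_noise_iconv_pow:
  assumes \<mu>: "symmetric_distribution \<mu>" and X: "symmetric_distribution X" and e: "0 \<le> e" "e \<le> 1"
  shows "noise e (iconv_pow \<mu> k X) \<preceq> iconv_pow (noise e \<mu>) k (noise e X)"
proof (induction k)
  case (Suc k)
  note s = symmetric_iconv_pow symmetric_noise \<mu> X e
  have "noise e (iconv_pow \<mu> (Suc k) X) \<preceq> noise e \<mu> \<star>\<star> noise e (iconv_pow \<mu> k X)"
    unfolding iconv_pow.simps by (rule deg_noise_iconv[OF \<mu> symmetric_iconv_pow[OF \<mu> X] e])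
  also have "\<dots> \<preceq> noise e \<mu> \<star>\<star> iconv_pow (noise e \<mu>) k (noise e X)"
    by (rule deg_iconv[OF _ _ _ _ deg_refl Suc.IH]) (intro s)+
  finally show ?case by simp
qed simp

lemma mag_noise_bp:
  assumes \<mu>: "symmetric_distribution \<mu>" and S: "symmetric_distribution S" and e: "0 \<le> e" "e \<le> 1" and \<delta>: "0 \<le> \<delta>" "\<delta> \<le> 1"
  shows "mag (noise e (bp_operator \<delta> P S \<mu>)) a = (\<integral>d. mag (noise e (iconv_pow (noise \<delta> \<mu>) d S)) a \<partial>measure_pmf P)"
proof -
  note s = symmetric_bp_operator[OF \<mu> S \<delta>, of P] symmetric_iconv_pow[OF symmetric_noise[OF \<mu> \<delta>] S]
  show ?thesis
    unfolding mag_noise_eq[OF s(1) e] mag_noise_eq[OF s(2) e]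
  proof (rule integral_bp_operator[OF symmetric_distributionD(1,2)[OF \<mu>] symmetric_distributionD(1,2)[OF S], where B="1 + \<bar>a\<bar>"])
    fix r
    have "\<bar>1 - 2 * e\<bar> * \<bar>tau r\<bar> \<le> 1" using abs_tau_le_1[of r] e by (intro mult_le_one) auto
    then show "\<bar>max (\<bar>1 - 2 * e\<bar> * \<bar>tau r\<bar>) a\<bar> \<le> 1 + \<bar>a\<bar>"
      using mult_nonneg_nonneg[of "\<bar>1 - 2 * e\<bar>" "\<bar>tau r\<bar>"] by linarith
  qed measurable
qed

text \<open>The noise is pushed from the root to the d children, where it commutes with the edge
  noise, and dropped at the survey, which can only improve the law.\<close>

lemma deg_noise_bp:
  assumes \<mu>: "symmetric_distribution \<mu>" and S: "symmetric_distribution S" and e: "0 \<le> e" "e \<le> 1" and \<delta>: "0 \<le> \<delta>" "\<delta> \<le> 1"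
  shows "noise e (bp_operator \<delta> P S \<mu>) \<preceq> bp_operator \<delta> P S (noise e \<mu>)"
proof -
  note n = symmetric_noise[OF \<mu> \<delta>] and ne = symmetric_noise[OF \<mu> e]
  note s1 = symmetric_noise[OF symmetric_iconv_pow[OF n S] e] and s2 = symmetric_iconv_pow[OF symmetric_noise[OF ne \<delta>] S]
  have "noise e (iconv_pow (noise \<delta> \<mu>) d S) \<preceq> iconv_pow (noise \<delta> (noise e \<mu>)) d S" for d
  proof -
    have "noise e (iconv_pow (noise \<delta> \<mu>) d S) \<preceq> iconv_pow (noise e (noise \<delta> \<mu>)) d (noise e S)"
      by (rule deg_noise_iconv_pow[OF n S e])
    also have "\<dots> \<preceq> iconv_pow (noise e (noise \<delta> \<mu>)) d S"
      by (rule deg_iconv_pow[OF _ _ _ _ deg_refl deg_noise_self[OF S e]]) (intro symmetric_noise \<mu> \<delta> e S)+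
    finally show ?thesis by (simp add: noise_commute[OF \<mu> \<delta> e])
  qed
  then have le: "mag (noise e (iconv_pow (noise \<delta> \<mu>) d S)) a \<le> mag (iconv_pow (noise \<delta> (noise e \<mu>)) d S) a" if "a \<in> {0..1}" for d a
    using that unfolding deg_def by blast
  show ?thesis
    unfolding deg_def mag_noise_bp[OF assms] mag_bp_operator[OF ne S]
    by (intro ballI integral_mono mag_pmf_integrable[OF s1, where P=P] mag_pmf_integrable[OF s2, where P=P] le)
qed

lemma vadd_mono:
  assumes "0 \<le> x" "x \<le> X" "X \<le> 1" "0 \<le> y" "y \<le> Y" "Y \<le> 1"
  shows "vadd x y \<le> vadd X Y"
  using vadd_abs_le[of x X y Y] assms by (subst vadd_le_iff(1)) auto

text \<open>The difference equals \<theta> (1 - \<theta>^2) x y (x + y) divided by (1 + \<theta>^2 x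
  y)(1 + x y), and this denominator is at most 4. The lower bound y0 makes the gap uniform in y,
  later in the degree.\<close>

lemma scaled_vadd_gap:
  assumes xy: "0 \<le> x" "x \<le> 1" "0 \<le> y0" "y0 \<le> y" "y \<le> 1" and \<theta>: "0 \<le> \<theta>" "\<theta> \<le> 1"
  shows "\<theta> * (1 - \<theta> * \<theta>) * (x * y0) * (x + y0) / 4 \<le> vadd (\<theta> * x) (\<theta> * y) - \<theta> * vadd x y"
proof -
  let ?A = "1 + \<theta> * x * (\<theta> * y)" and ?B = "1 + x * y"
  have y: "0 \<le> y" using xy by simp
  have p: "0 < ?A" "0 < ?B" using xy y \<theta> by (simp_all add: add_pos_nonneg)
  have tt: "\<theta> * \<theta> \<le> 1" using \<theta> by (simp add: mult_le_one)
  have "x * y \<le> 1" "\<theta> * x * (\<theta> * y) \<le> 1"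
    using xy y \<theta> by (auto intro!: mult_le_one)
  then have AB: "?A * ?B \<le> 2 * 2" using p by (intro mult_mono) auto
  have "\<theta> * (1 - \<theta> * \<theta>) * (x * y0) * (x + y0) / 4 \<le> \<theta> * (1 - \<theta> * \<theta>) * (x * y) * (x + y) / 4"
    using xy y \<theta> tt by (intro divide_right_mono mult_mono mult_left_mono mult_nonneg_nonneg add_nonneg_nonneg) auto
  also have "\<dots> \<le> \<theta> * (1 - \<theta> * \<theta>) * (x * y) * (x + y) / (?A * ?B)"
    using xy y \<theta> tt p AB by (intro divide_left_mono mult_nonneg_nonneg mult_pos_pos add_nonneg_nonneg) auto
  also have "\<dots> = vadd (\<theta> * x) (\<theta> * y) - \<theta> * vadd x y"
    using p by (simp add: vadd_def diff_frac_eq) (simp add: algebra_simps)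
  finally show ?thesis .
qed

text \<open>The noise \<open>e\<close> is moved from the root of the star with \<open>n\<close> children and survey \<open>S\<close> to the children, one
  child at a time, and finally removed from the survey. If the two ends of this chain agree at \<open>a\<close>, so do all
  its members; \<open>v m\<close> is the top of the support of the part whose noise is still joint, and \<open>C a k\<close> that of the
  part already split off, together with \<open>a\<close>. The conditions for equality at these tops are contradictory,
  unless already the first child dominates the rest, in which case equality also holds at a point above \<open>a\<close>.\<close>

locale bp_pair =
  fixes \<delta> e :: real and P :: "nat pmf" and S \<mu> \<nu> :: "ereal measure"
  assumes \<delta>: "0 \<le> \<delta>" "\<delta> \<le> 1" and e: "0 < e" "e < 1 / 2"
    and S: "symmetric_distribution S" and \<mu>: "symmetric_distribution \<mu>" and \<nu>: "symmetric_distribution \<nu>"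
    and le: "noise e \<mu> \<preceq> \<nu>"
begin

definition \<theta> :: real where "\<theta> = 1 - 2 * e"
abbreviation \<rho> :: real where "\<rho> \<equiv> \<bar>1 - 2 * \<delta>\<bar>"
text \<open>A child with its own share of the noise e. The stars with m children are
  \<open>W m\<close> for \<mu>, before the noise e, and \<open>F m\<close> for \<nu>.\<close>

abbreviation T :: "ereal measure" where "T \<equiv> noise e (noise \<delta> \<mu>)"
abbreviation W :: "nat \<Rightarrow> ereal measure" where "W m \<equiv> iconv_pow (noise \<delta> \<mu>) m S"
abbreviation F :: "nat \<Rightarrow> ereal measure" where "F m \<equiv> iconv_pow (noise \<delta> \<nu>) m S"
text \<open>The tops of the supports of a child message before and after the noise e are x' and
  l.\<close>

definition x' :: real where "x' = \<rho> * mtop \<mu>"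
definition l :: real where "l = \<theta> * x'"

definition v :: "nat \<Rightarrow> real" where "v m = (vadd x' ^^ m) (mtop S)"
definition C :: "real \<Rightarrow> nat \<Rightarrow> real" where "C a k = (vadd l ^^ k) a"

lemma v_simps [simp]: "v 0 = mtop S" "v (Suc m) = vadd x' (v m)" by (simp_all add: v_def)
lemma C_simps [simp]: "C a 0 = a" "C a (Suc k) = vadd l (C a k)" by (simp_all add: C_def)

lemma e': "0 \<le> e" "e \<le> 1" using e by auto
lemma \<theta>: "0 < \<theta>" "\<theta> < 1" "\<bar>1 - 2 * e\<bar> = \<theta>" using e by (auto simp: \<theta>_def)

lemma sym: "symmetric_distribution (noise \<delta> \<mu>)" "symmetric_distribution (noise \<delta> \<nu>)"
  "symmetric_distribution T" "symmetric_distribution (W m)" "symmetric_distribution (F m)"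
  "symmetric_distribution (noise e (W m))" "symmetric_distribution (noise e \<mu>)" "symmetric_distribution (noise e S)"
  by (intro symmetric_iconv_pow symmetric_noise \<mu> \<nu> S \<delta> e')+

lemma T_eq: "T = noise \<delta> (noise e \<mu>)"
  by (rule noise_commute[OF \<mu> \<delta> e'])

lemma T_le: "T \<preceq> noise \<delta> \<nu>"
  unfolding T_eq by (rule deg_noise[OF sym(7) \<nu> \<delta> le])

lemma pow_T_le: "iconv_pow T k S \<preceq> F k"
  by (rule deg_iconv_pow[OF sym(3,2) S S T_le deg_refl])

lemma noise_W_le: "noise e (W (k + m)) \<preceq> iconv_pow T k (noise e (W m))"
  using deg_noise_iconv_pow[OF sym(1) sym(4) e', of k m] by (simp add: iconv_pow_add)

lemma noise_W_le_T: "noise e (W m) \<preceq> iconv_pow T m S"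
proof -
  have "noise e (W m) \<preceq> iconv_pow T m (noise e S)" using noise_W_le[of m 0] by simp
  also have "\<dots> \<preceq> iconv_pow T m S"
    by (rule deg_iconv_pow[OF sym(3,3,8) S deg_refl deg_noise_self[OF S e']])
  finally show ?thesis .
qed

lemma pow_T_noise_W_le: "iconv_pow T k (noise e (W m)) \<preceq> F (k + m)"
proof -
  have "iconv_pow T k (noise e (W m)) \<preceq> iconv_pow T k (iconv_pow T m S)"
    by (rule deg_iconv_pow[OF sym(3,3,6) symmetric_iconv_pow[OF sym(3) S] deg_refl noise_W_le_T])
  also have "\<dots> \<preceq> F (k + m)" unfolding iconv_pow_add by (rule pow_T_le)
  finally show ?thesis .
qed

lemma noise_W_le_F: "noise e (W m) \<preceq> F m"
  using pow_T_noise_W_le[of 0 m] by simp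

lemma mag_squeeze:
  assumes "X \<preceq> Y" "Y \<preceq> Z" "0 \<le> a" "a \<le> 1" "mag X a = mag Z a"
  shows "mag Y a = mag Z a"
  using degD[OF assms(1,3,4)] degD[OF assms(2,3,4)] assms(5) by simp

lemma squeeze:
  assumes "0 \<le> a" "a \<le> 1" "mag (noise e (W (k + m))) a = mag (F (k + m)) a"
  shows "mag (iconv_pow T k (noise e (W m))) a = mag (F (k + m)) a"
  by (rule mag_squeeze[OF noise_W_le pow_T_noise_W_le assms])

lemma insupp_x': "insupp (noise \<delta> \<mu>) x'"
  using insupp_noise[OF \<mu> \<delta> insupp_mtop[OF \<mu>]] by (simp add: x'_def)

lemma insupp_l: "insupp T l"
  using insupp_noise[OF sym(1) e' insupp_x'] by (simp add: \<theta>(3) l_def)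

lemma insupp_C: "0 \<le> a \<Longrightarrow> a \<le> 1 \<Longrightarrow> insupp (iconv_pow T k (bsc a)) (C a k)"
proof (induction k)
  case (Suc k)
  from insupp_iconv[OF sym(3) symmetric_iconv_pow[OF sym(3) symmetric_bsc[OF Suc.prems]] insupp_l Suc.IH[OF Suc.prems]]
  show ?case by simp
qed (simp add: insupp_bsc)

lemma insupp_v: "insupp (W m) (v m)"
proof (induction m)
  case (Suc m)
  from insupp_iconv[OF sym(1) sym(4) insupp_x' Suc.IH]
  show ?case by simp
qed (simp add: insupp_mtop[OF S])

lemma x'_bounds: "0 \<le> x'" "x' \<le> 1"
  using insupp_bounds[OF insupp_x'] by auto

lemma l_bounds: "0 \<le> l" "l < 1" "l \<le> \<theta>"
proof -
  show 1: "0 \<le> l" using \<theta> x'_bounds by (simp add: l_def)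
  show 2: "l \<le> \<theta>" using \<theta> x'_bounds mult_left_le[of x' \<theta>] by (simp add: l_def)
  show "l < 1" by (rule le_less_trans[OF 2 \<theta>(2)])
qed

lemma mtop_W_le: "mtop (W m) \<le> v m"
proof (induction m)
  case (Suc m)
  have "mtop (W (Suc m)) \<le> vadd (mtop (noise \<delta> \<mu>)) (mtop (W m))"
    by (simp add: mtop_iconv_le[OF sym(1) sym(4)])
  also have "\<dots> \<le> vadd x' (v m)"
    using mtop_noise_le[OF \<mu> \<delta>, folded x'_def] Suc.IH mtop_bounds[OF sym(1)] mtop_bounds[OF sym(4)] x'_bounds insupp_bounds[OF insupp_v]
    by (intro vadd_mono)
  finally show ?case by simp
qed simp

lemma v_mono: "m \<le> n \<Longrightarrow> v m \<le> v n"
proof (rule lift_Suc_mono_le[of v])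
  show "v n \<le> v (Suc n)" for n using vadd_bounds(4)[OF x'_bounds insupp_bounds[OF insupp_v]] by simp
qed

text \<open>Compares the members with k and k + 1 children split off. The k split ones form the law
  of the parameter, with \<open>C a k\<close> in its support, so equality holds there for a single
  convolution and \<open>noise_iconv_eq_imp\<close> applies at the tops.\<close>

lemma equality_pair:
  assumes a: "0 \<le> a" "a \<le> 1" and eq: "mag (noise e (W (k + Suc m))) a = mag (F (k + Suc m)) a"
    and x: "0 < x'" and v: "0 < v m"
  shows "C a k * (1 - l * (\<theta> * v m)) \<le> \<theta> * \<bar>x' - v m\<bar> \<or> l + \<theta> * v m \<le> C a k * (1 + l * (\<theta> * v m))"
proof -
  let ?X = "noise e (W (Suc m))" and ?Y = "T \<star>\<star> noise e (W m)"
  have Y: "symmetric_distribution ?Y" by (rule symmetric_iconv[OF sym(3,6)])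
  have XY: "?X \<preceq> ?Y" using deg_noise_iconv[OF sym(1) sym(4) e'] by simp
  have "iconv_pow T k ?Y = iconv_pow T (Suc k) (noise e (W m))"
    using iconv_pow_add[of T k 1 "noise e (W m)"] by simp
  then have "mag (iconv_pow T k ?X) a = mag (iconv_pow T k ?Y) a"
    using squeeze[OF a eq] squeeze[of a "Suc k" m] a eq by simp
  then have "mag ?X (C a k) = mag ?Y (C a k)"
    unfolding mag_iconv_pow[OF sym(3) sym(6) a] mag_iconv_pow[OF sym(3) Y a]
    by (rule mag_eq_at_insupp[OF sym(6) Y XY symmetric_iconv_pow[OF sym(3) symmetric_bsc[OF a]] insupp_C[OF a]])
  then have "C a k * (1 - \<theta> * x' * (\<theta> * v m)) \<le> \<theta> * \<bar>x' - v m\<bar> \<or> \<theta> * (x' + v m) \<le> C a k * (1 + \<theta> * x' * (\<theta> * v m))"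
    by (intro noise_iconv_eq_imp[OF sym(1) sym(4) e'(1) e(2,1) insupp_bounds(1)[OF insupp_C[OF a]] _
          insupp_x' x insupp_v v, folded \<theta>_def]) simp
  then show ?thesis by (simp add: distrib_left l_def)
qed

text \<open>Exchanging one child T for \<open>noise \<delta> \<nu>\<close> stays inside the chain.
  The rest of the star together with a is a parameter law with c in its support, so the two children
  agree at c; undoing the noise \<delta> divides c by \<rho>.\<close>

lemma equality_shift:
  assumes a: "0 \<le> a" "a \<le> 1" and eq: "mag (noise e (W (Suc m))) a = mag (F (Suc m)) a" and "\<delta> \<noteq> 1 / 2"
  defines "c \<equiv> vadd (\<theta> * v m) a"
  shows "mag (noise e \<mu>) (c / \<rho>) = mag \<nu> (c / \<rho>)"
proof -
  let ?X = "noise e (W m)"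
  have eq': "mag (noise e (W (1 + m))) a = mag (F (1 + m)) a" using eq by simp
  have 1: "mag (T \<star>\<star> ?X) a = mag (F (Suc m)) a" using squeeze[OF a eq'] by simp
  have "noise \<delta> \<nu> \<star>\<star> ?X \<preceq> F (Suc m)"
    unfolding iconv_pow.simps by (rule deg_iconv[OF sym(2,2,6,5) deg_refl noise_W_le_F])
  moreover have "T \<star>\<star> ?X \<preceq> noise \<delta> \<nu> \<star>\<star> ?X"
    by (rule deg_iconv_left[OF sym(3,2,6) T_le])
  ultimately have "mag (T \<star>\<star> ?X) a = mag (noise \<delta> \<nu> \<star>\<star> ?X) a"
    using mag_squeeze[of "T \<star>\<star> ?X" "noise \<delta> \<nu> \<star>\<star> ?X" "F (Suc m)" a] a 1 by simp
  then have int_eq: "(\<integral>r. mag T \<bar>tau r\<bar> \<partial>(?X \<star>\<star> bsc a)) = (\<integral>r. mag (noise \<delta> \<nu>) \<bar>tau r\<bar> \<partial>(?X \<star>\<star> bsc a))"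
    unfolding mag_iconv[OF sym(3,6) a] mag_iconv[OF sym(2,6) a] .
  have "insupp (?X \<star>\<star> bsc a) c"
    using insupp_iconv[OF sym(6) symmetric_bsc[OF a] insupp_noise[OF sym(4) e' insupp_v] insupp_bsc[OF a]]
    by (simp add: c_def \<theta>)
  from mag_eq_at_insupp[OF sym(3,2) T_le symmetric_iconv[OF sym(6) symmetric_bsc[OF a]] this int_eq]
  have "mag T c = mag (noise \<delta> \<nu>) c" .
  moreover have "0 \<le> c"
    unfolding c_def vadd_def using a \<theta> insupp_bounds[OF insupp_v] by simp
  ultimately show ?thesis
    unfolding T_eq using \<open>\<delta> \<noteq> 1 / 2\<close> by (simp add: mag_noise[OF sym(7) \<delta>] mag_noise[OF \<nu> \<delta>])
qed

text \<open>The last link removes the noise from the survey, and below the top of S this strictly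
  increases \<open>mag\<close>.\<close>

lemma equality_survey:
  assumes a: "0 \<le> a" "a \<le> 1" and eq: "mag (noise e (W n)) a = mag (F n) a"
  shows "mtop S \<le> C a n"
proof (rule ccontr)
  assume "\<not> ?thesis"
  then have less: "C a n < mtop S" by simp
  have C0: "0 \<le> C a n" by (rule insupp_bounds(1)[OF insupp_C[OF a]])
  have eq': "mag (noise e (W (n + 0))) a = mag (F (n + 0)) a" using eq by simp
  have "iconv_pow T n (noise e S) \<preceq> iconv_pow T n S"
    by (rule deg_iconv_pow[OF sym(3,3,8) S deg_refl deg_noise_self[OF S e']])
  from mag_squeeze[OF this pow_T_le a] squeeze[OF a eq']
  have "mag (iconv_pow T n (noise e S)) a = mag (iconv_pow T n S) a" by simp
  then have "mag (noise e S) (C a n) = mag S (C a n)"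
    unfolding mag_iconv_pow[OF sym(3,8) a] mag_iconv_pow[OF sym(3) S a]
    by (rule mag_eq_at_insupp[OF sym(8) S deg_noise_self[OF S e'] symmetric_iconv_pow[OF sym(3) symmetric_bsc[OF a]] insupp_C[OF a]])
  then have eq0: "(\<integral>r. max (\<theta> * \<bar>tau r\<bar>) (C a n) \<partial>S) = (\<integral>r. max \<bar>tau r\<bar> (C a n) \<partial>S)"
    unfolding mag_noise_eq[OF S e'] \<theta>(3) by (simp only: mag_def)
  define h where "h u = max u (C a n) - max (\<theta> * u) (C a n)" for u
  have "0 < (\<integral>r. h \<bar>tau r\<bar> \<partial>S)"
  proof (rule insuppD[OF insupp_mtop[OF S]])
    show "continuous_on {0..1} h" unfolding h_def by (intro continuous_intros)
    show "0 \<le> h t" if "0 \<le> t" "t \<le> 1" for t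
    proof -
      have "\<theta> * t \<le> t" using that \<theta> by (intro mult_left_le_one_le) auto
      then show ?thesis by (simp add: h_def)
    qed
    have "\<theta> * mtop S < 1 * mtop S" using less C0 \<theta> by (intro mult_strict_right_mono) auto
    then show "0 < h (mtop S)" using less by (simp add: h_def)
  qed
  also have "(\<integral>r. h \<bar>tau r\<bar> \<partial>S) = (\<integral>r. max \<bar>tau r\<bar> (C a n) \<partial>S) - (\<integral>r. max (\<theta> * \<bar>tau r\<bar>) (C a n) \<partial>S)"
    unfolding h_def
    by (rule Bochner_Integration.integral_diff[OF mag_integrable[OF S]],
        rule continuous_abs_tau_integrable[OF S, where h="\<lambda>u. max (\<theta> * u) (C a n)"], intro continuous_intros)
  finally show False using eq0 by simp
qed

text \<open>The bound on \<open>C a k\<close> excludes the second alternative of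
  \<open>equality_pair\<close>. The first one, with v m the larger top, rearranges to
  \<open>vadd l (C a k) \<le> \<theta> * v m\<close>.\<close>

lemma next_C_le:
  assumes a: "0 \<le> a" "a \<le> 1" and eq: "mag (noise e (W (k + Suc m))) a = mag (F (k + Suc m)) a"
    and x: "0 < x'" and v: "0 < v m" and less: "C a k < vadd l (\<theta> * v m)" and "x' < v m"
  shows "C a (Suc k) \<le> \<theta> * v m"
proof -
  have C0: "0 \<le> C a k" by (rule insupp_bounds(1)[OF insupp_C[OF a]])
  have "C a k * (1 + l * (\<theta> * v m)) < l + \<theta> * v m"
    using less l_bounds v \<theta> by (subst (asm) vadd_le_iff) auto
  then have "C a k * (1 - l * (\<theta> * v m)) \<le> \<theta> * \<bar>x' - v m\<bar>" using equality_pair[OF a eq x v] by auto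
  also have "\<dots> = \<theta> * v m - l" using \<open>x' < v m\<close> by (simp add: l_def algebra_simps)
  finally show ?thesis
    using l_bounds C0 by (simp add: vadd_le_iff algebra_simps)
qed

text \<open>The same dichotomy when the child is at least as strong as the rest.\<close>

lemma small_v_bound:
  assumes a: "0 \<le> a" "a \<le> 1" and eq: "mag (noise e (W (k + Suc m))) a = mag (F (k + Suc m)) a"
    and x: "0 < x'" and v: "0 < v m" and less: "C a k < vadd l (\<theta> * v m)" and "v m \<le> x'"
  shows "C a k * (1 - l * (\<theta> * v m)) \<le> l - \<theta> * v m"
proof -
  have "C a k * (1 + l * (\<theta> * v m)) < l + \<theta> * v m"
    using less l_bounds v \<theta> by (subst (asm) vadd_le_iff) auto
  then have "C a k * (1 - l * (\<theta> * v m)) \<le> \<theta> * \<bar>x' - v m\<bar>" using equality_pair[OF a eq x v] by auto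
  also have "\<dots> = l - \<theta> * v m" using \<open>v m \<le> x'\<close> by (simp add: l_def algebra_simps)
  finally show ?thesis .
qed

text \<open>End of the descent: by \<open>equality_survey\<close> the positive top of S would be at
  most \<theta> times itself.\<close>

lemma equality_survey_step:
  assumes a: "0 \<le> a" "a \<le> 1" and eq: "mag (noise e (W (Suc k))) a = mag (F (Suc k)) a" and v: "0 < mtop S" and "C a (Suc k) \<le> \<theta> * v 0"
  shows False
proof -
  have "mtop S \<le> \<theta> * mtop S" using equality_survey[OF a eq] assms(5) by simp
  also have "\<dots> < 1 * mtop S" using v \<theta> by (intro mult_strict_right_mono) auto
  finally show False by simp
qed

text \<open>Restores the hypothesis of \<open>next_C_le\<close> after one more child has been split
  off.\<close>

lemma vadd_scaled_less: "0 < x' \<Longrightarrow> 0 < v m \<Longrightarrow> \<theta> * v (Suc m) < vadd l (\<theta> * v m)"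
proof -
  assume x: "0 < x'" and v: "0 < v m"
  have "\<theta> * \<theta> < 1 * 1" using \<theta> by (intro mult_strict_mono) auto
  then have "0 < \<theta> * (1 - \<theta> * \<theta>) * (x' * v m) * (x' + v m) / 4"
    using x v \<theta> by (intro divide_pos_pos mult_pos_pos add_pos_pos) auto
  also have "\<dots> \<le> vadd (\<theta> * x') (\<theta> * v m) - \<theta> * vadd x' (v m)"
    using x'_bounds insupp_bounds[OF insupp_v] \<theta> by (intro scaled_vadd_gap) auto
  finally show ?thesis by (simp add: l_def)
qed

lemma v_pos_if_less: "x' < v (Suc m) \<Longrightarrow> 0 < v m"
  using insupp_bounds[OF insupp_v, of m] by (cases "v m = 0") auto

text \<open>Once a child has been split off, \<open>C a (Suc k)\<close> is at least l. If the next
  child dominated, \<open>small_v_bound\<close> would give \<theta> v m \<le> l^2 \<theta> v m,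
  although l < 1.\<close>

lemma less_v_deep:
  assumes a: "0 \<le> a" "a \<le> 1" and eq: "mag (noise e (W (Suc k + Suc m))) a = mag (F (Suc k + Suc m)) a"
    and x: "0 < x'" and v: "0 < v m" and less: "C a (Suc k) < vadd l (\<theta> * v m)"
  shows "x' < v m"
proof (rule ccontr)
  assume "\<not> x' < v m"
  then have "v m \<le> x'" by simp
  note small = small_v_bound[OF a eq x v less this]
  have "l \<le> C a (Suc k)"
    using vadd_bounds(3)[OF l_bounds(1) less_imp_le[OF l_bounds(2)] insupp_bounds[OF insupp_C[OF a]], of k] by simp
  moreover have lv: "l * (\<theta> * v m) < \<theta> * v m" "\<theta> * v m \<le> 1"
    using l_bounds v \<theta> insupp_bounds[OF insupp_v, of m] by (auto intro: mult_le_one)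
  ultimately have "l * (1 - l * (\<theta> * v m)) \<le> l - \<theta> * v m"
    using small mult_right_mono[of l "C a (Suc k)" "1 - l * (\<theta> * v m)"] by linarith
  then have "\<theta> * v m \<le> l * (l * (\<theta> * v m))" by (simp add: algebra_simps)
  also have "\<dots> \<le> 1 * (l * (\<theta> * v m))" using l_bounds v \<theta> by (intro mult_right_mono) auto
  finally show False using lv by simp
qed

text \<open>Descent on m: each step splits off one more child and keeps the bound on
  \<open>C\<close>, until only the survey is left and equality is impossible.\<close>

lemma no_equality_deep:
  assumes a: "0 \<le> a" "a \<le> 1" and x: "0 < x'"
  shows "mag (noise e (W (Suc k + Suc m))) a = mag (F (Suc k + Suc m)) a \<Longrightarrow> 0 < v m \<Longrightarrow>
    C a (Suc k) < vadd l (\<theta> * v m) \<Longrightarrow> False"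
proof (induction m arbitrary: k)
  case (0 k)
  have big: "x' < v 0" by (rule less_v_deep[OF a 0(1) x 0(2,3)])
  from next_C_le[OF a 0(1) x 0(2,3) big] show False
    using equality_survey_step[OF a, of "Suc k"] 0(1,2) by simp
next
  case (Suc m k)
  note IH = Suc.prems
  have big: "x' < v (Suc m)" by (rule less_v_deep[OF a IH(1) x IH(2,3)])
  have vm: "0 < v m" by (rule v_pos_if_less[OF big])
  have "C a (Suc (Suc k)) \<le> \<theta> * v (Suc m)" by (rule next_C_le[OF a IH(1) x IH(2,3) big])
  also have "\<dots> < vadd l (\<theta> * v m)" by (rule vadd_scaled_less[OF x vm])
  finally show False using Suc.IH[of "Suc k"] IH(1) vm by simp
qed

text \<open>If v m > x', the descent starts. Otherwise \<open>small_v_bound\<close> says that vadd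
  (\<theta> v m) a is at most l, and \<open>equality_shift\<close> moves the equality to this point
  divided by \<rho>; since l / \<rho> = \<theta> * mtop \<mu>, the new point stays in the
  interval.\<close>

lemma equality_grows:
  assumes a: "0 \<le> a" "a \<le> \<theta> * mtop \<mu>" and eq: "mag (noise e (W (Suc m))) a = mag (F (Suc m)) a"
    and x: "0 < x'" and v: "0 < v m" and less: "a < vadd l (\<theta> * v m)"
  shows "\<exists>a'. a < a' \<and> a' \<le> \<theta> * mtop \<mu> \<and> mag (noise e \<mu>) a' = mag \<nu> a'"
proof -
  have tM: "\<theta> * mtop \<mu> < 1"
    using mtop_bounds[OF \<mu>] \<theta> by (intro le_less_trans[OF mult_left_le]) auto
  then have a1: "a < 1" "a \<le> 1" using a by auto
  note a' = a(1) a1(2)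
  have eq': "mag (noise e (W (0 + Suc m))) a = mag (F (0 + Suc m)) a" using eq by simp
  have less': "C a 0 < vadd l (\<theta> * v m)" using less by simp
  have "\<not> x' < v m"
  proof
    assume big: "x' < v m"
    note C1 = next_C_le[OF a' eq' x v less' big]
    show False
    proof (cases m)
      case 0
      with C1 equality_survey_step[OF a', of 0] eq v show False by simp
    next
      case (Suc m')
      then have vm: "0 < v m'" using v_pos_if_less[of m'] big by simp
      have "C a (Suc 0) \<le> \<theta> * v (Suc m')" using C1 Suc by simp
      also have "\<dots> < vadd l (\<theta> * v m')" by (rule vadd_scaled_less[OF x vm])
      finally show False using no_equality_deep[OF a' x, of 0 m'] eq Suc vm by simp
    qed
  qed
  then have "a * (1 - l * (\<theta> * v m)) \<le> l - \<theta> * v m"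
    using small_v_bound[OF a' eq' x v less'] by simp
  then have "\<theta> * v m + a \<le> l * (1 + \<theta> * v m * a)" by (simp add: algebra_simps)
  moreover have tv: "0 < \<theta> * v m" using \<theta> v by simp
  ultimately have c_le: "vadd (\<theta> * v m) a \<le> l" using a by (simp add: vadd_le_iff)
  have \<rho>: "0 < \<rho>" "\<rho> \<le> 1" using x mtop_bounds[OF \<mu>] \<delta> by (auto simp: x'_def zero_less_mult_iff)
  have "a * (\<theta> * v m * a) < \<theta> * v m"
  proof -
    have "a * a < 1" using a1 a(1) mult_strict_mono[of a 1 a 1] by simp
    then have "(a * a) * (\<theta> * v m) < 1 * (\<theta> * v m)" using tv by (intro mult_strict_right_mono)
    then show ?thesis by (simp add: mult_ac)
  qed
  then have "a < vadd (\<theta> * v m) a"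
    using tv a by (simp add: vadd_le_iff algebra_simps)
  also have "\<dots> \<le> vadd (\<theta> * v m) a / \<rho>"
    using \<rho> c_le \<open>a < vadd (\<theta> * v m) a\<close> a by (simp add: pos_le_divide_eq mult_left_le)
  finally have "a < vadd (\<theta> * v m) a / \<rho>" .
  moreover have "vadd (\<theta> * v m) a / \<rho> \<le> \<theta> * mtop \<mu>"
    using c_le \<rho> by (simp add: pos_divide_le_eq l_def x'_def mult_ac)
  moreover have "mag (noise e \<mu>) (vadd (\<theta> * v m) a / \<rho>) = mag \<nu> (vadd (\<theta> * v m) a / \<rho>)"
    using \<rho> by (intro equality_shift[OF a' eq]) auto
  ultimately show ?thesis by blast
qed

text \<open>Both sides are averages over the degree and are ordered degree by degree, so equal
  averages force equality at each degree of positive probability.\<close>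

lemma fixed_point_equality:
  assumes f\<mu>: "bp_operator \<delta> P S \<mu> = \<mu>" and f\<nu>: "bp_operator \<delta> P S \<nu> = \<nu>"
    and a: "0 \<le> a" "a \<le> 1" and eq: "mag (noise e \<mu>) a = mag \<nu> a" and n: "n \<in> set_pmf P"
  shows "mag (noise e (W n)) a = mag (F n) a"
proof -
  note i = mag_pmf_integrable[OF sym(6), where P=P and a=a] mag_pmf_integrable[OF sym(5), where P=P and a=a]
  have nn: "0 \<le> mag (F d) a - mag (noise e (W d)) a" for d using degD[OF noise_W_le_F a] by simp
  have "(\<integral>d. mag (F d) a - mag (noise e (W d)) a \<partial>measure_pmf P) = mag \<nu> a - mag (noise e \<mu>) a"
    using mag_noise_bp[OF \<mu> S e' \<delta>, of P a] mag_bp_operator[OF \<nu> S, of \<delta> P a] i by (simp add: f\<mu> f\<nu>)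
  then have "AE d in measure_pmf P. mag (F d) a - mag (noise e (W d)) a = 0"
    using eq i nn by (subst integral_nonneg_eq_0_iff_AE[symmetric]) auto
  then show ?thesis using n by (simp add: AE_measure_pmf_iff)
qed

text \<open>If all occurring degrees had their tops at or below z, the mixture would satisfy
  \<open>mag \<mu> z = z\<close>. With unbounded degrees the top itself may only be
  approached.\<close>

lemma mtop_approx:
  assumes f\<mu>: "bp_operator \<delta> P S \<mu> = \<mu>" and z: "0 \<le> z" "z < mtop \<mu>"
  shows "\<exists>n\<in>set_pmf P. z < v n"
proof (rule ccontr)
  assume "\<not> ?thesis"
  then have "mag (W n) z = z" if "n \<in> set_pmf P" for n
    using that mtop_W_le[of n] by (intro mag_ge_mtop[OF sym(4)]) force
  then have "(\<integral>n. mag (W n) z \<partial>measure_pmf P) = (\<integral>n. z \<partial>measure_pmf P)"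
    by (intro integral_cong_AE) (auto simp: AE_measure_pmf_iff)
  then have "mag \<mu> z = z" using mag_bp_operator[OF \<mu> S, of \<delta> P z] by (simp add: f\<mu>)
  with mag_less_mtop[OF \<mu> z] show False by simp
qed

text \<open>At the largest point b of equality some degree satisfies the hypotheses of
  \<open>equality_grows\<close>, which then produces a larger one.\<close>

lemma strict:
  assumes f\<mu>: "bp_operator \<delta> P S \<mu> = \<mu>" and f\<nu>: "bp_operator \<delta> P S \<nu> = \<nu>"
    and n0: "Suc m0 \<in> set_pmf P" "0 < v m0" and x: "0 < x'"
    and a: "0 \<le> a" "a \<le> \<theta> * mtop \<mu>"
  shows "mag (noise e \<mu>) a < mag \<nu> a"
proof (rule ccontr)
  have tM: "\<theta> * mtop \<mu> < 1"
    using mtop_bounds[OF \<mu>] \<theta> by (intro le_less_trans[OF mult_left_le]) auto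
  let ?E = "{a \<in> {0..\<theta> * mtop \<mu>}. mag (noise e \<mu>) a = mag \<nu> a}"
  assume "\<not> ?thesis"
  then have "a \<in> ?E" using degD[OF le, of a] a tM by auto
  moreover have "compact ?E"
  proof -
    have "closed {a. mag (noise e \<mu>) a = mag \<nu> a}"
      by (intro closed_Collect_eq mag_continuous sym \<nu>)
    moreover have "?E = {0..\<theta> * mtop \<mu>} \<inter> {a. mag (noise e \<mu>) a = mag \<nu> a}" by auto
    ultimately show ?thesis by (simp add: compact_Int_closed)
  qed
  ultimately obtain b where b: "b \<in> ?E" "\<And>c. c \<in> ?E \<Longrightarrow> c \<le> b"
    using compact_attains_sup[of ?E] by blast
  have b': "0 \<le> b" "b \<le> \<theta> * mtop \<mu>" "b \<le> 1" "mag (noise e \<mu>) b = mag \<nu> b" using b(1) tM by auto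
  \<comment> \<open>The gain from \<open>scaled_vadd_gap\<close> with y0 = v m0, hence valid for
    every m \<ge> m0.\<close>
  define c0 where "c0 = \<theta> * (1 - \<theta> * \<theta>) * (x' * v m0) * (x' + v m0) / 4"
  have "\<theta> * \<theta> < 1 * 1" using \<theta> by (intro mult_strict_mono) auto
  then have c0: "0 < c0" unfolding c0_def
    using x n0 \<theta> by (intro divide_pos_pos mult_pos_pos add_pos_pos) auto
  have M: "0 < mtop \<mu>" using x mtop_bounds[OF \<mu>] by (auto simp: x'_def zero_less_mult_iff)
  \<comment> \<open>Missing the top by less than c0 / \<theta> costs less than c0 after scaling by
    \<theta>, which the gain makes up for.\<close>
  define z where "z = max 0 (mtop \<mu> - c0 / \<theta>)"
  have z: "0 \<le> z" "z < mtop \<mu>" using M c0 \<theta> by (auto simp: z_def)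
  obtain n1 where n1: "n1 \<in> set_pmf P" "z < v n1" using mtop_approx[OF f\<mu> z] by blast
  \<comment> \<open>The degree has to come close to the top and be at least Suc m0; as v is
    monotone, the larger of n1 and Suc m0 does both.\<close>
  obtain m where m: "Suc m \<in> set_pmf P" "m0 \<le> m" "z < v (Suc m)"
  proof (cases "Suc m0 \<le> n1")
    case True
    then obtain m where "n1 = Suc m" "m0 \<le> m" by (cases n1) auto
    with n1 that show thesis by blast
  next
    case False
    then have "v n1 \<le> v (Suc m0)" by (intro v_mono) simp
    with n1 n0 that[of m0] show thesis by simp
  qed
  have vm: "v m0 \<le> v m" by (rule v_mono[OF m(2)])
  have "\<theta> * mtop \<mu> - c0 = \<theta> * (mtop \<mu> - c0 / \<theta>)" using \<theta> by (simp add: field_simps)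
  also have "\<dots> < \<theta> * v (Suc m)" using m(3) \<theta> by (intro mult_strict_left_mono) (auto simp: z_def)
  also have "\<dots> \<le> vadd l (\<theta> * v m) - c0"
    using scaled_vadd_gap[OF x'_bounds insupp_bounds(1)[OF insupp_v] vm insupp_bounds(2)[OF insupp_v], of \<theta>] \<theta>
    by (simp add: c0_def l_def)
  finally have less: "b < vadd l (\<theta> * v m)" using b' by simp
  have "0 < v m" using vm n0 by simp
  from equality_grows[OF b'(1,2) fixed_point_equality[OF f\<mu> f\<nu> b'(1,3,4) m(1)] x this less]
  obtain a' where "b < a'" "a' \<le> \<theta> * mtop \<mu>" "mag (noise e \<mu>) a' = mag \<nu> a'" by blast
  with b(2)[of a'] b'(1) show False by auto
qed

end

section \<open>Comparison of fixed points by varying the scale\<close>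

lemma mag_noise_scale:
  assumes \<mu>: "symmetric_distribution \<mu>" and t: "0 \<le> t" "t \<le> 1"
  shows "mag (noise ((1 - t) / 2) \<mu>) a = (\<integral>r. max (t * \<bar>tau r\<bar>) a \<partial>\<mu>)"
proof -
  have "\<bar>1 - 2 * ((1 - t) / 2)\<bar> = t" "0 \<le> (1 - t) / 2" "(1 - t) / 2 \<le> 1" using t by (simp_all add: field_simps)
  then show ?thesis using mag_noise_eq[OF \<mu>, of "(1 - t) / 2" a] by simp
qed

lemma mag_noise_scale_0:
  assumes \<mu>: "symmetric_distribution \<mu>" and t: "0 \<le> t" "t \<le> 1"
  shows "mag (noise ((1 - t) / 2) \<mu>) 0 = t * mag \<mu> 0"
proof -
  have "(\<integral>r. max (t * \<bar>tau r\<bar>) 0 \<partial>\<mu>) = (\<integral>r. t * max \<bar>tau r\<bar> 0 \<partial>\<mu>)"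
    using t by (intro Bochner_Integration.integral_cong refl) (simp add: max_absorb1)
  also have "\<dots> = t * mag \<mu> 0" unfolding mag_def by (rule integral_mult_right_zero)
  finally show ?thesis unfolding mag_noise_scale[OF assms] .
qed

text \<open>As |tau| \<le> 1, changing the scale costs at most the change itself, uniformly in a. So
  a margin in \<open>mag\<close> can be spent on a larger scale.\<close>

lemma mag_noise_scale_lipschitz:
  assumes \<mu>: "symmetric_distribution \<mu>" and s: "0 \<le> s" "s \<le> 1" and t: "0 \<le> t" "t \<le> 1"
  shows "mag (noise ((1 - s) / 2) \<mu>) a \<le> mag (noise ((1 - t) / 2) \<mu>) a + \<bar>s - t\<bar>"
proof -
  interpret prob_space \<mu> using symmetric_distributionD[OF \<mu>] by simp
  have i: "integrable \<mu> (\<lambda>r. max (u * \<bar>tau r\<bar>) a)" for u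
    by (rule continuous_abs_tau_integrable[OF \<mu>, where h="\<lambda>x. max (u * x) a"]) (intro continuous_intros)
  have le: "max (s * \<bar>tau r\<bar>) a \<le> max (t * \<bar>tau r\<bar>) a + \<bar>s - t\<bar>" for r
  proof -
    have "(s - t) * \<bar>tau r\<bar> \<le> \<bar>s - t\<bar> * 1"
      using abs_tau_le_1[of r] by (intro mult_mono) auto
    then show ?thesis unfolding left_diff_distrib mult_1_right by linarith
  qed
  have "(\<integral>r. max (s * \<bar>tau r\<bar>) a \<partial>\<mu>) \<le> (\<integral>r. max (t * \<bar>tau r\<bar>) a + \<bar>s - t\<bar> \<partial>\<mu>)"
    using i le by (intro integral_mono) auto
  then show ?thesis using i by (simp add: mag_noise_scale[OF \<mu> s] mag_noise_scale[OF \<mu> t] prob_space)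
qed

text \<open>With D = \<open>mag \<nu> 0\<close>, the scaled value D * |tau| is at most D, while
  \<open>mag \<nu> a\<close> is at least both a and D.\<close>

lemma deg_noise_mag_0:
  assumes \<mu>: "symmetric_distribution \<mu>" and \<nu>: "symmetric_distribution \<nu>"
  shows "noise ((1 - mag \<nu> 0) / 2) \<mu> \<preceq> \<nu>"
  unfolding deg_def
proof
  interpret prob_space \<mu> using symmetric_distributionD[OF \<mu>] by simp
  let ?D = "mag \<nu> 0"
  have D: "0 \<le> ?D" "?D \<le> 1" using mag_bounds[OF \<nu>, of 0] by auto
  fix a :: real assume "a \<in> {0..1}"
  then have a: "0 \<le> a" by simp
  have "integrable \<mu> (\<lambda>r. max (?D * \<bar>tau r\<bar>) a)"
    by (rule continuous_abs_tau_integrable[OF \<mu>, where h="\<lambda>x. max (?D * x) a"]) (intro continuous_intros)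
  moreover have "max (?D * \<bar>tau r\<bar>) a \<le> max ?D a" for r
    using D abs_tau_le_1[of r] by (intro max.mono mult_left_le) auto
  ultimately have "(\<integral>r. max (?D * \<bar>tau r\<bar>) a \<partial>\<mu>) \<le> (\<integral>r. max ?D a \<partial>\<mu>)"
    by (intro integral_mono) auto
  also have "\<dots> = max ?D a" by (simp add: prob_space)
  also have "\<dots> \<le> mag \<nu> a"
    using mag_bounds(1)[OF \<nu>, of a] mag_mono[OF \<nu> a] by simp
  finally show "mag (noise ((1 - ?D) / 2) \<mu>) a \<le> mag \<nu> a" by (simp add: mag_noise_scale[OF \<mu> D])
qed

lemma fixed_point_le:
  assumes \<delta>: "0 \<le> \<delta>" "\<delta> \<le> 1" and S: "symmetric_distribution S"
    and \<mu>: "symmetric_distribution \<mu>" and \<nu>: "symmetric_distribution \<nu>"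
    and f\<mu>: "bp_operator \<delta> P S \<mu> = \<mu>" and f\<nu>: "bp_operator \<delta> P S \<nu> = \<nu>"
    and \<mu>0: "0 < mag \<mu> 0" and \<nu>0: "0 < mag \<nu> 0" and \<delta>': "\<delta> \<noteq> 1 / 2"
    and m0: "Suc m0 \<in> set_pmf P" "0 < (vadd (\<bar>1 - 2 * \<delta>\<bar> * mtop \<mu>) ^^ m0) (mtop S)"
  shows "\<mu> \<preceq> \<nu>"
proof -
  let ?N = "\<lambda>t. noise ((1 - t) / 2) \<mu>"
  define E where "E = {t. 0 \<le> t \<and> t \<le> 1 \<and> ?N t \<preceq> \<nu>}"
  have D: "mag \<nu> 0 \<in> E" using deg_noise_mag_0[OF \<mu> \<nu>] mag_bounds[OF \<nu>, of 0] by (simp add: E_def)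
  have bdd: "bdd_above E" by (rule bdd_aboveI[of _ 1]) (simp add: E_def)
  define t where "t = Sup E"
  have t: "0 < t" "t \<le> 1"
  proof -
    have "mag \<nu> 0 \<le> t" unfolding t_def by (rule cSup_upper[OF D bdd])
    then show "0 < t" using \<nu>0 by simp
    show "t \<le> 1" unfolding t_def using D by (intro cSup_least) (auto simp: E_def)
  qed
  \<comment> \<open>The supremum is attained, by continuity in the scale.\<close>
  have tE: "?N t \<preceq> \<nu>"
    unfolding deg_def
  proof
    fix a :: real assume a: "a \<in> {0..1}"
    show "mag (?N t) a \<le> mag \<nu> a"
    proof (rule field_le_epsilon)
      fix \<epsilon> :: real assume "0 < \<epsilon>"
      then obtain s where s: "s \<in> E" "t - \<epsilon> < s"
        using less_cSup_iff[of E "t - \<epsilon>"] D bdd by (auto simp: t_def)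
      have "s \<le> t" unfolding t_def by (rule cSup_upper[OF s(1) bdd])
      have s': "0 \<le> s" "s \<le> 1" "mag (?N s) a \<le> mag \<nu> a" using s(1) a by (auto simp: E_def deg_def)
      show "mag (?N t) a \<le> mag \<nu> a + \<epsilon>"
        using mag_noise_scale_lipschitz[OF \<mu> less_imp_le[OF t(1)] t(2) s'(1,2), of a] s' s(2) \<open>s \<le> t\<close> by simp
    qed
  qed
  have "t = 1"
  proof (rule ccontr)
    assume "t \<noteq> 1"
    then have t1: "t < 1" using t by simp
    define e where "e = (1 - t) / 2"
    have tt: "1 - 2 * e = t" by (simp add: e_def field_simps)
    interpret bp_pair \<delta> e P S \<mu> \<nu>
      by unfold_locales (use \<delta> S \<mu> \<nu> t t1 tE in \<open>auto simp: e_def\<close>)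
    have th: "\<theta> = t" by (simp add: \<theta>_def tt)
    let ?M = "mtop \<mu>"
    have M: "0 < ?M" "?M \<le> 1" using mtop_pos[OF \<mu> \<mu>0] mtop_bounds[OF \<mu>] by auto
    have x: "0 < x'" using M \<delta>' by (simp add: x'_def)
    have v: "0 < v m0" using m0(2) by (simp add: v_def x'_def)
    have str: "0 < mag \<nu> a - mag (?N t) a" if "a \<in> {0..t * ?M}" for a
      using strict[OF f\<mu> f\<nu> m0(1) v x, of a, unfolded th] that by (simp add: e_def)
    have NT: "symmetric_distribution (?N t)" by (intro symmetric_noise \<mu>) (use t in auto)
    \<comment> \<open>On a compact interval strictness yields a uniform margin.\<close>
    have "\<exists>b\<in>{0..t * ?M}. \<forall>a\<in>{0..t * ?M}. mag \<nu> b - mag (?N t) b \<le> mag \<nu> a - mag (?N t) a"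
      using t M by (intro continuous_attains_inf continuous_on_diff mag_continuous \<nu> NT) auto
    then obtain b where b: "b \<in> {0..t * ?M}" "\<And>a. a \<in> {0..t * ?M} \<Longrightarrow> mag \<nu> b - mag (?N t) b \<le> mag \<nu> a - mag (?N t) a"
      by blast
    define \<eta> where "\<eta> = mag \<nu> b - mag (?N t) b"
    have \<eta>: "0 < \<eta>" using str[OF b(1)] by (simp add: \<eta>_def)
    have gap: "mag (?N t) a + \<eta> \<le> mag \<nu> a" if "a \<in> {0..t * ?M}" for a
      using b(2)[OF that] by (simp add: \<eta>_def)
    \<comment> \<open>The Lipschitz constant in the scale is 1, so the margin \<eta> pays for an
      increase by \<eta>.\<close>
    define t' where "t' = min 1 (t + \<eta>)"
    have t': "t < t'" "t' \<le> 1" "t' \<le> t + \<eta>" "0 \<le> t'" using t1 t \<eta> by (auto simp: t'_def)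
    have "mag (?N t') a \<le> mag \<nu> a" if a: "a \<in> {0..1}" for a
    proof (cases "a \<le> t * ?M")
      case True
      then show ?thesis
        using mag_noise_scale_lipschitz[OF \<mu> t'(4,2) less_imp_le[OF t(1)] t(2), of a] gap[of a] a t' by simp
    next
      \<comment> \<open>No margin is known beyond t * ?M. From t' * ?M on, the scaled law has the
        identity as its \<open>mag\<close>; in between, monotonicity and ?M \<le> 1 lead back to the
        margin at t * ?M.\<close>
      case False
      have T': "mag (?N t') c = c" if "t' * ?M \<le> c" for c
      proof -
        have c: "0 \<le> c" "?M \<le> c / t'" using that t t' M by (auto simp: pos_le_divide_eq mult.commute intro: order_trans[rotated])
        have "\<bar>1 - 2 * ((1 - t') / 2)\<bar> = t'" "(1 - t') / 2 \<noteq> 1 / 2" using t t' by (auto simp: field_simps)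
        moreover have "mag \<mu> (c / t') = c / t'" by (rule mag_ge_mtop[OF \<mu> c(2)])
        ultimately show ?thesis
          using mag_noise[OF \<mu>, of "(1 - t') / 2" c] c t t' by (simp add: field_simps)
      qed
      have NT': "symmetric_distribution (?N t')" by (intro symmetric_noise \<mu>) (use t' in auto)
      show ?thesis
      proof (cases "t' * ?M \<le> a")
        case True
        then show ?thesis using T' mag_bounds(1)[OF \<nu>, of a] by simp
      next
        case F2: False
        have "mag (?N t') a \<le> mag (?N t') (t' * ?M)" using F2 by (intro mag_mono[OF NT']) simp
        also have "\<dots> = t' * ?M" by (rule T') simp
        also have "\<dots> \<le> (t + \<eta>) * ?M" using t'(3) M by (intro mult_right_mono) auto
        also have "\<dots> \<le> t * ?M + \<eta>" using M \<eta> by (simp add: distrib_right mult_left_le)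
        also have "\<dots> \<le> mag (?N t) (t * ?M) + \<eta>" using mag_bounds(1)[OF NT, of "t * ?M"] by simp
        also have "\<dots> \<le> mag \<nu> (t * ?M)" using t M by (intro gap) auto
        also have "\<dots> \<le> mag \<nu> a" using False by (intro mag_mono[OF \<nu>]) simp
        finally show ?thesis .
      qed
    qed
    then have "t' \<in> E" using t' t by (simp add: E_def deg_def)
    then have "t' \<le> t" unfolding t_def by (rule cSup_upper[OF _ bdd])
    with t'(1) show False by simp
  qed
  then show ?thesis using tE mag_noise_scale[OF \<mu>, of 1] by (simp add: deg_def mag_def)
qed

text \<open>Strictness needs an informative child next to something else informative, a second child
  or the survey. The other parameters are degenerate: for \<delta> = 1 / 2 or degree 0 the image
  does not depend on the input, and the rest is a chain without survey.\<close>

lemma nontrivial_fixed_point_le: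
  assumes \<delta>: "0 \<le> \<delta>" "\<delta> \<le> 1" and S: "symmetric_distribution S"
    and ex: "\<not> (S = trivial_distribution \<and> (AE d in measure_pmf P. d = 1) \<and> \<delta> \<in> {0, 1})"
    and \<mu>: "symmetric_distribution \<mu>" and \<nu>: "symmetric_distribution \<nu>"
    and f\<mu>: "bp_operator \<delta> P S \<mu> = \<mu>" and f\<nu>: "bp_operator \<delta> P S \<nu> = \<nu>"
    and \<mu>0: "0 < mag \<mu> 0" and \<nu>0: "0 < mag \<nu> 0"
  shows "\<mu> \<preceq> \<nu>"
proof -
  let ?r = "\<bar>1 - 2 * \<delta>\<bar>"
  note sn = symmetric_noise[OF \<mu> \<delta>] symmetric_noise[OF \<nu> \<delta>]
  consider (half) "\<delta> = 1 / 2" | (zero) "set_pmf P \<subseteq> {0}"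
    | (main) m0 where "\<delta> \<noteq> 1 / 2" "Suc m0 \<in> set_pmf P" "0 < mtop S \<or> 0 < m0"
    | (chain) "mtop S = 0" "set_pmf P \<subseteq> {0, 1}"
  proof -
    have "mtop S = 0" if "\<not> 0 < mtop S" using that mtop_bounds[OF S] by simp
    moreover have "set_pmf P \<subseteq> {0, 1}" if "\<And>m0. Suc m0 \<in> set_pmf P \<Longrightarrow> \<not> 0 < m0"
    proof
      fix n assume "n \<in> set_pmf P"
      with that show "n \<in> {0, 1}" by (cases n) auto
    qed
    moreover have "\<exists>m0. Suc m0 \<in> set_pmf P" if "\<not> set_pmf P \<subseteq> {0}"
      using that by (metis insertI1 not0_implies_Suc subsetI)
    ultimately show thesis using that by metis
  qed
  then show ?thesis
  proof cases
    case half
    have "mag (noise \<delta> \<kappa>) a = a" if "symmetric_distribution \<kappa>" "0 \<le> a" for \<kappa> a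
      by (rule trans[OF mag_noise[OF that(1) \<delta> that(2)] if_P[OF half]])
    then have "noise \<delta> \<mu> = noise \<delta> \<nu>"
      using \<mu> \<nu> by (intro mag_inject[OF sn]) simp
    then have "mag (bp_operator \<delta> P S \<mu>) a = mag (bp_operator \<delta> P S \<nu>) a" for a
      by (simp add: mag_bp_operator[OF \<mu> S] mag_bp_operator[OF \<nu> S])
    then show ?thesis by (simp add: f\<mu> f\<nu> deg_def)
  next
    case zero
    have "mag (bp_operator \<delta> P S \<kappa>) a = mag S a" if "symmetric_distribution \<kappa>" for \<kappa> a
    proof -
      have "(\<integral>d. mag (iconv_pow (noise \<delta> \<kappa>) d S) a \<partial>measure_pmf P) = (\<integral>d. mag S a \<partial>measure_pmf P)"
        using zero by (intro integral_cong_AE) (auto simp: AE_measure_pmf_iff)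
      then show ?thesis by (simp add: mag_bp_operator[OF that S])
    qed
    from this[OF \<mu>] this[OF \<nu>] show ?thesis by (simp add: f\<mu> f\<nu> deg_def)
  next
    case main
    have x: "0 < ?r * mtop \<mu>" "?r * mtop \<mu> \<le> 1"
      using mtop_pos[OF \<mu> \<mu>0] mtop_bounds[OF \<mu>] main(1) \<delta> by (auto intro!: mult_le_one)
    have b: "0 \<le> (vadd (?r * mtop \<mu>) ^^ m) (mtop S) \<and> (vadd (?r * mtop \<mu>) ^^ m) (mtop S) \<le> 1 \<and>
        mtop S \<le> (vadd (?r * mtop \<mu>) ^^ m) (mtop S)" for m
    proof (induction m)
      case (Suc m)
      then show ?case using vadd_bounds[of "?r * mtop \<mu>" "(vadd (?r * mtop \<mu>) ^^ m) (mtop S)"] x by simp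
    qed (simp add: mtop_bounds[OF S])
    have "0 < (vadd (?r * mtop \<mu>) ^^ m0) (mtop S)"
    proof (cases m0)
      case 0
      then show ?thesis using main(3) by simp
    next
      case (Suc m)
      then show ?thesis
        using vadd_bounds(3)[of "?r * mtop \<mu>" "(vadd (?r * mtop \<mu>) ^^ m) (mtop S)"] x b[of m] by simp
    qed
    then show ?thesis
      by (rule fixed_point_le[OF \<delta> S \<mu> \<nu> f\<mu> f\<nu> \<mu>0 \<nu>0 main(1,2)])
  next
    case chain
    have St: "S = trivial_distribution"
      by (rule mag_inject[OF S symmetric_trivial]) (simp add: mag_trivial mag_ge_mtop[OF S] chain(1))
    \<comment> \<open>In a chain the mean of |tau| is scaled by |1 - 2 * \<delta>| if there is a
      child, and is 0 otherwise.\<close>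
    have W: "mag (iconv_pow (noise \<delta> \<mu>) d S) 0 = indicator {1} d * (?r * mag \<mu> 0)" if "d \<in> set_pmf P" for d
    proof -
      have "mag (noise \<delta> \<mu> \<star>\<star> S) 0 = mag (noise \<delta> \<mu>) 0"
        using measurable_mag[OF sn(1)]
        by (subst mag_0_iconv[OF sn(1) S]) (simp add: St trivial_distribution_def integral_return)
      moreover have "mag (noise \<delta> \<mu>) 0 = ?r * mag \<mu> 0"
        using mag_noise[OF \<mu> \<delta>, of 0] by simp
      moreover have "d = 0 \<or> d = 1" using chain(2) that by auto
      ultimately show ?thesis by (auto simp: St mag_trivial)
    qed
    have "mag \<mu> 0 = (\<integral>d. mag (iconv_pow (noise \<delta> \<mu>) d S) 0 \<partial>measure_pmf P)"
      using mag_bp_operator[OF \<mu> S, of \<delta> P 0] by (simp add: f\<mu>)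
    also have "\<dots> = (\<integral>d. indicator {1} d * (?r * mag \<mu> 0) \<partial>measure_pmf P)"
      by (intro integral_cong_AE) (auto simp: AE_measure_pmf_iff W)
    also have "\<dots> = pmf P 1 * (?r * mag \<mu> 0)"
      by (simp add: pmf.rep_eq)
    finally have "mag \<mu> 0 * (pmf P 1 * ?r) = mag \<mu> 0 * 1" by (simp add: mult_ac)
    \<comment> \<open>A positive mean survives only if both factors are 1, which is the excluded
      identity operator.\<close>
    then have pr: "pmf P 1 * ?r = 1" using \<mu>0 by (simp only: mult_left_cancel)
    have r1: "?r \<le> 1" using \<delta> by auto
    have "pmf P 1 * ?r \<le> pmf P 1" "pmf P 1 * ?r \<le> ?r"
      using r1 pmf_le_1[of P 1] by (auto intro: mult_left_le mult_left_le_one_le)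
    then have "pmf P 1 = 1" "?r = 1" using pr r1 pmf_le_1[of P 1] by linarith+
    then have "AE d in measure_pmf P. d = 1" "\<delta> \<in> {0, 1}"
      using measure_pmf.prob_eq_1[of "{1}" P] by (auto simp: pmf.rep_eq abs_if split: if_splits)
    with ex St show ?thesis by simp
  qed
qed

section \<open>Convergence of the iterates\<close>

lemma deg_bp_iterate:
  assumes \<delta>: "0 \<le> \<delta>" "\<delta> \<le> 1" and S: "symmetric_distribution S"
    and \<mu>: "symmetric_distribution \<mu>" and \<nu>: "symmetric_distribution \<nu>" and "\<mu> \<preceq> \<nu>"
  shows "(bp_operator \<delta> P S ^^ h) \<mu> \<preceq> (bp_operator \<delta> P S ^^ h) \<nu>"
    "symmetric_distribution ((bp_operator \<delta> P S ^^ h) \<mu>)" "symmetric_distribution ((bp_operator \<delta> P S ^^ h) \<nu>)"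
proof (induction h)
  case (Suc h)
  show "(bp_operator \<delta> P S ^^ Suc h) \<mu> \<preceq> (bp_operator \<delta> P S ^^ Suc h) \<nu>"
    using deg_bp_operator[OF Suc.IH(2,3) S \<delta> Suc.IH(1)] by simp
  show "symmetric_distribution ((bp_operator \<delta> P S ^^ Suc h) \<mu>)" "symmetric_distribution ((bp_operator \<delta> P S ^^ Suc h) \<nu>)"
    using symmetric_bp_operator[OF Suc.IH(2) S \<delta>] symmetric_bp_operator[OF Suc.IH(3) S \<delta>] by simp_all
qed (use assms in simp_all)

theorem theorem1:
  fixes \<delta> :: real and P\<^sub>d :: "nat pmf" and \<mu>\<^sub>s :: "ereal measure"
  assumes "0 \<le> \<delta>" and "\<delta> \<le> 1"
    and "symmetric_distribution \<mu>\<^sub>s"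
    and "\<not> (\<mu>\<^sub>s = trivial_distribution \<and> (AE d in measure_pmf P\<^sub>d. d = 1) \<and> \<delta> \<in> {0, 1})"
  shows "(\<exists>\<^sub>\<le>\<^sub>1 \<mu>. nontrivial_bp_fixed_point \<delta> P\<^sub>d \<mu>\<^sub>s \<mu>) \<and>
    (\<forall>\<mu>_star. nontrivial_bp_fixed_point \<delta> P\<^sub>d \<mu>\<^sub>s \<mu>_star \<longrightarrow>
      (\<forall>\<mu>. symmetric_distribution \<mu> \<and> \<mu> \<noteq> trivial_distribution \<longrightarrow>
        weakly_converges (\<lambda>h. (bp_operator \<delta> P\<^sub>d \<mu>\<^sub>s ^^ h) \<mu>) \<mu>_star)) \<and>
    ((\<nexists>\<mu>_star. nontrivial_bp_fixed_point \<delta> P\<^sub>d \<mu>\<^sub>s \<mu>_star) \<longrightarrow>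
      bp_fixed_point \<delta> P\<^sub>d \<mu>\<^sub>s trivial_distribution \<and>
      (\<forall>\<mu>. symmetric_distribution \<mu> \<and> \<mu> \<noteq> trivial_distribution \<longrightarrow>
        weakly_converges (\<lambda>h. (bp_operator \<delta> P\<^sub>d \<mu>\<^sub>s ^^ h) \<mu>) trivial_distribution))"
proof -
  note \<delta> = assms(1,2) and S = assms(3)
  let ?Q = "bp_operator \<delta> P\<^sub>d \<mu>\<^sub>s" and ?fp = "nontrivial_bp_fixed_point \<delta> P\<^sub>d \<mu>\<^sub>s"
  let ?top = "return borel \<infinity> :: ereal measure"
  have fpD: "symmetric_distribution \<mu>" "?Q \<mu> = \<mu>" "0 < mag \<mu> 0" if "?fp \<mu>" for \<mu>
    using that mag_0_pos[of \<mu>] by (auto simp: nontrivial_bp_fixed_point_def bp_fixed_point_def)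
  have fpI: "?fp \<mu>" if "symmetric_distribution \<mu>" "?Q \<mu> = \<mu>" "0 < mag \<mu> 0" for \<mu>
    using that mag_trivial[of 0] by (auto simp: nontrivial_bp_fixed_point_def bp_fixed_point_def)
  have unique: "\<mu> = \<nu>" if "?fp \<mu>" "?fp \<nu>" for \<mu> \<nu>
  proof -
    note m = fpD[OF that(1)] and n = fpD[OF that(2)]
    note le = nontrivial_fixed_point_le[OF \<delta> S assms(4)]
    show ?thesis
      by (rule deg_antisym[OF m(1) n(1) le[OF m(1) n(1) m(2) n(2) m(3) n(3)] le[OF n(1) m(1) n(2) m(2) n(3) m(3)]])
  qed
  \<comment> \<open>The limit of the iterates of perfect information; it bounds every fixed point
    and, in the limit, all iterates from above.\<close>
  obtain U where U: "symmetric_distribution U" "?Q U = U"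
      "\<And>a. 0 \<le> a \<Longrightarrow> a \<le> 1 \<Longrightarrow> (\<lambda>h. mag ((?Q ^^ h) ?top) a) \<longlonglongrightarrow> mag U a"
  proof (rule bp_iterate_limit[OF symmetric_top S \<delta> disjI2[OF deg_top[OF symmetric_bp_operator[OF symmetric_top S \<delta>]]]])
    fix K
    assume "symmetric_distribution K" "?Q K = K"
      "\<And>a. 0 \<le> a \<Longrightarrow> a \<le> 1 \<Longrightarrow> (\<lambda>h. mag ((?Q ^^ h) ?top) a) \<longlonglongrightarrow> mag K a"
    then show thesis by (rule that)
  qed
  have sym: "symmetric_distribution ((?Q ^^ h) \<mu>)" if "symmetric_distribution \<mu>" for \<mu> h
    by (rule deg_bp_iterate(2)[OF \<delta> S that that deg_refl])
  have upper: "mag ((?Q ^^ h) \<mu>) a \<le> mag ((?Q ^^ h) ?top) a"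
    if "symmetric_distribution \<mu>" "0 \<le> a" "a \<le> 1" for \<mu> h a
    by (rule degD[OF deg_bp_iterate(1)[OF \<delta> S that(1) symmetric_top deg_top[OF that(1)]] that(2,3)])
  have star: "weakly_converges (\<lambda>h. (?Q ^^ h) \<mu>) \<nu>"
    if fp: "?fp \<nu>" and \<mu>: "symmetric_distribution \<mu>" and nt: "\<mu> \<noteq> trivial_distribution" for \<mu> \<nu>
  proof -
    note \<nu> = fpD[OF fp]
    have it: "(?Q ^^ h) \<nu> = \<nu>" for h by (induction h) (simp_all add: \<nu>)
    \<comment> \<open>Being fixed, \<nu> stays below the iterates from the top, so U is nontrivial
      as well.\<close>
    have "mag \<nu> 0 \<le> mag U 0"
      using upper[OF \<nu>(1), of 0] it by (intro LIMSEQ_le_const[OF U(3)]) auto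
    then have U\<nu>: "U = \<nu>" using \<nu>(3) by (intro unique[OF fpI[OF U(1,2)] fp]) simp
    let ?D = "mag \<mu> 0"
    let ?e = "(1 - ?D) / 2"
    have D: "0 < ?D" "?D \<le> 1" using mag_0_pos[OF \<mu> nt] mag_bounds[OF \<mu>, of 0] by auto
    have e: "0 \<le> ?e" "?e \<le> 1" using D by auto
    note sL = symmetric_noise[OF \<nu>(1) e]
    \<comment> \<open>A degraded fixed point only improves under the operator, so its iterates
      increase; the scale ?D puts it below \<mu>.\<close>
    have inc: "noise ?e \<nu> \<preceq> ?Q (noise ?e \<nu>)"
      using deg_noise_bp[OF \<nu>(1) S e \<delta>, of P\<^sub>d] by (simp add: \<nu>(2))
    obtain K where K: "symmetric_distribution K" "?Q K = K"
        "\<And>a. 0 \<le> a \<Longrightarrow> a \<le> 1 \<Longrightarrow> (\<lambda>h. mag ((?Q ^^ h) (noise ?e \<nu>)) a) \<longlonglongrightarrow> mag K a"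
        "noise ?e \<nu> \<preceq> K"
    proof (rule bp_iterate_limit[OF sL S \<delta> disjI1[OF inc]])
      fix K
      assume "symmetric_distribution K" "?Q K = K"
        "\<And>a. 0 \<le> a \<Longrightarrow> a \<le> 1 \<Longrightarrow> (\<lambda>h. mag ((?Q ^^ h) (noise ?e \<nu>)) a) \<longlonglongrightarrow> mag K a"
        "noise ?e \<nu> \<preceq> ?Q (noise ?e \<nu>) \<Longrightarrow> noise ?e \<nu> \<preceq> K"
      with inc show thesis by (intro that)
    qed
    have "mag (noise ?e \<nu>) 0 = ?D * mag \<nu> 0"
      by (rule mag_noise_scale_0[OF \<nu>(1) less_imp_le[OF D(1)] D(2)])
    then have "0 < mag (noise ?e \<nu>) 0" using D(1) \<nu>(3) by (simp only: mult_pos_pos)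
    also have "\<dots> \<le> mag K 0" by (rule degD[OF K(4)]) simp_all
    finally have "0 < mag K 0" .
    then have K\<nu>: "K = \<nu>" by (intro unique[OF fpI[OF K(1,2)] fp])
    show ?thesis
    proof (rule weakly_convergesI[OF sym[OF \<mu>] \<nu>(1)])
      fix a :: real assume a: "0 \<le> a" "a \<le> 1"
      show "(\<lambda>h. mag ((?Q ^^ h) \<mu>) a) \<longlonglongrightarrow> mag \<nu> a"
      proof (rule tendsto_sandwich[OF _ _ K(3)[OF a, unfolded K\<nu>] U(3)[OF a, unfolded U\<nu>]]; intro always_eventually allI)
        fix h
        show "mag ((?Q ^^ h) (noise ?e \<nu>)) a \<le> mag ((?Q ^^ h) \<mu>) a"
          by (rule degD[OF deg_bp_iterate(1)[OF \<delta> S sL \<mu> deg_noise_mag_0[OF \<nu>(1) \<mu>]] a])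
      qed (rule upper[OF \<mu> a])
    qed
  qed
  have none: "bp_fixed_point \<delta> P\<^sub>d \<mu>\<^sub>s trivial_distribution \<and>
      (\<forall>\<mu>. symmetric_distribution \<mu> \<and> \<mu> \<noteq> trivial_distribution \<longrightarrow>
        weakly_converges (\<lambda>h. (?Q ^^ h) \<mu>) trivial_distribution)"
    if no: "\<nexists>\<nu>. ?fp \<nu>"
  proof -
    \<comment> \<open>Now the upper bound tends to a, which is also the least possible value of
      \<open>mag\<close> at a; so the lower side of the sandwich is constant.\<close>
    have Ut: "U = trivial_distribution" using no U(1,2) by (auto simp: nontrivial_bp_fixed_point_def bp_fixed_point_def)
    have "weakly_converges (\<lambda>h. (?Q ^^ h) \<mu>) trivial_distribution" if \<mu>: "symmetric_distribution \<mu>" for \<mu>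
    proof (rule weakly_convergesI[OF sym[OF \<mu>] symmetric_trivial])
      fix a :: real assume a: "0 \<le> a" "a \<le> 1"
      have t: "mag trivial_distribution a = a" by (rule mag_trivial[OF a(1)])
      show "(\<lambda>h. mag ((?Q ^^ h) \<mu>) a) \<longlonglongrightarrow> mag trivial_distribution a"
        unfolding t
        by (rule tendsto_sandwich[OF _ _ tendsto_const U(3)[OF a, unfolded Ut t]])
           (intro always_eventually allI mag_bounds(1)[OF sym[OF \<mu>]] upper[OF \<mu> a])+
    qed
    moreover have "bp_fixed_point \<delta> P\<^sub>d \<mu>\<^sub>s trivial_distribution"
      using U(1,2) by (simp add: bp_fixed_point_def Ut)
    ultimately show ?thesis by blast
  qed
  have "\<exists>\<^sub>\<le>\<^sub>1 \<mu>. ?fp \<mu>" by (rule Uniq_I) (rule unique)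
  moreover have "\<forall>\<nu>. ?fp \<nu> \<longrightarrow> (\<forall>\<mu>. symmetric_distribution \<mu> \<and> \<mu> \<noteq> trivial_distribution \<longrightarrow>
      weakly_converges (\<lambda>h. (?Q ^^ h) \<mu>) \<nu>)"
    by (intro allI impI, elim conjE) (rule star)
  ultimately show ?thesis using none by simp
qed

end
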